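(* For each $n$ let $\mathbf X_n$ be a $p\times n$ matrix ($p=p(n)$) of i.i.d. real random variables with zero mean and unit variance, let $\mathbf\Sigma_n=\sigma^2\mathbf I_p$ with $\sigma^2>0$, and put $\mathbf Y_n=\mathbf\Sigma_n^{1/2}\mathbf X_n$, $\mathbf S_n=\frac1n\mathbf Y_n\mathbf Y_n'$. Assume $\frac pn\to c\in(1,\infty)$ as $n\to\infty$. Then the empirical spectral distribution function $F^{\mathbf S_n^+}$ of the Moore-Penrose inverse of $\mathbf S_n$ converges weakly almost surely to a deterministic distribution function $P$ with Stieltjes transform $$m_P(z)=-\frac1z\Bigg(1+\frac{-1/z+(c-1)\sigma^2+\sqrt{(1/z-c\sigma^2+\sigma^2)^2-\frac4z\sigma^2}}{2\sigma^2c}\Bigg).$$ Moreover, the limiting distribution is given by $$P=(1-c^{-1})\,\delta_0+\nu(x)\,dx,$$ where $\delta_a$ denotes the Dirac measure at $a\in\mathbb R$ and $$\nu(x)=\begin{cases}c^{-1}\,\dfrac{\sqrt{(\lambda_+-1/x)(1/x-\lambda_-)}}{2\pi\sigma^2x}, & x\in[\lambda_+^{-1},\lambda_-^{-1}],\\[2mm] 0,&\text{otherwise,}\end{cases}$$ with $\lambda_+=\sigma^2(1+\sqrt c)^2$ and $\lambda_-=\sigma^2(1-\sqrt c)^2$.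
   Context: For a symmetric $p\times p$ matrix $\mathbf A$ with eigenvalues $\lambda_1(\mathbf A)\ge\dots\ge\lambda_p(\mathbf A)$, $F^{\mathbf A}(t)=\frac1p\sum_{i=1}^p\mathbb 1\{\lambda_i(\mathbf A)\le t\}$. $\mathbf A^+$ denotes the Moore-Penrose inverse of $\mathbf A$. The Stieltjes transform of a distribution function $G$ is $m_G(z)=\int_{-\infty}^{+\infty}\frac{1}{\lambda-z}dG(\lambda)$ for $z\in\mathbb C^+$ (upper half-plane). The branch of the square root in $m_P$ is the analytic one on $\mathbb C^+$ for which $m_P$ is the Stieltjes transform of a probability distribution. *)

theory Defs
  imports
    "HOL-Probability.Probability"
    "Jordan_Normal_Form.Char_Poly"
begin

subsection \<open>Real matrices\<close>

text \<open>
  Eigenvalues with (algebraic) multiplicity in decreasing order. For a symmetric real matrix the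
  characteristic polynomial splits over the reals, so that the list has one entry per row.
\<close>
definition eigenvalues_desc :: "real mat \<Rightarrow> real list" where
  "eigenvalues_desc A = rev (sorted_list_of_multiset (proots (char_poly A)))"

text \<open>Empirical spectral distribution function; the eigenvalues are indexed from 0.\<close>
definition esd :: "real mat \<Rightarrow> real \<Rightarrow> real" where
  "esd A t = (1 / real (dim_row A)) *
     (\<Sum>i<dim_row A. indicator {s. s \<le> t} (eigenvalues_desc A ! i))"

text \<open>The four Penrose conditions, which determine \<open>B\<close> uniquely.\<close>
definition is_moore_penrose :: "real mat \<Rightarrow> real mat \<Rightarrow> bool" where
  "is_moore_penrose A B \<longleftrightarrow>
     B \<in> carrier_mat (dim_col A) (dim_row A) \<and>
     A * B * A = A \<and> B * A * B = B \<and>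
     transpose_mat (A * B) = A * B \<and> transpose_mat (B * A) = B * A"

definition moore_penrose :: "real mat \<Rightarrow> real mat" where
  "moore_penrose A = (THE B. is_moore_penrose A B)"

definition pos_semidef :: "real mat \<Rightarrow> bool" where
  "pos_semidef A \<longleftrightarrow>
     A \<in> carrier_mat (dim_row A) (dim_row A) \<and> transpose_mat A = A \<and>
     (\<forall>v \<in> carrier_vec (dim_row A). 0 \<le> scalar_prod v (A *\<^sub>v v))"

text \<open>The unique symmetric positive semidefinite square root of a positive semidefinite matrix.\<close>
definition mat_sqrt :: "real mat \<Rightarrow> real mat" where
  "mat_sqrt A = (THE B. pos_semidef B \<and> dim_row B = dim_row A \<and> B * B = A)"

text \<open>
  The matrix \<open>(1/n) Y Y'\<close> with \<open>Y = V^(1/2) X\<close>, where \<open>V\<close> is the population covariance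
  and \<open>n\<close> the number of columns of \<open>X\<close>.
\<close>
definition sample_cov :: "real mat \<Rightarrow> real mat \<Rightarrow> real mat" where
  "sample_cov V X =
     (let Y = mat_sqrt V * X in (1 / real (dim_col X)) \<cdot>\<^sub>m (Y * transpose_mat Y))"


subsection \<open>The limiting distribution\<close>

text \<open>The measure \<open>G\<close> stands for the distribution function \<open>cdf G\<close>.\<close>
definition stieltjes_transform :: "real measure \<Rightarrow> complex \<Rightarrow> complex" where
  "stieltjes_transform G z = (LINT x|G. 1 / (complex_of_real x - z))"

definition mP_radicand :: "real \<Rightarrow> real \<Rightarrow> complex \<Rightarrow> complex" where
  "mP_radicand c \<sigma> z =
     (1 / z - of_real (c * \<sigma>\<^sup>2) + of_real (\<sigma>\<^sup>2))\<^sup>2 - 4 / z * of_real (\<sigma>\<^sup>2)"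

text \<open>The function \<open>r\<close> takes the place of the square root of \<open>mP_radicand c \<sigma>\<close>.\<close>
definition mP :: "real \<Rightarrow> real \<Rightarrow> (complex \<Rightarrow> complex) \<Rightarrow> complex \<Rightarrow> complex" where
  "mP c \<sigma> r z =
     - (1 / z) * (1 + (- 1 / z + of_real ((c - 1) * \<sigma>\<^sup>2) + r z) / of_real (2 * \<sigma>\<^sup>2 * c))"

text \<open>
  The branch of the square root: analytic on the upper half-plane, and such that the resulting
  function \<open>mP\<close> is the Stieltjes transform of some probability distribution. The values of \<open>r\<close>
  outside the upper half-plane are irrelevant.
\<close>
definition mP_branch :: "real \<Rightarrow> real \<Rightarrow> (complex \<Rightarrow> complex) \<Rightarrow> bool" where
  "mP_branch c \<sigma> r \<longleftrightarrow>
     r analytic_on {z. 0 < Im z} \<and>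
     (\<forall>z. 0 < Im z \<longrightarrow> (r z)\<^sup>2 = mP_radicand c \<sigma> z) \<and>
     (\<exists>Q. real_distribution Q \<and> (\<forall>z. 0 < Im z \<longrightarrow> stieltjes_transform Q z = mP c \<sigma> r z))"

definition lambda_plus :: "real \<Rightarrow> real \<Rightarrow> real" where
  "lambda_plus c \<sigma> = \<sigma>\<^sup>2 * (1 + sqrt c)\<^sup>2"

definition lambda_minus :: "real \<Rightarrow> real \<Rightarrow> real" where
  "lambda_minus c \<sigma> = \<sigma>\<^sup>2 * (1 - sqrt c)\<^sup>2"

definition nu :: "real \<Rightarrow> real \<Rightarrow> real \<Rightarrow> real" where
  "nu c \<sigma> x =
     (if x \<in> {inverse (lambda_plus c \<sigma>)..inverse (lambda_minus c \<sigma>)}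
      then inverse c * (sqrt ((lambda_plus c \<sigma> - 1 / x) * (1 / x - lambda_minus c \<sigma>))
             / (2 * pi * \<sigma>\<^sup>2 * x))
      else 0)"

end

theory Submission
  imports Defs "HOL-Probability.Hoeffding"
begin

text \<open>
  With \<open>R = (S + t)\<^sup>-\<^sup>1\<close>, \<open>t > 0\<close>, the Sherman-Morrison formula turns the identity \<open>tr (R (S + t)) = p\<close> into
  \<open>p - t tr R = \<Sum>j. q j / (1 + q j)\<close>, where \<open>q j\<close> is the quadratic form of the resolvent without
  column \<open>j\<close>, evaluated at the independent column \<open>j\<close>. Under second moments alone \<open>q j\<close> concentrates
  in \<open>L\<^sup>1\<close> around \<open>g = tr R / n\<close>, so the mean of \<open>g\<close> tends to the root of \<open>t g + g / (1 + g) = c\<close>;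
  changing one column moves \<open>tr R\<close> by at most \<open>1 / t\<close>, so McDiarmid's inequality and Borel-Cantelli give
  almost sure convergence. Real resolvents suffice: the functions \<open>u / (1 + s u)\<close> of \<open>u = 1 / (1 + \<lambda>)\<close>
  generate all polynomials on \<open>[0, 1]\<close>. Inverting eigenvalues is discontinuous only at 0, where the mass
  \<open>1 - 1 / c\<close> is pinned down by the rank bound from below and by the averages of \<open>u ^ k\<close> from above.
  The transform of the limit law reduces, after \<open>1 / x = m + h cos \<theta>\<close>, to a Poisson-kernel integral.
\<close>

unbundle no inner_syntax
unbundle no vec_syntax
unbundle no fps_syntax

subsection \<open>Spectral theorem for real symmetric matrices\<close>

text \<open>The matrices for different \<open>n\<close> carry no joint structure, so almost sure
  convergence has to come from probability bounds that are summable in \<open>n\<close>. McDiarmid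
  over columns gives exponential ones from the bounded effect of a column on the resolvent trace,
  whatever the tails of the entries. Moments enter only in the mean, and only the second: off the
  diagonal it controls the variance of a quadratic form, on the diagonal truncation supplies the law
  of large numbers. A positive shift keeps everything real and monotone:
  \<open>t * y + y / (1 + y)\<close> has slope at least \<open>t\<close> for nonnegative
  \<open>y\<close>, so an approximate solution of the limiting equation is close to its root. The
  shifts \<open>1 + s\<close> with \<open>s = 1 / (j + 1)\<close> come from
  \<open>1 / (\<lambda> + 1 + s) = u / (1 + s * u)\<close>; being countably many, they share one
  null set. The variance is scaled out: the random-matrix estimates treat unit variance, and
  \<open>\<sigma>\<close> reappears only in the shift \<open>t / \<sigma>^2\<close>.\<close>

lemma symmetric_real_eigenvalue:
  fixes A :: "real mat"
  assumes A: "A \<in> carrier_mat n n" and sym: "transpose_mat A = A" and n: "0 < n"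
  obtains l where "eigenvalue A l"
proof -
  let ?Ac = "map_mat complex_of_real A"
  have Ac: "?Ac \<in> carrier_mat n n" using A by simp
  obtain as where as: "char_poly ?Ac = (\<Prod>a\<leftarrow>as. [:- a, 1:])" "length as = n"
    using char_poly_factorized[OF Ac] by blast
  then obtain a where "a \<in> set as" using n by (metis length_greater_0_conv list.set_intros(1) neq_Nil_conv)
  then have root: "poly (char_poly ?Ac) a = 0"
    by (simp add: as poly_prod_list prod_list_zero_iff)
  then obtain v where ev: "eigenvector ?Ac v a"
    using eigenvalue_root_char_poly[OF Ac] unfolding eigenvalue_def by blast
  then have v: "v \<in> carrier_vec n" "v \<noteq> 0\<^sub>v n" and Av: "?Ac *\<^sub>v v = a \<cdot>\<^sub>v v"
    using A unfolding eigenvector_def by auto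
  have entry: "(\<Sum>j<n. complex_of_real (A $$ (i,j)) * v $ j) = a * v $ i" if "i < n" for i
    using arg_cong[OF Av, of "\<lambda>w. w $ i"] that v A
    by (simp add: scalar_prod_def row_def atLeast0LessThan)
  have symA: "A $$ (i,j) = A $$ (j,i)" if "i < n" "j < n" for i j
    using that A arg_cong[OF sym, of "\<lambda>B. B $$ (j,i)"] by simp
  \<comment> \<open>\<open>N\<close> is the squared norm of the complex eigenvector and
    \<open>a * N\<close> the Hermitian form of \<open>A\<close> at it. Symmetry of \<open>A\<close>
    makes that form equal to its own conjugate, so \<open>a\<close> is real.\<close>
  define N where "N = (\<Sum>i<n. v $ i * cnj (v $ i))"
  have eq1: "a * N = (\<Sum>i<n. \<Sum>j<n. complex_of_real (A $$ (i,j)) * v $ j * cnj (v $ i))"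
    by (simp add: N_def sum_distrib_left entry flip: sum_distrib_right mult.assoc)
  have "cnj (a * N) = (\<Sum>i<n. \<Sum>j<n. complex_of_real (A $$ (i,j)) * cnj (v $ j) * v $ i)"
    unfolding eq1 by simp
  also have "\<dots> = (\<Sum>j<n. \<Sum>i<n. complex_of_real (A $$ (i,j)) * cnj (v $ j) * v $ i)"
    by (rule sum.swap)
  also have "\<dots> = a * N"
    unfolding eq1 by (intro sum.cong refl) (simp add: symA mult_ac)
  finally have "cnj (a * N) = a * N" .
  moreover have Nr: "N = complex_of_real (\<Sum>i<n. (cmod (v $ i))\<^sup>2)"
    by (simp add: N_def complex_mult_cnj cmod_power2)
  moreover have "(\<Sum>i<n. (cmod (v $ i))\<^sup>2) \<noteq> 0"
  proof
    assume "(\<Sum>i<n. (cmod (v $ i))\<^sup>2) = 0"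
    then have "\<And>i. i < n \<Longrightarrow> v $ i = 0" by (simp add: sum_nonneg_eq_0_iff)
    then show False using v by (auto intro!: eq_vecI)
  qed
  ultimately have "cnj a = a" by (metis (mono_tags, lifting) complex_cnj_complex_of_real complex_cnj_mult mult_cancel_right of_real_eq_0_iff)
  then have "a = complex_of_real (Re a)" by (simp add: complex_eq_iff)
  then have "poly (map_poly complex_of_real (char_poly A)) (complex_of_real (Re a)) = 0"
    using root of_real_hom.char_poly_hom[OF A, where 'a=complex] by simp
  then have "poly (char_poly A) (Re a) = 0" by simp
  then show ?thesis using that eigenvalue_root_char_poly[OF A] by blast
qed

text \<open>The reflection that swaps the first unit vector \<open>e\<close> and \<open>v\<close>:
  for \<open>w = e - v\<close> one has \<open>w \<bullet> w = 2 * (1 - v $ 0)\<close>, so the usual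
  factor \<open>2 / (w \<bullet> w)\<close> is \<open>1 / (1 - v $ 0)\<close>. If
  \<open>v $ 0 = 1\<close>, then \<open>v = e\<close> and \<open>k = 0\<close> gives the
  identity.\<close>

lemma householder:
  fixes v :: "real vec"
  assumes v: "v \<in> carrier_vec (Suc n)" and unit: "v \<bullet> v = 1"
  obtains H where "H \<in> carrier_mat (Suc n) (Suc n)" "transpose_mat H = H"
    "H * H = 1\<^sub>m (Suc n)" "H *\<^sub>v unit_vec (Suc n) 0 = v"
proof -
  define w where "w i = (if i = 0 then 1 else 0) - v $ i" for i
  define k where "k = (if v $ 0 = 1 then 0 else 1 / (1 - v $ 0))"
  define H where "H = Matrix.mat (Suc n) (Suc n) (\<lambda>(i,j). (if i = j then 1 else 0) - k * w i * w j)"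
  have vv: "(\<Sum>i<Suc n. v $ i * v $ i) = 1"
    using unit v by (simp add: scalar_prod_def atLeast0LessThan del: sum.lessThan_Suc)
  then have tail: "(\<Sum>i<n. v $ Suc i * v $ Suc i) = 1 - v $ 0 * v $ 0"
    unfolding sum.lessThan_Suc_shift by simp
  have ww: "(\<Sum>i<Suc n. w i * w i) = 2 * (1 - v $ 0)"
    unfolding sum.lessThan_Suc_shift by (simp add: w_def tail algebra_simps)
  have kw: "k * w i = w i / (1 - v $ 0)" if "i < Suc n" for i
  proof (cases "v $ 0 = 1")
    case True
    then have "(\<Sum>i<n. v $ Suc i * v $ Suc i) = 0" using tail by simp
    then have "\<And>i. i < n \<Longrightarrow> v $ Suc i = 0" by (subst (asm) sum_nonneg_eq_0_iff) auto
    then show ?thesis using True that by (cases i) (auto simp: w_def)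
  qed (simp add: k_def)
  \<comment> \<open>In \<open>H * H\<close> the coefficient of \<open>w i * w j\<close> is
    \<open>- 2 * k + k * k * (w \<bullet> w)\<close>; this identity makes it vanish.\<close>
  have k2: "k * k * (\<Sum>i<Suc n. w i * w i) = 2 * k"
  proof (cases "v $ 0 = 1")
    case False
    then have "k * (1 - v $ 0) = 1" by (simp add: k_def)
    moreover have "k * k * (2 * (1 - v $ 0)) = 2 * k * (k * (1 - v $ 0))" by simp
    ultimately show ?thesis unfolding ww by simp
  qed (simp add: k_def)
  have H: "H \<in> carrier_mat (Suc n) (Suc n)" by (simp add: H_def)
  moreover have "transpose_mat H = H" by (rule eq_matI) (auto simp: H_def)
  moreover have "H * H = 1\<^sub>m (Suc n)"
  proof (rule eq_matI)
    fix i j assume ij: "i < dim_row (1\<^sub>m (Suc n))" "j < dim_col (1\<^sub>m (Suc n))"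
    have "(H * H) $$ (i,j) = (\<Sum>l<Suc n. ((if i = l then 1 else 0) - k * w i * w l) * ((if l = j then 1 else 0) - k * w l * w j))"
      using ij by (simp add: H_def scalar_prod_def atLeast0LessThan row_def col_def del: sum.lessThan_Suc)
    also have "\<dots> = (\<Sum>l<Suc n. (if l = i then if l = j then 1 else 0 else 0)
        - (if l = i then k * w l * w j else 0) - (if l = j then k * w i * w l else 0) + w i * w j * (k * k) * (w l * w l))"
      by (intro sum.cong refl) (auto simp: algebra_simps)
    also have "\<dots> = (if i = j then 1 else 0) - k * w i * w j - k * w i * w j + w i * w j * (k * k) * (\<Sum>l<Suc n. w l * w l)"
      using ij by (simp add: sum.distrib sum_subtractf sum.delta del: sum.lessThan_Suc flip: sum_distrib_left)
    also have "\<dots> = (if i = j then 1 else 0) - 2 * k * w i * w j + w i * w j * (k * k * (\<Sum>l<Suc n. w l * w l))"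
      by (simp del: sum.lessThan_Suc)
    also have "\<dots> = (if i = j then 1 else 0)" unfolding k2 by simp
    finally show "(H * H) $$ (i,j) = 1\<^sub>m (Suc n) $$ (i,j)" using ij by simp
  qed (auto simp: H_def)
  moreover have "H *\<^sub>v unit_vec (Suc n) 0 = v"
  proof (rule eq_vecI)
    fix i assume i: "i < dim_vec v"
    have i': "i < Suc n" using i v by simp
    have "(H *\<^sub>v unit_vec (Suc n) 0) $ i = H $$ (i, 0)"
      using i' H by simp
    also have "\<dots> = (if i = 0 then 1 else 0) - k * w i * w 0" using i' by (simp add: H_def)
    also have "\<dots> = v $ i"
    proof (cases "v $ 0 = 1")
      case True
      then have "k * w i = 0" using kw[OF i'] by simp
      then have "w i = 0" using True kw[OF i'] tail i'
      proof -
        have "(\<Sum>i<n. v $ Suc i * v $ Suc i) = 0" using tail True by simp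
        then have "\<And>i. i < n \<Longrightarrow> v $ Suc i = 0" by (subst (asm) sum_nonneg_eq_0_iff) auto
        then show ?thesis using True i' by (cases i) (auto simp: w_def)
      qed
      then show ?thesis using \<open>k * w i = 0\<close> by (simp add: w_def)
    next
      case False
      then have "k * w 0 = 1" by (simp add: k_def w_def)
      moreover have "k * w i * w 0 = (k * w 0) * w i" by (simp only: mult_ac)
      ultimately have e: "k * w i * w 0 = w i" by (simp only: mult_1)
      show ?thesis unfolding e by (simp add: w_def)
    qed
    finally show "(H *\<^sub>v unit_vec (Suc n) 0) $ i = v $ i" .
  qed (use v in \<open>auto simp: H_def\<close>)
  ultimately show ?thesis by (rule that)
qed

text \<open>Deflation: \<open>H\<close> carries the first unit vector to a unit eigenvector, so the
  first column of \<open>H * A * H\<close> is \<open>l\<close> times that unit vector, and by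
  symmetry so is the first row. The remaining block is diagonalised by induction, and
  \<open>F\<close> extends its orthogonal matrix by a leading 1.\<close>

lemma symmetric_spectral_decomposition:
  fixes A :: "real mat"
  assumes "A \<in> carrier_mat n n" "transpose_mat A = A"
  shows "\<exists>U d. U \<in> carrier_mat n n \<and> U * transpose_mat U = 1\<^sub>m n \<and>
    transpose_mat U * U = 1\<^sub>m n \<and> A = U * mat_diag n d * transpose_mat U"
  using assms
proof (induction n arbitrary: A)
  case 0
  then show ?case
    by (intro exI[of _ "1\<^sub>m 0"] exI[of _ "\<lambda>_. 0"] conjI eq_matI) auto
next
  case (Suc n)
  note A = Suc.prems(1) and symA = Suc.prems(2)
  obtain l where "eigenvalue A l" using symmetric_real_eigenvalue[OF A symA] by auto
  then obtain v0 where v0: "v0 \<in> carrier_vec (Suc n)" "v0 \<noteq> 0\<^sub>v (Suc n)" "A *\<^sub>v v0 = l \<cdot>\<^sub>v v0"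
    unfolding eigenvalue_def eigenvector_def using A by auto
  have pos: "0 < v0 \<bullet> v0"
    using v0 conjugate_square_greater_0_vec[of v0 "Suc n"] by simp
  define v where "v = (1 / sqrt (v0 \<bullet> v0)) \<cdot>\<^sub>v v0"
  have v: "v \<in> carrier_vec (Suc n)" using v0 by (simp add: v_def)
  have unit: "v \<bullet> v = 1"
    using v0 pos by (simp add: v_def)
  have Av: "A *\<^sub>v v = l \<cdot>\<^sub>v v"
    using A v0 by (simp add: v_def smult_smult_assoc mult_mat_vec mult.commute)
  obtain H where H: "H \<in> carrier_mat (Suc n) (Suc n)" "transpose_mat H = H"
    "H * H = 1\<^sub>m (Suc n)" "H *\<^sub>v unit_vec (Suc n) 0 = v"
    using householder[OF v unit] by blast
  have Hv: "H *\<^sub>v v = unit_vec (Suc n) 0"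
    using assoc_mult_mat_vec[OF H(1) H(1), of "unit_vec (Suc n) 0"] H by simp
  define B where "B = H * A * H"
  have B: "B \<in> carrier_mat (Suc n) (Suc n)" using H A by (simp add: B_def)
  have symB: "transpose_mat B = B"
    unfolding B_def using H A symA
    by (simp add: transpose_mult[of _ "Suc n" "Suc n" _ "Suc n"])
  have "B *\<^sub>v unit_vec (Suc n) 0 = l \<cdot>\<^sub>v unit_vec (Suc n) 0"
    using H A v Av Hv by (simp add: B_def assoc_mult_mat_vec[of _ "Suc n" "Suc n" _ "Suc n"] mult_mat_vec)
  then have "(B *\<^sub>v unit_vec (Suc n) 0) $ i = (l \<cdot>\<^sub>v unit_vec (Suc n) 0) $ i" for i by simp
  then have B0: "B $$ (i, 0) = (if i = 0 then l else 0)" if "i < Suc n" for i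
    using that B by (metis carrier_matD index_mult_mat_vec index_smult_vec(1) index_unit_vec(1,3) mult_cancel_left1
        mult_zero_right scalar_prod_right_unit row_carrier_vec index_row(1) zero_less_Suc)
  have symB': "i < Suc n \<Longrightarrow> j < Suc n \<Longrightarrow> B $$ (i,j) = B $$ (j,i)" for i j
    using B symB by (metis carrier_matD index_transpose_mat(1))
  define B' where "B' = Matrix.mat n n (\<lambda>(i,j). B $$ (Suc i, Suc j))"
  have "B' \<in> carrier_mat n n" "transpose_mat B' = B'"
    unfolding B'_def by (auto intro!: eq_matI simp: symB')
  from Suc.IH[OF this] obtain U' d' where U': "U' \<in> carrier_mat n n" "U' * transpose_mat U' = 1\<^sub>m n"
    "transpose_mat U' * U' = 1\<^sub>m n" "B' = U' * mat_diag n d' * transpose_mat U'" by blast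
  define F where "F = four_block_mat (1\<^sub>m 1) (0\<^sub>m 1 n) (0\<^sub>m n 1) U'"
  define d where "d i = (if i = 0 then l else d' (i - 1))" for i
  have F: "F \<in> carrier_mat (Suc n) (Suc n)" using U' by (simp add: F_def four_block_carrier_mat[of _ 1 1 _ n n, simplified])
  have FT: "transpose_mat F = four_block_mat (1\<^sub>m 1) (0\<^sub>m 1 n) (0\<^sub>m n 1) (transpose_mat U')"
    unfolding F_def using U' by (subst transpose_four_block_mat[of _ 1 1 _ n _ n]) auto
  have D: "mat_diag (Suc n) d = four_block_mat (mat_diag 1 (\<lambda>_. l)) (0\<^sub>m 1 n) (0\<^sub>m n 1) (mat_diag n d')"
    by (rule eq_matI) (auto simp: mat_diag_def d_def)
  have Bblock: "B = four_block_mat (mat_diag 1 (\<lambda>_. l)) (0\<^sub>m 1 n) (0\<^sub>m n 1) B'"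
  proof (rule eq_matI)
    fix i j assume "i < dim_row (four_block_mat (mat_diag 1 (\<lambda>_. l)) (0\<^sub>m 1 n) (0\<^sub>m n 1) B')"
      "j < dim_col (four_block_mat (mat_diag 1 (\<lambda>_. l)) (0\<^sub>m 1 n) (0\<^sub>m n 1) B')"
    then have ij: "i < Suc n" "j < Suc n" by (auto simp: B'_def mat_diag_def)
    then show "B $$ (i,j) = four_block_mat (mat_diag 1 (\<lambda>_. l)) (0\<^sub>m 1 n) (0\<^sub>m n 1) B' $$ (i,j)"
      using B0[of i] B0[of j] symB'[of 0 j] by (auto simp: B'_def mat_diag_def)
  qed (use B in \<open>auto simp: B'_def mat_diag_def\<close>)
  have FDF: "F * mat_diag (Suc n) d * transpose_mat F = B"
    unfolding FT unfolding D Bblock F_def U'(4)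
    using U' mult_carrier_mat[OF mult_carrier_mat[OF U'(1) mat_diag_dim[of n d']], of "transpose_mat U'" n]
    by (simp add: left_mult_one_mat[of _ "Suc 0" "Suc 0"] right_mult_one_mat[of _ "Suc 0" "Suc 0"]
      left_add_zero_mat[of _ "Suc 0" n] left_add_zero_mat[of _ n "Suc 0"] left_add_zero_mat[of _ n n]
      right_add_zero_mat[of _ "Suc 0" "Suc 0"] left_mult_zero_mat[of _ n n] right_mult_zero_mat[of _ n n]
      left_mult_zero_mat[of _ "Suc 0" "Suc 0"] right_mult_zero_mat[of _ "Suc 0" "Suc 0"] mult_four_block_mat[of _ 1 1 _ n _ n _ _ 1 _ n])
  have FF: "F * transpose_mat F = 1\<^sub>m (Suc n)" "transpose_mat F * F = 1\<^sub>m (Suc n)"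
    unfolding FT unfolding F_def using U'
    by (simp_all add: left_mult_one_mat[of _ "Suc 0" "Suc 0"] right_mult_one_mat[of _ "Suc 0" "Suc 0"]
      left_add_zero_mat[of _ "Suc 0" n] left_add_zero_mat[of _ n "Suc 0"] left_add_zero_mat[of _ n n]
      right_add_zero_mat[of _ "Suc 0" "Suc 0"] left_mult_zero_mat[of _ n n] right_mult_zero_mat[of _ n n]
      left_mult_zero_mat[of _ "Suc 0" "Suc 0"] mult_four_block_mat[of _ 1 1 _ n _ n _ _ 1 _ n] four_block_one_mat[of 1 n, simplified])
  define U where "U = H * F"
  have UT: "transpose_mat U = transpose_mat F * H"
    unfolding U_def using H F by (simp add: transpose_mult[of _ "Suc n" "Suc n" _ "Suc n"])
  have FTc: "transpose_mat F \<in> carrier_mat (Suc n) (Suc n)" using F by simp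
  have m: "X * Y \<in> carrier_mat (Suc n) (Suc n)" if "X \<in> carrier_mat (Suc n) (Suc n)" "Y \<in> carrier_mat (Suc n) (Suc n)" for X Y :: "real mat"
    using that by simp
  note as = assoc_mult_mat[of _ "Suc n" "Suc n" _ "Suc n" _ "Suc n"]
  have "U * transpose_mat U = H * (F * transpose_mat F) * H"
    unfolding UT unfolding U_def using H F FTc by (simp add: as m)
  then have 1: "U * transpose_mat U = 1\<^sub>m (Suc n)" using H by (simp add: FF)
  have "transpose_mat U * U = transpose_mat F * ((H * H) * F)"
    unfolding UT unfolding U_def using H(1) F FTc by (simp add: as m)
  then have 2: "transpose_mat U * U = 1\<^sub>m (Suc n)" using H F by (simp add: FF)
  have "U * mat_diag (Suc n) d * transpose_mat U = H * (F * mat_diag (Suc n) d * transpose_mat F) * H"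
    unfolding UT unfolding U_def using H(1) F FTc by (simp add: as m)
  also have "\<dots> = (H * H) * A * (H * H)"
    unfolding FDF unfolding B_def using H(1) A by (simp add: as m)
  also have "\<dots> = A" using A H by simp
  finally have "A = U * mat_diag (Suc n) d * transpose_mat U" by simp
  moreover have "U \<in> carrier_mat (Suc n) (Suc n)" using H F by (simp add: U_def)
  ultimately show ?case using 1 2 by blast
qed

section \<open>Matrices with a given spectral decomposition: product, empirical spectrum,
  pseudo-inverse\<close>

lemma conjugate_diag_mult:
  fixes U :: "'a :: comm_semiring_1 mat"
  assumes "U \<in> carrier_mat n n" "transpose_mat U * U = 1\<^sub>m n"
  shows "(U * mat_diag n f * transpose_mat U) * (U * mat_diag n g * transpose_mat U)
    = U * mat_diag n (\<lambda>i. f i * g i) * transpose_mat U"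
proof -
  have m: "X * Y \<in> carrier_mat n n" if "X \<in> carrier_mat n n" "Y \<in> carrier_mat n n" for X Y :: "'a mat"
    using that by simp
  note as = assoc_mult_mat[of _ n n _ n _ n]
  have "(U * mat_diag n f * transpose_mat U) * (U * mat_diag n g * transpose_mat U)
    = U * mat_diag n f * ((transpose_mat U * U) * (mat_diag n g * transpose_mat U))"
    using assms(1) by (simp add: as m)
  also have "\<dots> = U * (mat_diag n f * mat_diag n g) * transpose_mat U"
    using assms(1) by (simp add: assms(2) as m left_mult_one_mat[of _ n n] del: mat_diag_diag)
  finally show ?thesis by simp
qed

lemma transpose_conjugate_diag:
  fixes U :: "'a :: comm_semiring_1 mat"
  assumes "U \<in> carrier_mat n n"
  shows "transpose_mat (U * mat_diag n f * transpose_mat U) = U * mat_diag n f * transpose_mat U"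
proof -
  have "transpose_mat (mat_diag n f) = mat_diag n f"
    by (rule eq_matI) (auto simp: mat_diag_def)
  then show ?thesis
    using assms by (simp add: transpose_mult[of _ n n _ n] assoc_mult_mat[of _ n n _ n _ n] mult_carrier_mat[of _ n n _ n] del: assoc_mult_mat)
qed

lemma char_poly_conjugate_diag:
  fixes U :: "real mat"
  assumes "U \<in> carrier_mat n n" "U * transpose_mat U = 1\<^sub>m n" "transpose_mat U * U = 1\<^sub>m n"
  shows "char_poly (U * mat_diag n d * transpose_mat U) = (\<Prod>i<n. [:- d i, 1:])"
proof -
  have "similar_mat (U * mat_diag n d * transpose_mat U) (mat_diag n d)"
    unfolding similar_mat_def
    by (intro exI[of _ U] exI[of _ "transpose_mat U"] similar_mat_witI[of _ _ n]) (use assms in auto)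
  then have "char_poly (U * mat_diag n d * transpose_mat U) = char_poly (mat_diag n d)"
    by (rule char_poly_similar)
  also have "\<dots> = (\<Prod>a\<leftarrow>diag_mat (mat_diag n d). [:- a, 1:])"
    by (rule char_poly_upper_triangular[of _ n]) (auto simp: mat_diag_def upper_triangular_def)
  also have "diag_mat (mat_diag n d) = map d [0..<n]"
    by (auto simp: diag_mat_def mat_diag_def)
  also have "(\<Prod>a\<leftarrow>map d [0..<n]. [:- a, 1:]) = (\<Prod>i<n. [:- d i, 1:])"
    by (simp add: prod.distinct_set_conv_list[symmetric] atLeast0LessThan comp_def)
  finally show ?thesis .
qed

text \<open>The counting sum depends only on the multiset of roots, so the ordering in
  \<open>eigenvalues_desc\<close> drops out; the multiset is read off from the linear factors of the
  characteristic polynomial.\<close>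

lemma esd_conjugate_diag:
  fixes U :: "real mat"
  assumes "U \<in> carrier_mat n n" "U * transpose_mat U = 1\<^sub>m n" "transpose_mat U * U = 1\<^sub>m n"
  shows "esd (U * mat_diag n d * transpose_mat U) t = real (card {i. i < n \<and> d i \<le> t}) / real n"
proof -
  let ?A = "U * mat_diag n d * transpose_mat U"
  have "proots (char_poly ?A) = image_mset d (mset_set {..<n})"
  proof -
    have "proots (\<Prod>i<n. [:- d i, 1:]) = (\<Sum>i<n. proots [:- d i, 1:])"
      by (rule proots_prod) auto
    also have "\<dots> = image_mset d (mset_set {..<n})"
      by (simp add: sum_unfold_sum_mset)
    finally show ?thesis by (simp add: char_poly_conjugate_diag[OF assms])
  qed
  then have ms: "mset (eigenvalues_desc ?A) = image_mset d (mset_set {..<n})"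
    unfolding eigenvalues_desc_def by simp
  then have len: "length (eigenvalues_desc ?A) = n"
    by (metis card_lessThan size_image_mset size_mset size_mset_set)
  have "(\<Sum>i<n. indicator {s. s \<le> t} (eigenvalues_desc ?A ! i) :: real)
    = sum_list (map (indicator {s. s \<le> t}) (eigenvalues_desc ?A))"
    using len by (simp add: sum_list_sum_nth atLeast0LessThan)
  also have "\<dots> = sum_mset (image_mset (indicator {s. s \<le> t}) (mset (eigenvalues_desc ?A)))"
    by (simp add: sum_mset_sum_list flip: mset_map)
  also have "\<dots> = (\<Sum>i<n. indicator {s. s \<le> t} (d i))"
    unfolding ms by (simp add: sum_unfold_sum_mset image_mset.compositionality comp_def)
  also have "\<dots> = real (card {i. i < n \<and> d i \<le> t})"
    by (simp add: indicator_def sum.If_cases Int_def lessThan_def)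
  finally show ?thesis using assms(1) by (simp add: esd_def)
qed

text \<open>\<open>A * C = (A * B) * (A * C)\<close> is symmetric and a product of symmetric
  matrices, so transposing swaps the factors and yields \<open>A * B\<close>. Likewise
  \<open>C * A = B * A\<close>, whence \<open>C = C * A * C = B * A * C = B * A * B = B\<close>.
  This uniqueness gives the \<open>THE\<close> in \<open>moore_penrose\<close> its value.\<close>

lemma moore_penrose_eqI:
  assumes A: "A \<in> carrier_mat m n" and B: "is_moore_penrose A B"
  shows "moore_penrose A = B"
  unfolding moore_penrose_def
proof (rule the_equality)
  fix C assume "is_moore_penrose A C"
  then have C: "C \<in> carrier_mat n m" "A * C * A = A" "C * A * C = C"
     "transpose_mat (A * C) = A * C" "transpose_mat (C * A) = C * A"
    using A by (auto simp: is_moore_penrose_def)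
  have B: "B \<in> carrier_mat n m" "A * B * A = A" "B * A * B = B"
     "transpose_mat (A * B) = A * B" "transpose_mat (B * A) = B * A"
    using A B by (auto simp: is_moore_penrose_def)
  have AC: "A * C = A * B"
  proof -
    have "A * C = transpose_mat (A * B * A * C)" using B C by simp
    also have "A * B * A * C = (A * B) * (A * C)"
      using A B(1) C(1) by (simp add: assoc_mult_mat[of _ m n _ m _ m] assoc_mult_mat[of _ m m _ n _ m] assoc_mult_mat[of _ m n _ n _ m] assoc_mult_mat[of _ m n _ m _ m] assoc_mult_mat[of _ n m _ m _ n] mult_carrier_mat[of _ m n _ m] mult_carrier_mat[of _ n m _ n])
    also have "transpose_mat \<dots> = (A * C) * (A * B)"
      using A B C by (subst transpose_mult[of _ m m _ m]) auto
    also have "\<dots> = A * C * A * B"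
      using A B(1) C(1) by (simp add: assoc_mult_mat[of _ m m _ n _ m] assoc_mult_mat[of _ m n _ n _ m] assoc_mult_mat[of _ m n _ m _ m] assoc_mult_mat[of _ n m _ m _ n] mult_carrier_mat[of _ m n _ m] mult_carrier_mat[of _ n m _ n])
    finally show ?thesis using C by simp
  qed
  have CA: "C * A = B * A"
  proof -
    have "C * A = transpose_mat (C * (A * B * A))" using B C by simp
    also have "C * (A * B * A) = (C * A) * (B * A)"
      using A B(1) C(1) by (simp add: assoc_mult_mat[of _ m n _ m _ n] assoc_mult_mat[of _ n m _ n _ n] assoc_mult_mat[of _ m n _ n _ m] assoc_mult_mat[of _ m n _ m _ m] assoc_mult_mat[of _ n m _ m _ n] mult_carrier_mat[of _ m n _ m] mult_carrier_mat[of _ n m _ n])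
    also have "transpose_mat \<dots> = (B * A) * (C * A)"
      using A B C by (subst transpose_mult[of _ n n _ n]) auto
    also have "\<dots> = B * (A * C * A)"
      using A B(1) C(1) by (simp add: assoc_mult_mat[of _ m n _ m _ n] assoc_mult_mat[of _ n m _ n _ n] assoc_mult_mat[of _ m n _ n _ m] assoc_mult_mat[of _ m n _ m _ m] assoc_mult_mat[of _ n m _ m _ n] mult_carrier_mat[of _ m n _ m] mult_carrier_mat[of _ n m _ n])
    finally show ?thesis using C by simp
  qed
  have "C = C * A * C" using C by simp
  also have "\<dots> = B * (A * C)" unfolding CA using A B(1) C(1) by simp
  also have "\<dots> = B * A * B" unfolding AC using A B(1) by simp
  finally show "C = B" using B by simp
qed (rule B)

text \<open>The convention \<open>inverse 0 = 0\<close> is the Moore-Penrose inverse of a scalar, so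
  inverting the diagonal entrywise also treats the kernel correctly.\<close>

lemma moore_penrose_conjugate_diag:
  fixes U :: "real mat"
  assumes "U \<in> carrier_mat n n" "U * transpose_mat U = 1\<^sub>m n" "transpose_mat U * U = 1\<^sub>m n"
  shows "moore_penrose (U * mat_diag n d * transpose_mat U)
    = U * mat_diag n (\<lambda>i. inverse (d i)) * transpose_mat U"
proof (rule moore_penrose_eqI[of _ n n])
  have [simp]: "d i * inverse (d i) * d i = d i" "inverse (d i) * d i * inverse (d i) = inverse (d i)" for i
    by (cases "d i = 0"; simp)+
  show "is_moore_penrose (U * mat_diag n d * transpose_mat U) (U * mat_diag n (\<lambda>i. inverse (d i)) * transpose_mat U)"
    unfolding is_moore_penrose_def conjugate_diag_mult[OF assms(1,3)] transpose_conjugate_diag[OF assms(1)]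
    using assms(1) by auto
qed (use assms in auto)

subsection \<open>Resolvents of positive semidefinite matrices\<close>

text \<open>Written as adjugate over determinant, so that every entry is visibly a rational function
  of the entries of \<open>A\<close>, hence measurable. For positive semidefinite \<open>A\<close>
  and \<open>t > 0\<close> the determinant is nonzero and this is the inverse of
  \<open>A + t\<close>.\<close>

definition resolvent :: "real \<Rightarrow> real mat \<Rightarrow> real mat" where
  "resolvent t A = (1 / det (A + t \<cdot>\<^sub>m 1\<^sub>m (dim_row A))) \<cdot>\<^sub>m adj_mat (A + t \<cdot>\<^sub>m 1\<^sub>m (dim_row A))"

definition mtrace :: "real mat \<Rightarrow> real" where
  "mtrace A = (\<Sum>i<dim_row A. A $$ (i, i))"

lemma scalar_prod_self_nonneg: "0 \<le> (v :: real vec) \<bullet> v"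
  by (simp add: scalar_prod_def sum_nonneg)

lemma scalar_prod_self_eq_0:
  assumes "v \<in> carrier_vec n" shows "(v :: real vec) \<bullet> v = 0 \<longleftrightarrow> v = 0\<^sub>v n"
  using conjugate_square_eq_0_vec[OF assms] by simp

locale psd_shift =
  fixes A :: "real mat" and n :: nat and t :: real
  assumes psd: "pos_semidef A" and carrier: "A \<in> carrier_mat n n" and t_pos: "0 < t"
begin

abbreviation "B \<equiv> A + t \<cdot>\<^sub>m 1\<^sub>m n"
abbreviation "R \<equiv> resolvent t A"

lemma B_carrier: "B \<in> carrier_mat n n" using carrier by simp

lemma B_mult_vec: "x \<in> carrier_vec n \<Longrightarrow> B *\<^sub>v x = A *\<^sub>v x + t \<cdot>\<^sub>v x"
  using carrier by (subst add_mult_distrib_mat_vec[of _ n n]) auto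

lemma quad_nonneg: "x \<in> carrier_vec n \<Longrightarrow> 0 \<le> x \<bullet> (A *\<^sub>v x)"
  using psd carrier by (simp add: pos_semidef_def)

lemma quad_B: "x \<in> carrier_vec n \<Longrightarrow> t * (x \<bullet> x) \<le> x \<bullet> (B *\<^sub>v x)"
  using carrier quad_nonneg by (simp add: B_mult_vec scalar_prod_add_distrib[of _ n])

lemma det_B: "det B \<noteq> 0"
proof
  assume "det B = 0"
  then obtain v where v: "v \<in> carrier_vec n" "v \<noteq> 0\<^sub>v n" "B *\<^sub>v v = 0\<^sub>v n"
    using det_0_iff_vec_prod_zero_field[OF B_carrier] by blast
  then have "t * (v \<bullet> v) \<le> 0" using quad_B[OF v(1)] by simp
  then have "v \<bullet> v = 0" using t_pos scalar_prod_self_nonneg[of v] by (simp add: mult_le_0_iff)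
  then show False using v scalar_prod_self_eq_0 by blast
qed

lemma R_def': "R = (1 / det B) \<cdot>\<^sub>m adj_mat B"
  using carrier by (simp add: resolvent_def)

lemma R_carrier: "R \<in> carrier_mat n n"
  unfolding R_def' using adj_mat[OF B_carrier] by simp

lemma B_R: "B * R = 1\<^sub>m n" and R_B: "R * B = 1\<^sub>m n"
  using adj_mat[OF B_carrier] B_carrier det_B
  by (auto simp: R_def' mult_smult_distrib[of _ n n _ n] mult_smult_assoc_mat[of _ n n _ n] intro!: eq_matI)

lemma R_eqI:
  assumes "C \<in> carrier_mat n n" "B * C = 1\<^sub>m n" shows "R = C"
proof -
  have "R * (B * C) = (R * B) * C"
    by (rule assoc_mult_mat[OF R_carrier B_carrier assms(1), symmetric])
  then show ?thesis using R_carrier assms by (simp add: R_B)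
qed

lemma R_sym: "transpose_mat R = R"
proof -
  have "transpose_mat A = A" using psd by (simp add: pos_semidef_def)
  then have "A $$ (j, i) = A $$ (i, j)" if "i < n" "j < n" for i j
    using carrier that by (metis carrier_matD index_transpose_mat(1))
  then have "transpose_mat B = B" using carrier by (intro eq_matI) auto
  then have "B * transpose_mat R = transpose_mat (R * B)"
    using R_carrier B_carrier by (simp add: transpose_mult[of _ n n _ n])
  then show ?thesis using R_eqI[of "transpose_mat R"] R_carrier by (simp add: R_B)
qed

lemma B_R_vec: "x \<in> carrier_vec n \<Longrightarrow> B *\<^sub>v (R *\<^sub>v x) = x"
  using assoc_mult_mat_vec[OF B_carrier R_carrier, of x] by (simp add: B_R)

lemma R_B_vec: "x \<in> carrier_vec n \<Longrightarrow> R *\<^sub>v (B *\<^sub>v x) = x"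
  using assoc_mult_mat_vec[OF R_carrier B_carrier, of x] by (simp add: R_B)

lemma R_vec_carrier: "x \<in> carrier_vec n \<Longrightarrow> R *\<^sub>v x \<in> carrier_vec n"
  using R_carrier by auto

lemma R_adjoint: "x \<in> carrier_vec n \<Longrightarrow> y \<in> carrier_vec n \<Longrightarrow> (R *\<^sub>v x) \<bullet> y = x \<bullet> (R *\<^sub>v y)"
  using transpose_vec_mult_scalar[OF R_carrier, of y x] by (simp add: R_sym)

text \<open>For \<open>y = R *\<^sub>v x\<close> the right-hand side is the quadratic form of
  \<open>B\<close> at \<open>y\<close>, which dominates \<open>t * (y \<bullet> y)\<close>.\<close>

lemma R_norm: "x \<in> carrier_vec n \<Longrightarrow> t * ((R *\<^sub>v x) \<bullet> (R *\<^sub>v x)) \<le> x \<bullet> (R *\<^sub>v x)"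
  using quad_B[OF R_vec_carrier, of x] B_R_vec[of x] comm_scalar_prod[OF R_vec_carrier, of x x] by simp

lemma R_quad_nonneg: "x \<in> carrier_vec n \<Longrightarrow> 0 \<le> x \<bullet> (R *\<^sub>v x)"
  using R_norm[of x] t_pos scalar_prod_self_nonneg[of "R *\<^sub>v x"]
  by (meson dual_order.trans less_imp_le mult_nonneg_nonneg)

lemma R_unit:
  assumes "i < n" shows "k < n \<Longrightarrow> (R *\<^sub>v unit_vec n i) $ k = R $$ (k, i)"
    and "unit_vec n i \<bullet> (R *\<^sub>v unit_vec n i) = R $$ (i, i)"
    and "(R *\<^sub>v unit_vec n i) \<bullet> (R *\<^sub>v unit_vec n i) = (\<Sum>k<n. (R $$ (i, k))\<^sup>2)"
proof -
  show *: "(R *\<^sub>v unit_vec n i) $ k = R $$ (k, i)" if "k < n" for k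
    using assms that R_carrier by simp
  show "unit_vec n i \<bullet> (R *\<^sub>v unit_vec n i) = R $$ (i, i)"
    using assms R_vec_carrier[of "unit_vec n i"] *[OF assms] by simp
  have "R $$ (i, k) = R $$ (k, i)" if "k < n" for k
    using R_sym R_carrier assms that by (metis carrier_matD index_transpose_mat(1))
  then show "(R *\<^sub>v unit_vec n i) \<bullet> (R *\<^sub>v unit_vec n i) = (\<Sum>k<n. (R $$ (i, k))\<^sup>2)"
    using R_carrier * by (simp add: scalar_prod_def[of _ "R *\<^sub>v unit_vec n i"] atLeast0LessThan power2_eq_square)
qed

text \<open>At a unit vector \<open>R_norm\<close> bounds \<open>t\<close> times the squared norm of
  row \<open>i\<close> by \<open>r = R $$ (i, i)\<close>. That norm contains \<open>r^2\<close>, so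
  \<open>t * r^2 \<le> r\<close>. The resulting bounds are the ones that the estimate for quadratic
  forms uses with \<open>b = 1 / t\<close>.\<close>

lemma R_row:
  assumes i: "i < n"
  shows "0 \<le> R $$ (i, i)" "R $$ (i, i) \<le> 1 / t" "(\<Sum>k<n. (R $$ (i, k))\<^sup>2) \<le> 1 / t\<^sup>2"
proof -
  have b: "t * (\<Sum>k<n. (R $$ (i, k))\<^sup>2) \<le> R $$ (i, i)"
    using R_norm[of "unit_vec n i"] by (simp add: R_unit[OF i])
  moreover have "(R $$ (i, i))\<^sup>2 \<le> (\<Sum>k<n. (R $$ (i, k))\<^sup>2)"
    using i by (intro member_le_sum) auto
  ultimately have sq: "t * (R $$ (i, i))\<^sup>2 \<le> R $$ (i, i)"
    using t_pos by (meson mult_left_mono less_imp_le order_trans)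
  show nn: "0 \<le> R $$ (i, i)"
    using R_quad_nonneg[of "unit_vec n i"] by (simp add: R_unit[OF i])
  show le: "R $$ (i, i) \<le> 1 / t"
  proof (cases "R $$ (i, i) = 0")
    case False
    then have "t * R $$ (i, i) \<le> 1"
      using sq nn by (simp add: power2_eq_square flip: mult.assoc)
    then show ?thesis using t_pos by (simp add: field_simps)
  qed (use t_pos in simp)
  have "t * (\<Sum>k<n. (R $$ (i, k))\<^sup>2) \<le> 1 / t" using b le by linarith
  then show "(\<Sum>k<n. (R $$ (i, k))\<^sup>2) \<le> 1 / t\<^sup>2"
    using t_pos by (simp add: field_simps power2_eq_square)
qed

lemma R_trace: "mtrace R = (\<Sum>i<n. R $$ (i, i))"
  using R_carrier by (simp add: mtrace_def)

lemma R_trace_bounds: "0 \<le> mtrace R" "mtrace R \<le> real n / t"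
proof -
  show "0 \<le> mtrace R" unfolding R_trace by (intro sum_nonneg R_row) simp
  have "mtrace R \<le> (\<Sum>i<n. 1 / t)" unfolding R_trace by (intro sum_mono R_row) simp
  then show "mtrace R \<le> real n / t" by simp
qed

text \<open>\<open>d i\<close> is the quadratic form of \<open>A\<close> at the \<open>i\<close>-th
  column of \<open>U\<close>, a unit vector. Conjugating the diagonal matrix of the
  \<open>1 / (d i + t)\<close> inverts \<open>B\<close>, so it is \<open>R\<close>, and its trace
  collects the squared norms of the columns.\<close>

lemma R_spectral:
  assumes U: "U \<in> carrier_mat n n" "U * transpose_mat U = 1\<^sub>m n" "transpose_mat U * U = 1\<^sub>m n"
    and A_eq: "A = U * mat_diag n d * transpose_mat U"
  shows "\<And>i. i < n \<Longrightarrow> 0 \<le> d i" "mtrace R = (\<Sum>i<n. 1 / (d i + t))"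
proof -
  note as = assoc_mult_mat[of _ n n _ n _ n]
  have m: "X * Y \<in> carrier_mat n n" if "X \<in> carrier_mat n n" "Y \<in> carrier_mat n n" for X Y :: "real mat"
    using that by simp
  have AU: "A * U = U * mat_diag n d"
    unfolding A_eq using U(1) by (simp add: as m U(3) right_mult_one_mat[of _ n n])
  show d: "0 \<le> d i" if i: "i < n" for i
  proof -
    let ?e = "unit_vec n i :: real vec"
    have De: "mat_diag n d *\<^sub>v ?e = d i \<cdot>\<^sub>v ?e"
      using i by (intro eq_vecI) (auto simp: mat_diag_def)
    have "A *\<^sub>v (U *\<^sub>v ?e) = U *\<^sub>v (d i \<cdot>\<^sub>v ?e)"
      using assoc_mult_mat_vec[OF carrier U(1), of ?e] assoc_mult_mat_vec[OF U(1) mat_diag_dim[of n d], of ?e]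
      by (simp add: AU De)
    then have "(U *\<^sub>v ?e) \<bullet> (A *\<^sub>v (U *\<^sub>v ?e)) = ?e \<bullet> (transpose_mat U *\<^sub>v (U *\<^sub>v (d i \<cdot>\<^sub>v ?e)))"
      using transpose_vec_mult_scalar[of "transpose_mat U" n n "U *\<^sub>v (d i \<cdot>\<^sub>v ?e)" ?e] U by simp
    also have "transpose_mat U *\<^sub>v (U *\<^sub>v (d i \<cdot>\<^sub>v ?e)) = d i \<cdot>\<^sub>v ?e"
      using assoc_mult_mat_vec[of "transpose_mat U" n n U n "d i \<cdot>\<^sub>v ?e"] U by simp
    also have "?e \<bullet> (d i \<cdot>\<^sub>v ?e) = d i" using i by simp
    finally show ?thesis using quad_nonneg[of "U *\<^sub>v ?e"] U(1) by auto
  qed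
  let ?C = "U * mat_diag n (\<lambda>i. 1 / (d i + t)) * transpose_mat U"
  have "B = U * mat_diag n (\<lambda>i. d i + t) * transpose_mat U"
  proof -
    have "mat_diag n (\<lambda>i. d i + t) = mat_diag n d + t \<cdot>\<^sub>m 1\<^sub>m n"
      by (rule eq_matI) (auto simp: mat_diag_def)
    then show ?thesis
      using U unfolding A_eq
      by (simp add: mult_add_distrib_mat[of _ n n _ n] add_mult_distrib_mat[of _ n n _ _ n] mult_smult_distrib[of _ n n _ n] mult_smult_assoc_mat[of _ n n _ n] as m right_mult_one_mat[of _ n n])
  qed
  then have "B * ?C = U * mat_diag n (\<lambda>i. (d i + t) * (1 / (d i + t))) * transpose_mat U"
    using conjugate_diag_mult[OF U(1,3)] by simp
  also have "mat_diag n (\<lambda>i. (d i + t) * (1 / (d i + t))) = 1\<^sub>m n"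
    using d t_pos by (intro eq_matI) (auto simp: mat_diag_def add_nonneg_eq_0_iff)
  finally have "B * ?C = 1\<^sub>m n" using U by simp
  then have RC: "R = ?C" using U by (intro R_eqI) auto
  have R_entry: "R $$ (i, i) = (\<Sum>k<n. U $$ (i, k) * (1 / (d k + t)) * U $$ (i, k))" if "i < n" for i
    unfolding RC mat_diag_mult_right[OF U(1)]
    using that U by (simp add: scalar_prod_def atLeast0LessThan)
  have col: "(\<Sum>i<n. U $$ (i, k) * U $$ (i, k)) = 1" if "k < n" for k
    using arg_cong[OF U(3), of "\<lambda>M. M $$ (k, k)"] that U(1) by (simp add: scalar_prod_def atLeast0LessThan)
  have "mtrace R = (\<Sum>i<n. \<Sum>k<n. U $$ (i, k) * (1 / (d k + t)) * U $$ (i, k))"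
    unfolding R_trace by (intro sum.cong refl R_entry) simp
  also have "\<dots> = (\<Sum>k<n. \<Sum>i<n. U $$ (i, k) * (1 / (d k + t)) * U $$ (i, k))"
    by (rule sum.swap)
  also have "\<dots> = (\<Sum>k<n. (1 / (d k + t)) * (\<Sum>i<n. U $$ (i, k) * U $$ (i, k)))"
    by (simp add: sum_distrib_left mult_ac)
  also have "\<dots> = (\<Sum>k<n. 1 / (d k + t))" by (intro sum.cong refl) (simp add: col)
  finally show "mtrace R = (\<Sum>i<n. 1 / (d i + t))" .
qed

end

text \<open>Sherman-Morrison on vectors: with \<open>R'\<close> the updated resolvent,
  \<open>R y = R' (B' (R y)) = R' y + s (x . R y) R' x\<close>, and \<open>y = x\<close> gives
  \<open>R x = (1 + q) R' x\<close>. The traces differ by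
  \<open>s (R x) . (R' x) = s |R x|^2 / (1 + q)\<close>, which \<open>R_norm\<close> places between
  0 and \<open>q / (t (1 + q))\<close>.\<close>

lemma resolvent_rank_one_update:
  fixes s :: real
  assumes "psd_shift A n t" "psd_shift A' n t" and x: "x \<in> carrier_vec n" and s: "0 \<le> s"
    and upd: "\<And>y. y \<in> carrier_vec n \<Longrightarrow> A' *\<^sub>v y = A *\<^sub>v y + (s * (x \<bullet> y)) \<cdot>\<^sub>v x"
  defines "q \<equiv> s * (x \<bullet> (resolvent t A *\<^sub>v x))"
  shows "0 \<le> q" "s * (x \<bullet> (resolvent t A' *\<^sub>v x)) = q / (1 + q)"
    and "mtrace (resolvent t A') \<le> mtrace (resolvent t A)"
    and "mtrace (resolvent t A) \<le> mtrace (resolvent t A') + 1 / t"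
proof -
  interpret A: psd_shift A n t by fact
  interpret A': psd_shift A' n t by fact
  show q: "0 \<le> q" using s A.R_quad_nonneg[OF x] by (simp add: q_def)
  have B': "A'.B *\<^sub>v y = A.B *\<^sub>v y + (s * (x \<bullet> y)) \<cdot>\<^sub>v x" if "y \<in> carrier_vec n" for y
    using that x A.carrier by (auto simp: A.B_mult_vec A'.B_mult_vec upd intro!: eq_vecI)
  have RR': "A.R *\<^sub>v y = A'.R *\<^sub>v y + (s * (x \<bullet> (A.R *\<^sub>v y))) \<cdot>\<^sub>v (A'.R *\<^sub>v x)" if y: "y \<in> carrier_vec n" for y
  proof -
    have "A.R *\<^sub>v y = A'.R *\<^sub>v (A'.B *\<^sub>v (A.R *\<^sub>v y))"
      using A.R_vec_carrier[OF y] by (simp add: A'.R_B_vec)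
    also have "A'.B *\<^sub>v (A.R *\<^sub>v y) = y + (s * (x \<bullet> (A.R *\<^sub>v y))) \<cdot>\<^sub>v x"
      using A.R_vec_carrier[OF y] y by (simp add: B' A.B_R_vec)
    also have "A'.R *\<^sub>v \<dots> = A'.R *\<^sub>v y + (s * (x \<bullet> (A.R *\<^sub>v y))) \<cdot>\<^sub>v (A'.R *\<^sub>v x)"
      using x y A'.R_carrier by (simp add: mult_add_distrib_mat_vec[of _ n n] mult_mat_vec[of _ n n])
    finally show ?thesis .
  qed
  have Rx: "A.R *\<^sub>v x = (1 + q) \<cdot>\<^sub>v (A'.R *\<^sub>v x)"
  proof -
    have "A.R *\<^sub>v x = A'.R *\<^sub>v x + q \<cdot>\<^sub>v (A'.R *\<^sub>v x)" using RR'[OF x] by (simp add: q_def)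
    then show ?thesis by (simp add: add_smult_distrib_vec)
  qed
  have "x \<bullet> (A.R *\<^sub>v x) = (1 + q) * (x \<bullet> (A'.R *\<^sub>v x))"
    by (subst Rx) (use x A'.R_vec_carrier[OF x] in simp)
  then have "q = (1 + q) * (s * (x \<bullet> (A'.R *\<^sub>v x)))"
    by (metis q_def mult.left_commute)
  then show "s * (x \<bullet> (A'.R *\<^sub>v x)) = q / (1 + q)" using q by (simp add: field_simps)
  have tr: "mtrace A.R = mtrace A'.R + s * ((A.R *\<^sub>v x) \<bullet> (A'.R *\<^sub>v x))"
  proof -
    have "A.R $$ (i, i) = A'.R $$ (i, i) + s * ((A.R *\<^sub>v x) $ i * (A'.R *\<^sub>v x) $ i)" if i: "i < n" for i
    proof -
      have "x \<bullet> (A.R *\<^sub>v unit_vec n i) = (A.R *\<^sub>v x) $ i"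
        using i A.R_adjoint[OF x, of "unit_vec n i"] A.R_vec_carrier[OF x] by simp
      then show ?thesis
        using arg_cong[OF RR'[of "unit_vec n i"], of "\<lambda>v. v $ i"] i A'.R_carrier
        by (simp add: A.R_unit A'.R_unit del: index_mult_mat_vec)
    qed
    then show ?thesis
      unfolding A.R_trace A'.R_trace scalar_prod_def
      using A'.R_carrier by (simp add: sum.distrib sum_distrib_left atLeast0LessThan del: index_mult_mat_vec)
  qed
  have d: "s * ((A.R *\<^sub>v x) \<bullet> (A'.R *\<^sub>v x)) * (1 + q) = s * ((A.R *\<^sub>v x) \<bullet> (A.R *\<^sub>v x))"
    using A'.R_vec_carrier[OF x] by (simp add: Rx)
  have b: "t * (s * ((A.R *\<^sub>v x) \<bullet> (A.R *\<^sub>v x))) \<le> q"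
    using mult_left_mono[OF A.R_norm[OF x] s] by (simp add: q_def mult_ac)
  have eq: "s * ((A.R *\<^sub>v x) \<bullet> (A'.R *\<^sub>v x)) = s * ((A.R *\<^sub>v x) \<bullet> (A.R *\<^sub>v x)) / (1 + q)"
    using d q by (simp add: field_simps)
  have nn: "0 \<le> s * ((A.R *\<^sub>v x) \<bullet> (A.R *\<^sub>v x))" using s scalar_prod_self_nonneg by simp
  then show "mtrace A'.R \<le> mtrace A.R" unfolding tr eq using q by simp
  have "s * ((A.R *\<^sub>v x) \<bullet> (A.R *\<^sub>v x)) \<le> q / t"
    using b A.t_pos by (simp add: field_simps)
  also have "\<dots> \<le> (1 + q) / t" using A.t_pos by (simp add: divide_right_mono)
  finally have "s * ((A.R *\<^sub>v x) \<bullet> (A.R *\<^sub>v x)) / (1 + q) \<le> 1 / t"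
    using q A.t_pos by (simp add: field_simps)
  then show "mtrace A.R \<le> mtrace A'.R + 1 / t" unfolding tr eq by simp
qed

text \<open>The set \<open>J\<close> of columns is a parameter: column \<open>j\<close> is deleted
  by passing to \<open>J - {j}\<close>, while the dimension and the scale \<open>s\<close> stay
  fixed, so that the two matrices differ by a rank-one term only.\<close>

definition gram :: "nat \<Rightarrow> real \<Rightarrow> nat set \<Rightarrow> (nat \<times> nat \<Rightarrow> real) \<Rightarrow> real mat" where
  "gram n s J x = Matrix.mat n n (\<lambda>(i, k). s * (\<Sum>j\<in>J. x (i, j) * x (k, j)))"

definition colvec :: "nat \<Rightarrow> (nat \<times> nat \<Rightarrow> real) \<Rightarrow> nat \<Rightarrow> real vec" where
  "colvec n x j = vec n (\<lambda>i. x (i, j))"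

lemma gram_carrier [simp]: "gram n s J x \<in> carrier_mat n n"
  by (simp add: gram_def)

lemma colvec_carrier [simp]: "colvec n x j \<in> carrier_vec n"
  by (simp add: colvec_def)

lemma dim_gram [simp]: "dim_row (gram n s J x) = n" "dim_col (gram n s J x) = n"
  by (simp_all add: gram_def)

lemma gram_mult_vec_index:
  assumes "y \<in> carrier_vec n" "i < n"
  shows "(gram n s J x *\<^sub>v y) $ i = s * (\<Sum>j\<in>J. (colvec n x j \<bullet> y) * x (i, j))"
proof -
  have "(gram n s J x *\<^sub>v y) $ i = (\<Sum>k<n. \<Sum>j\<in>J. s * (x (i, j) * x (k, j) * y $ k))"
    using assms by (simp add: gram_def scalar_prod_def atLeast0LessThan sum_distrib_left sum_distrib_right mult_ac)
  also have "\<dots> = (\<Sum>j\<in>J. \<Sum>k<n. s * (x (i, j) * x (k, j) * y $ k))" by (rule sum.swap)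
  finally show ?thesis
    using assms by (simp add: colvec_def scalar_prod_def atLeast0LessThan sum_distrib_left sum_distrib_right mult_ac)
qed

lemma gram_quad:
  assumes "y \<in> carrier_vec n"
  shows "y \<bullet> (gram n s J x *\<^sub>v y) = s * (\<Sum>j\<in>J. (colvec n x j \<bullet> y)\<^sup>2)"
proof -
  have "y \<bullet> (gram n s J x *\<^sub>v y) = (\<Sum>i<n. \<Sum>j\<in>J. s * ((colvec n x j \<bullet> y) * x (i, j) * y $ i))"
    using assms by (simp add: scalar_prod_def[of y] atLeast0LessThan gram_mult_vec_index sum_distrib_left mult_ac
        del: index_mult_mat_vec)
  also have "\<dots> = (\<Sum>j\<in>J. \<Sum>i<n. s * ((colvec n x j \<bullet> y) * x (i, j) * y $ i))" by (rule sum.swap)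
  also have "\<dots> = (\<Sum>j\<in>J. s * ((colvec n x j \<bullet> y) * (\<Sum>i<n. x (i, j) * y $ i)))"
    by (simp add: sum_distrib_left mult_ac)
  also have "\<dots> = (\<Sum>j\<in>J. s * ((colvec n x j \<bullet> y) * (colvec n x j \<bullet> y)))"
    using assms by (simp add: scalar_prod_def atLeast0LessThan colvec_def)
  finally show ?thesis by (simp add: sum_distrib_left power2_eq_square)
qed

lemma psd_shift_gram: "0 \<le> s \<Longrightarrow> 0 < t \<Longrightarrow> psd_shift (gram n s J x) n t"
proof unfold_locales
  assume "0 \<le> s"
  moreover have "transpose_mat (gram n s J x) = gram n s J x"
    by (rule eq_matI) (auto simp: gram_def mult.commute)
  ultimately show "pos_semidef (gram n s J x)"
    by (auto simp: pos_semidef_def gram_quad intro!: mult_nonneg_nonneg sum_nonneg)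
qed simp_all

lemma gram_remove:
  assumes "finite J" "j \<in> J" "y \<in> carrier_vec n"
  shows "gram n s J x *\<^sub>v y = gram n s (J - {j}) x *\<^sub>v y + (s * (colvec n x j \<bullet> y)) \<cdot>\<^sub>v colvec n x j"
proof (rule eq_vecI)
  fix i assume "i < dim_vec (gram n s (J - {j}) x *\<^sub>v y + (s * (colvec n x j \<bullet> y)) \<cdot>\<^sub>v colvec n x j)"
  then have i: "i < n" by (simp add: colvec_def)
  show "(gram n s J x *\<^sub>v y) $ i = (gram n s (J - {j}) x *\<^sub>v y + (s * (colvec n x j \<bullet> y)) \<cdot>\<^sub>v colvec n x j) $ i"
    using i assms
    by (simp add: gram_mult_vec_index sum.remove[of J j] carrier_vecD[OF colvec_carrier] del: index_mult_mat_vec)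
      (simp add: colvec_def algebra_simps)
qed (simp add: carrier_vecD[OF colvec_carrier])

lemma gram_trace_identity:
  assumes s: "0 \<le> s" and t: "0 < t"
  shows "(\<Sum>j\<in>J. s * (colvec n x j \<bullet> (resolvent t (gram n s J x) *\<^sub>v colvec n x j)))
    + t * mtrace (resolvent t (gram n s J x)) = real n"
proof -
  interpret psd_shift "gram n s J x" n t using psd_shift_gram[OF s t] .
  \<comment> \<open>The diagonal entry \<open>(i, i)\<close> of \<open>B * R = 1\<close>; symmetry
    of \<open>R\<close> moves it from the unit vector onto the columns.\<close>
  have "s * (\<Sum>j\<in>J. (R *\<^sub>v colvec n x j) $ i * x (i, j)) + t * R $$ (i, i) = 1" if i: "i < n" for i
  proof -
    have "colvec n x j \<bullet> (R *\<^sub>v unit_vec n i) = (R *\<^sub>v colvec n x j) $ i" for j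
      using i R_adjoint[of "colvec n x j" "unit_vec n i"] R_vec_carrier[of "colvec n x j"] by simp
    then have "(gram n s J x *\<^sub>v (R *\<^sub>v unit_vec n i)) $ i = s * (\<Sum>j\<in>J. (R *\<^sub>v colvec n x j) $ i * x (i, j))"
      using R_vec_carrier[of "unit_vec n i"] i by (simp add: gram_mult_vec_index del: index_mult_mat_vec)
    then show ?thesis
      using arg_cong[OF B_R_vec[of "unit_vec n i"], of "\<lambda>v. v $ i"] i R_vec_carrier[of "unit_vec n i"] R_carrier
      by (simp add: B_mult_vec R_unit del: index_mult_mat_vec)
  qed
  then have "(\<Sum>i<n. s * (\<Sum>j\<in>J. (R *\<^sub>v colvec n x j) $ i * x (i, j)) + t * R $$ (i, i)) = real n"
    by simp
  then have e: "(\<Sum>i<n. s * (\<Sum>j\<in>J. (R *\<^sub>v colvec n x j) $ i * x (i, j))) + t * mtrace R = real n"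
    by (simp add: sum.distrib R_trace sum_distrib_left)
  have "(\<Sum>i<n. s * (\<Sum>j\<in>J. (R *\<^sub>v colvec n x j) $ i * x (i, j)))
      = (\<Sum>j\<in>J. \<Sum>i<n. s * ((R *\<^sub>v colvec n x j) $ i * x (i, j)))"
    by (simp only: sum_distrib_left, rule sum.swap)
  also have "\<dots> = (\<Sum>j\<in>J. s * (colvec n x j \<bullet> (R *\<^sub>v colvec n x j)))"
    using R_carrier by (simp add: scalar_prod_def[of "colvec n x _"] atLeast0LessThan sum_distrib_left mult_ac del: index_mult_mat_vec)
      (simp add: colvec_def)
  finally show ?thesis using e by simp
qed

text \<open>A positive semidefinite \<open>C\<close> with square \<open>\<sigma>^2\<close> satisfies
  \<open>(C + |\<sigma>|) (C - |\<sigma>|) = 0\<close>, and the first factor is invertible, being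
  the shift of \<open>C\<close> by \<open>|\<sigma>|\<close>. Hence the root is unique, as the
  \<open>THE\<close> in \<open>mat_sqrt\<close> demands.\<close>

lemma mat_sqrt_smult_one:
  assumes "\<sigma> \<noteq> 0"
  shows "mat_sqrt (\<sigma>\<^sup>2 \<cdot>\<^sub>m 1\<^sub>m n) = \<bar>\<sigma>\<bar> \<cdot>\<^sub>m 1\<^sub>m n"
  unfolding mat_sqrt_def
proof (rule the_equality)
  have mv: "(\<bar>\<sigma>\<bar> \<cdot>\<^sub>m 1\<^sub>m n) *\<^sub>v v = \<bar>\<sigma>\<bar> \<cdot>\<^sub>v v" if "v \<in> carrier_vec n" for v
    using that by (intro eq_vecI) auto
  show "pos_semidef (\<bar>\<sigma>\<bar> \<cdot>\<^sub>m 1\<^sub>m n) \<and> dim_row (\<bar>\<sigma>\<bar> \<cdot>\<^sub>m 1\<^sub>m n) = dim_row (\<sigma>\<^sup>2 \<cdot>\<^sub>m 1\<^sub>m n) \<and>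
    (\<bar>\<sigma>\<bar> \<cdot>\<^sub>m 1\<^sub>m n) * (\<bar>\<sigma>\<bar> \<cdot>\<^sub>m 1\<^sub>m n) = \<sigma>\<^sup>2 \<cdot>\<^sub>m 1\<^sub>m n"
    by (auto simp: pos_semidef_def mv scalar_prod_self_nonneg mult_smult_distrib[of _ n n _ n] mult_smult_assoc_mat[of _ n n _ n]
        power2_eq_square intro!: eq_matI)
next
  fix C assume "pos_semidef C \<and> dim_row C = dim_row (\<sigma>\<^sup>2 \<cdot>\<^sub>m 1\<^sub>m n) \<and> C * C = \<sigma>\<^sup>2 \<cdot>\<^sub>m 1\<^sub>m n"
  then have C: "pos_semidef C" "C \<in> carrier_mat n n" "C * C = \<sigma>\<^sup>2 \<cdot>\<^sub>m 1\<^sub>m n"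
    by (auto simp: pos_semidef_def)
  interpret psd_shift C n "\<bar>\<sigma>\<bar>" using C assms by unfold_locales auto
  have "B * C = B * (\<bar>\<sigma>\<bar> \<cdot>\<^sub>m 1\<^sub>m n)"
    using C(2) by (simp add: add_mult_distrib_mat[of _ n n _ _ n] C(3) mult_smult_distrib[of _ n n _ n]
        mult_smult_assoc_mat[of _ n n _ n] left_mult_one_mat[of _ n n] right_mult_one_mat[of _ n n])
      (auto intro!: eq_matI simp: power2_eq_square algebra_simps)
  then have "(R * B) * C = (R * B) * (\<bar>\<sigma>\<bar> \<cdot>\<^sub>m 1\<^sub>m n)"
    using assoc_mult_mat[OF R_carrier B_carrier C(2)] assoc_mult_mat[OF R_carrier B_carrier, of "\<bar>\<sigma>\<bar> \<cdot>\<^sub>m 1\<^sub>m n" n] by simp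
  then show "C = \<bar>\<sigma>\<bar> \<cdot>\<^sub>m 1\<^sub>m n" using C(2) by (simp add: R_B)
qed

lemma sample_cov_scaled_identity:
  assumes "\<sigma> \<noteq> 0"
  shows "sample_cov (\<sigma>\<^sup>2 \<cdot>\<^sub>m 1\<^sub>m p) (Matrix.mat p n x) = \<sigma>\<^sup>2 \<cdot>\<^sub>m gram p (1 / real n) {..<n} x"
proof -
  have Y: "\<bar>\<sigma>\<bar> \<cdot>\<^sub>m 1\<^sub>m p * Matrix.mat p n x = Matrix.mat p n (\<lambda>ij. \<bar>\<sigma>\<bar> * x ij)"
    by (subst mult_smult_assoc_mat[of _ p p _ n]) (auto intro!: eq_matI)
  have sigma2: "(\<bar>\<sigma>\<bar> * a) * (\<bar>\<sigma>\<bar> * b) = \<sigma>\<^sup>2 * (a * b)" for a b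
  proof -
    have "(\<bar>\<sigma>\<bar> * a) * (\<bar>\<sigma>\<bar> * b) = \<bar>\<sigma>\<bar>\<^sup>2 * (a * b)" by (simp only: power2_eq_square mult_ac)
    then show ?thesis by simp
  qed
  show ?thesis
    unfolding sample_cov_def Let_def mat_sqrt_smult_one[OF assms] Y
    by (rule eq_matI)
      (simp_all add: gram_def scalar_prod_def atLeast0LessThan sum_distrib_left sigma2)
qed

subsection \<open>Quadratic forms in independent entries\<close>

text \<open>The cross term vanishes because \<open>h\<close> has mean 0. The left-hand side is a
  nonnegative integral so that the inductions over coordinates can use Tonelli without any
  integrability on the product space.\<close>

lemma nn_integral_quadratic:
  fixes h :: "real \<Rightarrow> real"
  assumes "prob_space \<mu>" "integrable \<mu> h" "integrable \<mu> (\<lambda>y. (h y)\<^sup>2)" "(\<integral>y. h y \<partial>\<mu>) = 0"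
  shows "(\<integral>\<^sup>+y. ennreal ((u + h y * v)\<^sup>2) \<partial>\<mu>) = ennreal (u\<^sup>2 + (\<integral>y. (h y)\<^sup>2 \<partial>\<mu>) * v\<^sup>2)"
proof -
  interpret prob_space \<mu> by fact
  have e: "(u + h y * v)\<^sup>2 = u\<^sup>2 + (2 * u * v) * h y + v\<^sup>2 * (h y)\<^sup>2" for y
    by (simp add: power2_eq_square algebra_simps)
  have "integrable \<mu> (\<lambda>y. (u + h y * v)\<^sup>2)" unfolding e using assms by auto
  then have "(\<integral>\<^sup>+y. ennreal ((u + h y * v)\<^sup>2) \<partial>\<mu>) = ennreal (\<integral>y. (u + h y * v)\<^sup>2 \<partial>\<mu>)"
    by (intro nn_integral_eq_integral) auto
  also have "(\<integral>y. (u + h y * v)\<^sup>2 \<partial>\<mu>) = u\<^sup>2 + (\<integral>y. (h y)\<^sup>2 \<partial>\<mu>) * v\<^sup>2"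
    unfolding e using assms by (simp add: prob_space)
  finally show ?thesis .
qed

locale iid_product =
  fixes \<mu> :: "real measure"
  assumes prob: "prob_space \<mu>" and sets_mu [measurable_cong]: "sets \<mu> = sets borel"
begin

lemma product_prob_space: "product_prob_space (\<lambda>_. \<mu>)"
  using prob by (rule product_prob_spaceI)

lemma nn_integral_component:
  fixes I :: "'i set"
  assumes "i \<in> I" and f [measurable]: "f \<in> borel_measurable borel"
  shows "(\<integral>\<^sup>+x. f (x i) \<partial>(Pi\<^sub>M I (\<lambda>_. \<mu>))) = (\<integral>\<^sup>+y. f y \<partial>\<mu>)"
proof -
  interpret product_prob_space "\<lambda>_::'i. \<mu>" by (rule product_prob_space)
  have "(\<integral>\<^sup>+y. f y \<partial>\<mu>) = (\<integral>\<^sup>+y. f y \<partial>(distr (Pi\<^sub>M I (\<lambda>_. \<mu>)) \<mu> (\<lambda>\<omega>. \<omega> i)))"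
    using assms by (simp add: PiM_component)
  also have "\<dots> = (\<integral>\<^sup>+x. f (x i) \<partial>(Pi\<^sub>M I (\<lambda>_. \<mu>)))"
    using assms by (intro nn_integral_distr) measurable
  finally show ?thesis by simp
qed

text \<open>Each new coordinate contributes a term of mean 0 given the others, so the squares add
  up. A general \<open>h\<close> covers both the entry itself and its centred truncated
  square.\<close>

lemma nn_integral_linear_form_sq:
  fixes I :: "'i set"
  assumes "finite I" and h: "integrable \<mu> h" "integrable \<mu> (\<lambda>y. (h y)\<^sup>2)" "(\<integral>y. h y \<partial>\<mu>) = 0"
  shows "(\<integral>\<^sup>+x. ennreal ((\<Sum>i\<in>I. a i * h (x i))\<^sup>2) \<partial>(Pi\<^sub>M I (\<lambda>_. \<mu>)))
    = ennreal ((\<integral>y. (h y)\<^sup>2 \<partial>\<mu>) * (\<Sum>i\<in>I. (a i)\<^sup>2))"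
  using assms(1)
proof (induction I)
  case empty
  interpret product_prob_space "\<lambda>_::'i. \<mu>" by (rule product_prob_space)
  show ?case by (simp add: nn_integral_empty)
next
  case (insert m I)
  interpret product_prob_space "\<lambda>_::'i. \<mu>" by (rule product_prob_space)
  have hm [measurable]: "h \<in> borel_measurable borel"
    using borel_measurable_integrable[OF h(1)] by (simp cong: measurable_cong_sets add: sets_mu)
  let ?v = "\<integral>y. (h y)\<^sup>2 \<partial>\<mu>"
  have [measurable]: "(\<lambda>x. ennreal ((\<Sum>i\<in>I. a i * h (x i))\<^sup>2)) \<in> borel_measurable (Pi\<^sub>M I (\<lambda>_. \<mu>))"
    by measurable
  have upd: "(\<Sum>i\<in>insert m I. a i * h ((x(m := y)) i)) = (\<Sum>i\<in>I. a i * h (x i)) + h y * a m" for x y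
    using insert by (simp add: add.commute mult.commute, intro sum.cong) auto
  have "(\<integral>\<^sup>+x. ennreal ((\<Sum>i\<in>insert m I. a i * h (x i))\<^sup>2) \<partial>(Pi\<^sub>M (insert m I) (\<lambda>_. \<mu>)))
    = (\<integral>\<^sup>+x. \<integral>\<^sup>+y. ennreal (((\<Sum>i\<in>I. a i * h (x i)) + h y * a m)\<^sup>2) \<partial>\<mu> \<partial>(Pi\<^sub>M I (\<lambda>_. \<mu>)))"
    using insert by (subst product_nn_integral_insert) (auto simp: upd simp del: sum.insert fun_upd_apply)
  also have "\<dots> = (\<integral>\<^sup>+x. ennreal ((\<Sum>i\<in>I. a i * h (x i))\<^sup>2) + ennreal (?v * (a m)\<^sup>2) \<partial>(Pi\<^sub>M I (\<lambda>_. \<mu>)))"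
    by (simp add: nn_integral_quadratic[OF prob h] flip: ennreal_plus)
  also have "\<dots> = ennreal (?v * (\<Sum>i\<in>I. (a i)\<^sup>2)) + ennreal (?v * (a m)\<^sup>2)"
    by (subst nn_integral_add)
      (simp_all add: insert.IH prob_space.emeasure_space_1[OF prob_space_PiM] prob)
  also have "\<dots> = ennreal (?v * (\<Sum>i\<in>insert m I. (a i)\<^sup>2))"
    using insert by (simp add: algebra_simps sum_nonneg flip: ennreal_plus)
  finally show ?case .
qed

text \<open>Including the index \<open>m\<close> adds \<open>2 * x m * v x\<close> with
  \<open>v\<close> linear in the other coordinates. The second moment grows by
  \<open>4 * (\<Sum>k\<in>I. (A m k)\<^sup>2)\<close>, twice the growth of the double sum, which
  meets each pair in both orders. Second moments suffice because the two indices of a product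
  differ.\<close>

lemma nn_integral_off_diagonal_sq:
  fixes I :: "'i set"
  assumes "finite I" and h: "integrable \<mu> (\<lambda>y. y)" "integrable \<mu> (\<lambda>y. y\<^sup>2)" "(\<integral>y. y \<partial>\<mu>) = 0" "(\<integral>y. y\<^sup>2 \<partial>\<mu>) = 1"
    and sym: "\<And>i k. i \<in> I \<Longrightarrow> k \<in> I \<Longrightarrow> A i k = A k i"
  shows "(\<integral>\<^sup>+x. ennreal ((\<Sum>i\<in>I. \<Sum>k\<in>I - {i}. A i k * x i * x k)\<^sup>2) \<partial>(Pi\<^sub>M I (\<lambda>_. \<mu>)))
    = ennreal (2 * (\<Sum>i\<in>I. \<Sum>k\<in>I - {i}. (A i k)\<^sup>2))"
  using assms(1) sym
proof (induction I)
  case empty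
  interpret product_prob_space "\<lambda>_::'i. \<mu>" by (rule product_prob_space)
  show ?case by (simp add: nn_integral_empty)
next
  case (insert m I)
  interpret product_prob_space "\<lambda>_::'i. \<mu>" by (rule product_prob_space)
  define U where "U x = (\<Sum>i\<in>I. \<Sum>k\<in>I - {i}. A i k * x i * x k)" for x
  define v where "v x = (\<Sum>k\<in>I. A m k * x k)" for x
  have split: "(\<Sum>i\<in>insert m I. \<Sum>k\<in>insert m I - {i}. f i k) = (\<Sum>i\<in>I. \<Sum>k\<in>I - {i}. f i k) + 2 * (\<Sum>k\<in>I. f m k)"
    if "\<And>i. i \<in> I \<Longrightarrow> f i m = f m i" for f :: "_ \<Rightarrow> _ \<Rightarrow> real"
  proof -
    have "(\<Sum>k\<in>insert m I - {i}. f i k) = (\<Sum>k\<in>I - {i}. f i k) + f m i" if i: "i \<in> I" for i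
    proof -
      have "insert m I - {i} = insert m (I - {i})" using i insert by auto
      then show ?thesis using insert \<open>\<And>i. i \<in> I \<Longrightarrow> f i m = f m i\<close>[OF i] by simp
    qed
    moreover have "insert m I - {m} = I" using insert by auto
    ultimately show ?thesis using insert by (simp add: sum.distrib)
  qed
  have upd: "(\<Sum>i\<in>insert m I. \<Sum>k\<in>insert m I - {i}. A i k * (x(m := y)) i * (x(m := y)) k) = U x + y * (2 * v x)" for x y
  proof -
    have ne: "m \<noteq> k" if "k \<in> I" for k using that insert by auto
    have "(\<Sum>i\<in>I. \<Sum>k\<in>I - {i}. A i k * (x(m := y)) i * (x(m := y)) k) = U x"
      unfolding U_def using ne by (intro sum.cong refl) auto
    moreover have "(\<Sum>k\<in>I. A m k * (x(m := y)) m * (x(m := y)) k) = y * v x"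
      unfolding v_def sum_distrib_left using ne by (intro sum.cong refl) (auto simp: mult_ac)
    ultimately show ?thesis
      by (subst split) (use insert.prems in \<open>auto simp del: fun_upd_apply simp: mult_ac\<close>)
  qed
  have [measurable]: "U \<in> borel_measurable (Pi\<^sub>M I (\<lambda>_. \<mu>))" unfolding U_def by measurable
  have [measurable]: "v \<in> borel_measurable (Pi\<^sub>M I (\<lambda>_. \<mu>))" unfolding v_def by measurable
  have "(\<integral>\<^sup>+x. ennreal ((\<Sum>i\<in>insert m I. \<Sum>k\<in>insert m I - {i}. A i k * x i * x k)\<^sup>2) \<partial>(Pi\<^sub>M (insert m I) (\<lambda>_. \<mu>)))
    = (\<integral>\<^sup>+x. \<integral>\<^sup>+y. ennreal ((U x + y * (2 * v x))\<^sup>2) \<partial>\<mu> \<partial>(Pi\<^sub>M I (\<lambda>_. \<mu>)))"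
    using insert by (subst product_nn_integral_insert) (simp_all only: upd, measurable)
  also have "\<dots> = (\<integral>\<^sup>+x. ennreal ((U x)\<^sup>2) + ennreal 4 * ennreal ((v x)\<^sup>2) \<partial>(Pi\<^sub>M I (\<lambda>_. \<mu>)))"
    by (intro nn_integral_cong, subst nn_integral_quadratic[OF prob h(1-3)])
      (simp_all add: h(4) power_mult_distrib ennreal_mult)
  also have "\<dots> = (\<integral>\<^sup>+x. ennreal ((U x)\<^sup>2) \<partial>(Pi\<^sub>M I (\<lambda>_. \<mu>))) + ennreal 4 * (\<integral>\<^sup>+x. ennreal ((v x)\<^sup>2) \<partial>(Pi\<^sub>M I (\<lambda>_. \<mu>)))"
    by (subst nn_integral_add) (simp_all add: nn_integral_cmult)
  also have "(\<integral>\<^sup>+x. ennreal ((U x)\<^sup>2) \<partial>(Pi\<^sub>M I (\<lambda>_. \<mu>))) = ennreal (2 * (\<Sum>i\<in>I. \<Sum>k\<in>I - {i}. (A i k)\<^sup>2))"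
    using insert unfolding U_def by simp
  also have "(\<integral>\<^sup>+x. ennreal ((v x)\<^sup>2) \<partial>(Pi\<^sub>M I (\<lambda>_. \<mu>))) = ennreal (\<Sum>k\<in>I. (A m k)\<^sup>2)"
    using nn_integral_linear_form_sq[OF insert(1) h(1-3), of "A m"] by (simp add: v_def h(4))
  also have "ennreal (2 * (\<Sum>i\<in>I. \<Sum>k\<in>I - {i}. (A i k)\<^sup>2)) + ennreal 4 * ennreal (\<Sum>k\<in>I. (A m k)\<^sup>2)
      = ennreal (2 * (\<Sum>i\<in>insert m I. \<Sum>k\<in>insert m I - {i}. (A i k)\<^sup>2))"
  proof -
    have "(\<Sum>i\<in>insert m I. \<Sum>k\<in>insert m I - {i}. (A i k)\<^sup>2)
        = (\<Sum>i\<in>I. \<Sum>k\<in>I - {i}. (A i k)\<^sup>2) + 2 * (\<Sum>k\<in>I. (A m k)\<^sup>2)"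
      using insert.prems by (intro split) simp
    then show ?thesis
      by (simp only: distrib_left mult.assoc[symmetric]) (simp add: ennreal_plus ennreal_mult sum_nonneg)
  qed
  finally show ?case .
qed

end

text \<open>Young's inequality \<open>|y| \<le> y^2 / (2 * s) + s / 2\<close> at
  \<open>s = sqrt V\<close>, integrated; it stands in for Cauchy-Schwarz at the level of nonnegative
  integrals.\<close>

lemma nn_integral_abs_le_sqrt:
  fixes f :: "'a \<Rightarrow> real"
  assumes "prob_space M" and [measurable]: "f \<in> borel_measurable M"
    and le: "(\<integral>\<^sup>+x. ennreal ((f x)\<^sup>2) \<partial>M) \<le> ennreal V" and V: "0 < V"
  shows "(\<integral>\<^sup>+x. ennreal \<bar>f x\<bar> \<partial>M) \<le> ennreal (sqrt V)"
proof -
  interpret prob_space M by fact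
  let ?s = "sqrt V"
  have s: "0 < ?s" "?s * ?s = V" using V by simp_all
  have "\<bar>y\<bar> \<le> (1 / (2 * ?s)) * y\<^sup>2 + ?s / 2" for y
  proof -
    have "0 \<le> (\<bar>y\<bar> - ?s)\<^sup>2" by simp
    then have "2 * ?s * \<bar>y\<bar> \<le> y\<^sup>2 + ?s * ?s" by (simp add: power2_eq_square algebra_simps)
    then show ?thesis using s(1) by (simp add: field_simps)
  qed
  then have "(\<integral>\<^sup>+x. ennreal \<bar>f x\<bar> \<partial>M) \<le> (\<integral>\<^sup>+x. ennreal (1 / (2 * ?s)) * ennreal ((f x)\<^sup>2) + ennreal (?s / 2) \<partial>M)"
    using s(1) by (intro nn_integral_mono) (simp add: ennreal_leI flip: ennreal_mult ennreal_plus)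
  also have "\<dots> = ennreal (1 / (2 * ?s)) * (\<integral>\<^sup>+x. ennreal ((f x)\<^sup>2) \<partial>M) + ennreal (?s / 2)"
    by (subst nn_integral_add) (simp_all add: nn_integral_cmult emeasure_space_1)
  also have "\<dots> \<le> ennreal (1 / (2 * ?s)) * ennreal V + ennreal (?s / 2)"
    by (intro add_right_mono mult_left_mono le) simp
  also have "\<dots> = ennreal (V / (2 * ?s) + ?s / 2)"
    using s(1) V by (simp flip: ennreal_mult ennreal_plus)
  also have "V / (2 * ?s) + ?s / 2 = ?s"
    using s by (simp add: field_simps)
  finally show ?thesis .
qed

context iid_product
begin

text \<open>Only the diagonal part needs the truncation at \<open>K\<close>: the off-diagonal part is
  square-integrable under second moments alone.\<close>
lemma nn_integral_quadratic_form_deviation: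
  fixes I :: "'i set"
  assumes I: "finite I" "I \<noteq> {}"
    and h: "integrable \<mu> (\<lambda>y. y)" "integrable \<mu> (\<lambda>y. y\<^sup>2)" "(\<integral>y. y \<partial>\<mu>) = 0" "(\<integral>y. y\<^sup>2 \<partial>\<mu>) = 1"
    and sym: "\<And>i k. i \<in> I \<Longrightarrow> k \<in> I \<Longrightarrow> A i k = A k i"
    and b: "0 < b" and diag: "\<And>i. i \<in> I \<Longrightarrow> 0 \<le> A i i" "\<And>i. i \<in> I \<Longrightarrow> A i i \<le> b"
    and row: "\<And>i. i \<in> I \<Longrightarrow> (\<Sum>k\<in>I. (A i k)\<^sup>2) \<le> b\<^sup>2"
    and K: "0 < K"
  defines "\<delta> \<equiv> (\<integral>y. (if y\<^sup>2 \<le> K then 0 else y\<^sup>2) \<partial>\<mu>)" and "p \<equiv> real (card I)"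
  shows "(\<integral>\<^sup>+x. ennreal \<bar>(\<Sum>i\<in>I. \<Sum>k\<in>I. A i k * x i * x k) - (\<Sum>i\<in>I. A i i)\<bar> \<partial>(Pi\<^sub>M I (\<lambda>_. \<mu>)))
    \<le> ennreal (sqrt (2 * p * b\<^sup>2) + (2 * p * b * \<delta> + sqrt (p * b\<^sup>2 * K\<^sup>2)))"
proof -
  interpret mu: prob_space \<mu> by (rule prob)
  interpret product_prob_space "\<lambda>_::'i. \<mu>" by (rule product_prob_space)
  let ?P = "Pi\<^sub>M I (\<lambda>_. \<mu>)"
  interpret P: prob_space ?P by (intro prob_space_PiM prob)
  have p: "0 < p" using I by (simp add: p_def card_gt_0_iff)
  define f where "f y = (if y\<^sup>2 \<le> K then y\<^sup>2 else 0)" for y :: real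
  define g where "g y = (if y\<^sup>2 \<le> K then 0 else y\<^sup>2)" for y :: real
  have [measurable]: "f \<in> borel_measurable borel" "g \<in> borel_measurable borel"
    unfolding f_def g_def by measurable
  have fg: "f y + g y = y\<^sup>2" and f_bounds: "0 \<le> f y" "f y \<le> K" and g_nn: "0 \<le> g y" for y
    using K by (auto simp: f_def g_def)
  have f_int: "integrable \<mu> f"
  proof (rule mu.integrable_const_bound[where B = K])
    show "AE y in \<mu>. norm (f y) \<le> K" using f_bounds by simp
  qed measurable
  have g_int: "integrable \<mu> g"
  proof (rule Bochner_Integration.integrable_bound[OF h(2)])
    show "AE y in \<mu>. norm (g y) \<le> norm (y\<^sup>2)" by (simp add: g_def)
  qed measurable
  have \<delta>: "\<delta> = (\<integral>y. g y \<partial>\<mu>)" by (simp add: \<delta>_def g_def)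
  have \<delta>_nn: "0 \<le> \<delta>" unfolding \<delta> by (intro integral_nonneg_AE) (simp add: g_nn)
  define m where "m = (\<integral>y. f y \<partial>\<mu>)"
  have m\<delta>: "m + \<delta> = 1" unfolding m_def \<delta> using f_int g_int h(4) by (simp add: fg flip: Bochner_Integration.integral_add)
  have m: "0 \<le> m" "m \<le> K"
    unfolding m_def using f_bounds mu.integral_le_const[OF f_int, of K]
    by (auto intro!: integral_nonneg_AE)
  define w where "w y = f y - m" for y
  have w_abs: "\<bar>w y\<bar> \<le> K" for y using m f_bounds[of y] by (auto simp: w_def abs_le_iff)
  have [measurable]: "w \<in> borel_measurable borel" unfolding w_def by measurable
  have w: "integrable \<mu> w" "(\<integral>y. w y \<partial>\<mu>) = 0"
    unfolding w_def using f_int by (auto simp: m_def mu.prob_space)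
  have w_sq: "(w y)\<^sup>2 \<le> K\<^sup>2" for y using w_abs[of y] by (metis abs_le_square_iff abs_of_pos K)
  have w2: "integrable \<mu> (\<lambda>y. (w y)\<^sup>2)"
  proof (rule mu.integrable_const_bound[where B = "K\<^sup>2"])
    show "AE y in \<mu>. norm ((w y)\<^sup>2) \<le> K\<^sup>2" using w_sq by simp
  qed measurable
  have w2_le: "0 \<le> (\<integral>y. (w y)\<^sup>2 \<partial>\<mu>)" "(\<integral>y. (w y)\<^sup>2 \<partial>\<mu>) \<le> K\<^sup>2"
    using mu.integral_le_const[OF w2, of "K\<^sup>2"] w_sq by auto
  define U where "U x = (\<Sum>i\<in>I. \<Sum>k\<in>I - {i}. A i k * x i * x k)" for x
  define L where "L x = (\<Sum>i\<in>I. A i i * w (x i))" for x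
  define G where "G x = (\<Sum>i\<in>I. A i i * g (x i))" for x
  have [measurable]: "U \<in> borel_measurable ?P" "L \<in> borel_measurable ?P" "G \<in> borel_measurable ?P"
    unfolding U_def L_def G_def by measurable
  have Adiag_sum: "(\<Sum>i\<in>I. A i i) \<le> p * b" "0 \<le> (\<Sum>i\<in>I. A i i)"
    using sum_mono[OF diag(2), of I "\<lambda>i. i"] by (auto simp: p_def intro!: sum_nonneg diag)
  \<comment> \<open>Unit variance in the form \<open>m + \<delta> = 1\<close> writes each square as
    \<open>1 + w + g - \<delta>\<close>: the 1 produces the trace, \<open>w\<close> is bounded and
    centred, and \<open>g\<close> is nonnegative with mean \<open>\<delta>\<close>.\<close>
  have dec: "(\<Sum>i\<in>I. \<Sum>k\<in>I. A i k * x i * x k) - (\<Sum>i\<in>I. A i i) = U x + (L x + G x - \<delta> * (\<Sum>i\<in>I. A i i))" for x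
  proof -
    have "(\<Sum>i\<in>I. \<Sum>k\<in>I. A i k * x i * x k) = U x + (\<Sum>i\<in>I. A i i * (x i)\<^sup>2)"
      unfolding U_def sum.distrib[symmetric] using I
      by (intro sum.cong refl) (simp add: sum.remove[OF I(1)] power2_eq_square)
    also have "(\<Sum>i\<in>I. A i i * (x i)\<^sup>2) = (\<Sum>i\<in>I. A i i * w (x i) + A i i * g (x i) - \<delta> * A i i + A i i)"
    proof (intro sum.cong refl)
      fix i
      have "(x i)\<^sup>2 = w (x i) + g (x i) - \<delta> + 1" using fg[of "x i"] m\<delta> by (simp add: w_def)
      then show "A i i * (x i)\<^sup>2 = A i i * w (x i) + A i i * g (x i) - \<delta> * A i i + A i i"
        by (simp only: distrib_left right_diff_distrib mult_1_right mult.commute[of \<delta>])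
    qed
    finally show ?thesis by (simp add: L_def G_def sum.distrib sum_subtractf sum_distrib_left)
  qed
  have G_nn: "0 \<le> G x" for x unfolding G_def by (intro sum_nonneg mult_nonneg_nonneg diag g_nn)
  have \<delta>A: "0 \<le> \<delta> * (\<Sum>i\<in>I. A i i)" "\<delta> * (\<Sum>i\<in>I. A i i) \<le> p * b * \<delta>"
    using Adiag_sum \<delta>_nn by (simp_all add: mult.commute mult_left_mono)
  have bd: "\<bar>(\<Sum>i\<in>I. \<Sum>k\<in>I. A i k * x i * x k) - (\<Sum>i\<in>I. A i i)\<bar> \<le> \<bar>U x\<bar> + (\<bar>L x\<bar> + (G x + p * b * \<delta>))" for x
    unfolding dec using \<delta>A G_nn[of x] by arith
  have pb\<delta>: "0 \<le> p * b * \<delta>" using p b \<delta>_nn by simp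
  have "(\<integral>\<^sup>+x. ennreal \<bar>(\<Sum>i\<in>I. \<Sum>k\<in>I. A i k * x i * x k) - (\<Sum>i\<in>I. A i i)\<bar> \<partial>?P)
    \<le> (\<integral>\<^sup>+x. ennreal \<bar>U x\<bar> + (ennreal \<bar>L x\<bar> + (ennreal (G x) + ennreal (p * b * \<delta>))) \<partial>?P)"
    using G_nn pb\<delta> bd by (intro nn_integral_mono) (simp add: ennreal_leI flip: ennreal_plus)
  also have "\<dots> = (\<integral>\<^sup>+x. ennreal \<bar>U x\<bar> \<partial>?P) + ((\<integral>\<^sup>+x. ennreal \<bar>L x\<bar> \<partial>?P) + ((\<integral>\<^sup>+x. ennreal (G x) \<partial>?P) + ennreal (p * b * \<delta>)))"
    by (simp add: nn_integral_add P.emeasure_space_1)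
  \<comment> \<open>The square roots bound the root mean squares of \<open>U\<close> and
    \<open>L\<close>. The tail part \<open>G\<close> and the constant correction each cost at most
    \<open>p * b * \<delta>\<close>, whence the factor 2 in the claim.\<close>
  also have "\<dots> \<le> ennreal (sqrt (2 * p * b\<^sup>2)) + (ennreal (sqrt (p * b\<^sup>2 * K\<^sup>2)) + (ennreal (p * b * \<delta>) + ennreal (p * b * \<delta>)))"
  proof (intro add_mono order_refl)
    have "(\<Sum>i\<in>I. \<Sum>k\<in>I - {i}. (A i k)\<^sup>2) \<le> (\<Sum>i\<in>I. b\<^sup>2)"
    proof (rule sum_mono)
      fix i assume i: "i \<in> I"
      have "(\<Sum>k\<in>I - {i}. (A i k)\<^sup>2) \<le> (\<Sum>k\<in>I. (A i k)\<^sup>2)" using I by (intro sum_mono2) auto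
      then show "(\<Sum>k\<in>I - {i}. (A i k)\<^sup>2) \<le> b\<^sup>2" using row[OF i] by simp
    qed
    then have "2 * (\<Sum>i\<in>I. \<Sum>k\<in>I - {i}. (A i k)\<^sup>2) \<le> 2 * p * b\<^sup>2" by (simp add: p_def)
    then show "(\<integral>\<^sup>+x. ennreal \<bar>U x\<bar> \<partial>?P) \<le> ennreal (sqrt (2 * p * b\<^sup>2))"
      using p b nn_integral_off_diagonal_sq[OF I(1) h, of A] sym
      by (intro nn_integral_abs_le_sqrt P.prob_space_axioms) (auto simp: U_def intro!: ennreal_leI)
    have "(\<Sum>i\<in>I. (A i i)\<^sup>2) \<le> (\<Sum>i\<in>I. b\<^sup>2)"
      using diag by (intro sum_mono power_mono) auto
    then have "(\<integral>y. (w y)\<^sup>2 \<partial>\<mu>) * (\<Sum>i\<in>I. (A i i)\<^sup>2) \<le> K\<^sup>2 * (p * b\<^sup>2)"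
      using w2_le by (intro mult_mono) (auto simp: p_def intro!: sum_nonneg)
    then show "(\<integral>\<^sup>+x. ennreal \<bar>L x\<bar> \<partial>?P) \<le> ennreal (sqrt (p * b\<^sup>2 * K\<^sup>2))"
      using p b K nn_integral_linear_form_sq[OF I(1) w(1) w2 w(2), of "\<lambda>i. A i i"]
      by (intro nn_integral_abs_le_sqrt P.prob_space_axioms) (auto simp: L_def[symmetric] mult.commute intro!: ennreal_leI)
    have "(\<integral>\<^sup>+x. ennreal (G x) \<partial>?P) = (\<integral>\<^sup>+x. (\<Sum>i\<in>I. ennreal (A i i) * ennreal (g (x i))) \<partial>?P)"
      unfolding G_def using diag g_nn by (intro nn_integral_cong) (simp add: sum_nonneg flip: ennreal_mult)
    also have "\<dots> = (\<Sum>i\<in>I. ennreal (A i i) * (\<integral>\<^sup>+x. ennreal (g (x i)) \<partial>?P))"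
      by (subst nn_integral_sum) (auto simp: nn_integral_cmult)
    also have "\<dots> = (\<Sum>i\<in>I. ennreal (A i i) * ennreal \<delta>)"
    proof (intro sum.cong refl)
      fix i assume "i \<in> I"
      then have "(\<integral>\<^sup>+x. ennreal (g (x i)) \<partial>?P) = (\<integral>\<^sup>+y. ennreal (g y) \<partial>\<mu>)"
        by (intro nn_integral_component) auto
      also have "\<dots> = ennreal \<delta>" unfolding \<delta> using g_int g_nn by (intro nn_integral_eq_integral) auto
      finally show "ennreal (A i i) * (\<integral>\<^sup>+x. ennreal (g (x i)) \<partial>?P) = ennreal (A i i) * ennreal \<delta>" by simp
    qed
    also have "\<dots> = ennreal (\<delta> * (\<Sum>i\<in>I. A i i))"
    proof -
      have "(\<Sum>i\<in>I. ennreal (A i i) * ennreal \<delta>) = (\<Sum>i\<in>I. ennreal (\<delta> * A i i))"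
        using diag \<delta>_nn by (intro sum.cong refl) (simp add: ennreal_mult mult.commute)
      also have "\<dots> = ennreal (\<Sum>i\<in>I. \<delta> * A i i)" using diag \<delta>_nn by (intro sum_ennreal) simp
      finally show ?thesis by (simp add: sum_distrib_left)
    qed
    also have "\<dots> \<le> ennreal (p * b * \<delta>)"
      using Adiag_sum \<delta>_nn by (intro ennreal_leI) (simp add: mult.commute mult_left_mono)
    finally show "(\<integral>\<^sup>+x. ennreal (G x) \<partial>?P) \<le> ennreal (p * b * \<delta>)" .
  qed
  also have "\<dots> = ennreal (sqrt (2 * p * b\<^sup>2) + (2 * p * b * \<delta> + sqrt (p * b\<^sup>2 * K\<^sup>2)))"
    using p b K \<delta>_nn by (simp flip: ennreal_plus add: algebra_simps)
  finally show ?thesis .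
qed

end

subsection \<open>McDiarmid's inequality for blocks\<close>

text \<open>Hoeffding's lemma asks for an interval, while only the oscillation of \<open>f\<close>
  is bounded. Taking the infimum as left end lets the interval vary with the coordinates that are
  frozen later, its length staying \<open>b\<close>.\<close>

lemma hoeffding_mgf_of_range:
  fixes f :: "'a \<Rightarrow> real"
  assumes "prob_space M" and [measurable]: "f \<in> borel_measurable M"
    and bound: "\<And>x. x \<in> space M \<Longrightarrow> \<bar>f x\<bar> \<le> C"
    and range: "\<And>x y. x \<in> space M \<Longrightarrow> y \<in> space M \<Longrightarrow> f x - f y \<le> b" and l: "0 < l"
  shows "(\<integral>\<^sup>+x. ennreal (exp (l * (f x - integral\<^sup>L M f))) \<partial>M) \<le> ennreal (exp (l\<^sup>2 * b\<^sup>2 / 8))"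
proof -
  interpret prob_space M by fact
  define a where "a = (INF x\<in>space M. f x)"
  have bdd: "bdd_below (f ` space M)"
    using bound by (intro bdd_belowI2[of _ "- C"]) (metis abs_le_D2 minus_le_iff)
  have "a \<le> f x" if "x \<in> space M" for x
    unfolding a_def using bdd that by (rule cINF_lower)
  moreover have "f x \<le> a + b" if "x \<in> space M" for x
  proof -
    have "f x - b \<le> a" unfolding a_def
      using range[OF that] not_empty by (intro cINF_greatest) (auto simp: algebra_simps)
    then show ?thesis by simp
  qed
  ultimately interpret interval_bounded_random_variable M f a "a + b"
    by unfold_locales auto
  show ?thesis using Hoeffdings_lemma_nn_integral[OF l] by simp
qed

context iid_product
begin

text \<open>The martingale argument done by Fubini, one block being a whole column. \<open>F\<close>
  averages out the last column; with the others frozen, \<open>f - F\<close> is centred with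
  oscillation at most \<open>b\<close>, which costs a factor
  \<open>exp (l\<^sup>2 * b\<^sup>2 / 8)\<close>, and \<open>F\<close> inherits the bounded
  differences for the induction hypothesis.\<close>

lemma mcdiarmid_mgf_blocks:
  fixes I :: "'i set" and J :: "'j set" and f :: "('i \<times> 'j \<Rightarrow> real) \<Rightarrow> real" and b :: real
  assumes J: "finite J" and I: "finite I" and l: "0 < l"
    and "f \<in> borel_measurable (Pi\<^sub>M (I \<times> J) (\<lambda>_. \<mu>))"
    and "\<And>x. x \<in> space (Pi\<^sub>M (I \<times> J) (\<lambda>_. \<mu>)) \<Longrightarrow> \<bar>f x\<bar> \<le> C"
    and "\<And>j x y. j \<in> J \<Longrightarrow> x \<in> space (Pi\<^sub>M (I \<times> J) (\<lambda>_. \<mu>)) \<Longrightarrow> y \<in> space (Pi\<^sub>M (I \<times> J) (\<lambda>_. \<mu>)) \<Longrightarrow>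
      (\<And>i k. i \<in> I \<Longrightarrow> k \<in> J \<Longrightarrow> k \<noteq> j \<Longrightarrow> x (i, k) = y (i, k)) \<Longrightarrow> f x - f y \<le> b"
  shows "(\<integral>\<^sup>+x. ennreal (exp (l * (f x - integral\<^sup>L (Pi\<^sub>M (I \<times> J) (\<lambda>_. \<mu>)) f))) \<partial>(Pi\<^sub>M (I \<times> J) (\<lambda>_. \<mu>)))
    \<le> ennreal (exp (l\<^sup>2 * b\<^sup>2 * card J / 8))"
  using J assms(4-6)
proof (induction J arbitrary: f)
  case empty
  interpret product_sigma_finite "\<lambda>_::'i \<times> 'j. \<mu>"
    using prob by (simp add: product_sigma_finite_def prob_space_imp_sigma_finite)
  show ?case by (simp add: PiM_empty nn_integral_count_space_finite lebesgue_integral_count_space_finite)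
next
  case (insert j J)
  interpret product_sigma_finite "\<lambda>_::'i \<times> 'j. \<mu>"
    using prob by (simp add: product_sigma_finite_def prob_space_imp_sigma_finite)
  note [measurable] = insert.prems(1)
  let ?K = "I \<times> J" and ?B = "I \<times> {j}"
  let ?PK = "Pi\<^sub>M ?K (\<lambda>_. \<mu>)" and ?PB = "Pi\<^sub>M ?B (\<lambda>_. \<mu>)" and ?P = "Pi\<^sub>M (I \<times> insert j J) (\<lambda>_. \<mu>)"
  interpret PK: prob_space ?PK by (intro prob_space_PiM prob)
  interpret PB: prob_space ?PB by (intro prob_space_PiM prob)
  interpret P: prob_space ?P by (intro prob_space_PiM prob)
  have un: "I \<times> insert j J = ?K \<union> ?B" and dis: "?K \<inter> ?B = {}" and fin: "finite ?K" "finite ?B"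
    using insert I by auto
  have mm [measurable]: "(\<lambda>xy. merge ?K ?B xy) \<in> ?PK \<Otimes>\<^sub>M ?PB \<rightarrow>\<^sub>M ?P"
    unfolding un by (rule measurable_merge)
  have msp: "merge ?K ?B (x, y) \<in> space ?P" if "x \<in> space ?PK" "y \<in> space ?PB" for x y
    using measurable_space[OF mm, of "(x, y)"] that by (simp add: space_pair_measure)
  define F where "F x = (\<integral>y. f (merge ?K ?B (x, y)) \<partial>?PB)" for x
  have fm: "(\<lambda>(x, y). f (merge ?K ?B (x, y))) \<in> borel_measurable (?PK \<Otimes>\<^sub>M ?PB)"
    using measurable_comp[OF mm insert.prems(1)] by (simp add: comp_def split_beta)
  have F_meas [measurable]: "F \<in> borel_measurable ?PK"
    unfolding F_def by (rule PB.borel_measurable_lebesgue_integral[OF fm])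
  have sec: "(\<lambda>y. f (merge ?K ?B (x, y))) \<in> borel_measurable ?PB" if "x \<in> space ?PK" for x
    using measurable_Pair2[OF fm that] by simp
  have int: "integrable ?PB (\<lambda>y. f (merge ?K ?B (x, y)))" if "x \<in> space ?PK" for x
    using insert.prems(2) msp that by (intro PB.integrable_const_bound[where B = C] AE_I2 sec) auto
  have F_bound: "\<bar>F x\<bar> \<le> C" if "x \<in> space ?PK" for x
  proof -
    have "\<bar>F x\<bar> \<le> (\<integral>y. \<bar>f (merge ?K ?B (x, y))\<bar> \<partial>?PB)"
      unfolding F_def by (rule integral_abs_bound)
    also have "\<dots> \<le> C" using insert.prems(2) msp that int
      by (intro PB.integral_le_const AE_I2) auto
    finally show ?thesis .
  qed
  have F_diff: "F x - F x' \<le> b" if j': "j' \<in> J" and x: "x \<in> space ?PK" "x' \<in> space ?PK"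
    and eq: "\<And>i k. i \<in> I \<Longrightarrow> k \<in> J \<Longrightarrow> k \<noteq> j' \<Longrightarrow> x (i, k) = x' (i, k)" for j' x x'
  proof -
    have "F x - F x' = (\<integral>y. f (merge ?K ?B (x, y)) - f (merge ?K ?B (x', y)) \<partial>?PB)"
      unfolding F_def using int x by simp
    also have "\<dots> \<le> b"
    proof (intro PB.integral_le_const AE_I2)
      fix y assume y: "y \<in> space ?PB"
      show "f (merge ?K ?B (x, y)) - f (merge ?K ?B (x', y)) \<le> b"
        using j' eq by (intro insert.prems(3)[of j'] msp x y) (auto simp: merge_def)
    qed (use int x in auto)
    finally show ?thesis .
  qed
  have IH: "(\<integral>\<^sup>+x. ennreal (exp (l * (F x - integral\<^sup>L ?PK F))) \<partial>?PK) \<le> ennreal (exp (l\<^sup>2 * b\<^sup>2 * card J / 8))"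
    by (rule insert.IH[OF F_meas F_bound F_diff])
  have "integrable ?P f"
    using insert.prems(2) by (intro P.integrable_const_bound[where B = C] AE_I2) auto
  then have Ef: "integral\<^sup>L ?P f = integral\<^sup>L ?PK F"
    unfolding F_def un using dis fin by (subst product_integral_fold) auto
  let ?m = "integral\<^sup>L ?PK F"
  have "(\<integral>\<^sup>+x. ennreal (exp (l * (f x - integral\<^sup>L ?P f))) \<partial>?P)
      = (\<integral>\<^sup>+x. (\<integral>\<^sup>+y. ennreal (exp (l * (f (merge ?K ?B (x, y)) - ?m))) \<partial>?PB) \<partial>?PK)"
    unfolding Ef unfolding un using dis fin
    by (subst product_nn_integral_fold) (auto simp flip: un)
  also have "\<dots> \<le> (\<integral>\<^sup>+x. ennreal (exp (l\<^sup>2 * b\<^sup>2 / 8)) * ennreal (exp (l * (F x - ?m))) \<partial>?PK)"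
  proof (rule nn_integral_mono)
    fix x assume x: "x \<in> space ?PK"
    note [measurable] = sec[OF x]
    \<comment> \<open>The exponent is split into \<open>F x - ?m\<close>, constant in
      \<open>y\<close>, and the centred part \<open>f (merge ?K ?B (x, y)) - F x\<close>.\<close>
    have "(\<integral>\<^sup>+y. ennreal (exp (l * (f (merge ?K ?B (x, y)) - ?m))) \<partial>?PB)
      = (\<integral>\<^sup>+y. ennreal (exp (l * (F x - ?m))) * ennreal (exp (l * (f (merge ?K ?B (x, y)) - F x))) \<partial>?PB)"
      by (intro nn_integral_cong) (simp add: algebra_simps flip: ennreal_mult exp_add)
    also have "\<dots> = ennreal (exp (l * (F x - ?m))) * (\<integral>\<^sup>+y. ennreal (exp (l * (f (merge ?K ?B (x, y)) - F x))) \<partial>?PB)"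
      by (rule nn_integral_cmult) measurable
    also have "\<dots> \<le> ennreal (exp (l * (F x - ?m))) * ennreal (exp (l\<^sup>2 * b\<^sup>2 / 8))"
      unfolding F_def
    proof (intro mult_left_mono hoeffding_mgf_of_range[OF PB.prob_space_axioms sec[OF x] _ _ l])
      show "\<bar>f (merge ?K ?B (x, y))\<bar> \<le> C" if "y \<in> space ?PB" for y
        using that x msp insert.prems(2) by auto
      show "f (merge ?K ?B (x, y)) - f (merge ?K ?B (x, y')) \<le> b" if "y \<in> space ?PB" "y' \<in> space ?PB" for y y'
        by (intro insert.prems(3)[of j] msp x that) (auto simp: merge_def)
    qed simp
    finally show "(\<integral>\<^sup>+y. ennreal (exp (l * (f (merge ?K ?B (x, y)) - ?m))) \<partial>?PB)
      \<le> ennreal (exp (l\<^sup>2 * b\<^sup>2 / 8)) * ennreal (exp (l * (F x - ?m)))"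
      by (simp add: mult.commute)
  qed
  also have "\<dots> = ennreal (exp (l\<^sup>2 * b\<^sup>2 / 8)) * (\<integral>\<^sup>+x. ennreal (exp (l * (F x - ?m))) \<partial>?PK)"
    by (rule nn_integral_cmult) measurable
  also have "\<dots> \<le> ennreal (exp (l\<^sup>2 * b\<^sup>2 / 8)) * ennreal (exp (l\<^sup>2 * b\<^sup>2 * card J / 8))"
    by (intro mult_left_mono IH) simp
  also have "\<dots> = ennreal (exp (l\<^sup>2 * b\<^sup>2 * card (insert j J) / 8))"
    using insert by (simp add: algebra_simps add_divide_distrib flip: ennreal_mult exp_add)
  finally show ?case .
qed

lemma mcdiarmid_upper_tail_blocks:
  fixes I :: "'i set" and J :: "'j set" and f :: "('i \<times> 'j \<Rightarrow> real) \<Rightarrow> real" and b :: real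
  defines "P \<equiv> Pi\<^sub>M (I \<times> J) (\<lambda>_. \<mu>)"
  assumes J: "finite J" "J \<noteq> {}" and I: "finite I"
    and f [measurable]: "f \<in> borel_measurable P"
    and bound: "\<And>x. x \<in> space P \<Longrightarrow> \<bar>f x\<bar> \<le> C"
    and diff: "\<And>j x y. j \<in> J \<Longrightarrow> x \<in> space P \<Longrightarrow> y \<in> space P \<Longrightarrow>
      (\<And>i k. i \<in> I \<Longrightarrow> k \<in> J \<Longrightarrow> k \<noteq> j \<Longrightarrow> x (i, k) = y (i, k)) \<Longrightarrow> f x - f y \<le> b"
    and b: "0 < b" and \<epsilon>: "0 < \<epsilon>"
  shows "measure P {x \<in> space P. \<epsilon> \<le> f x - integral\<^sup>L P f} \<le> exp (- 2 * \<epsilon>\<^sup>2 / (card J * b\<^sup>2))"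
proof -
  interpret prob_space P unfolding P_def by (intro prob_space_PiM prob)
  define N where "N = real (card J)"
  have N: "0 < N" using J by (simp add: N_def card_gt_0_iff)
  \<comment> \<open>The minimiser of
    \<open>- l * \<epsilon> + l\<^sup>2 * b\<^sup>2 * N / 8\<close>.\<close>
  define l where "l = 4 * \<epsilon> / (N * b\<^sup>2)"
  have l: "0 < l" using N b \<epsilon> by (simp add: l_def)
  have "emeasure P {x \<in> space P. \<epsilon> \<le> f x - integral\<^sup>L P f}
    \<le> ennreal (exp (- l * \<epsilon>)) * (\<integral>\<^sup>+x. ennreal (exp (l * (f x - integral\<^sup>L P f))) \<partial>P)"
    using Chernoff_ineq_nn_integral_ge[OF l, of "space P" P "\<lambda>x. f x - integral\<^sup>L P f" \<epsilon>]
    by (simp add: nn_set_integral_space)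
  also have "\<dots> \<le> ennreal (exp (- l * \<epsilon>)) * ennreal (exp (l\<^sup>2 * b\<^sup>2 * card J / 8))"
    unfolding P_def
    by (intro mult_left_mono mcdiarmid_mgf_blocks[where C = C] J I l f[unfolded P_def] bound[unfolded P_def] diff[unfolded P_def]) auto
  also have "\<dots> = ennreal (exp (- l * \<epsilon> + l\<^sup>2 * b\<^sup>2 * N / 8))"
    by (simp add: N_def flip: ennreal_mult exp_add)
  also have "- l * \<epsilon> + l\<^sup>2 * b\<^sup>2 * N / 8 = - 2 * \<epsilon>\<^sup>2 / (N * b\<^sup>2)"
    using N b by (simp add: l_def power2_eq_square field_simps)
  finally show ?thesis by (simp add: emeasure_eq_measure N_def)
qed

lemma mcdiarmid_blocks:
  fixes I :: "'i set" and J :: "'j set" and f :: "('i \<times> 'j \<Rightarrow> real) \<Rightarrow> real" and b :: real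
  defines "P \<equiv> Pi\<^sub>M (I \<times> J) (\<lambda>_. \<mu>)"
  assumes J: "finite J" "J \<noteq> {}" and I: "finite I"
    and f [measurable]: "f \<in> borel_measurable P"
    and bound: "\<And>x. x \<in> space P \<Longrightarrow> \<bar>f x\<bar> \<le> C"
    and diff: "\<And>j x y. j \<in> J \<Longrightarrow> x \<in> space P \<Longrightarrow> y \<in> space P \<Longrightarrow>
      (\<And>i k. i \<in> I \<Longrightarrow> k \<in> J \<Longrightarrow> k \<noteq> j \<Longrightarrow> x (i, k) = y (i, k)) \<Longrightarrow> f x - f y \<le> b"
    and b: "0 < b" and \<epsilon>: "0 < \<epsilon>"
  shows "measure P {x \<in> space P. \<epsilon> \<le> \<bar>f x - integral\<^sup>L P f\<bar>} \<le> 2 * exp (- 2 * \<epsilon>\<^sup>2 / (card J * b\<^sup>2))"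
proof -
  interpret prob_space P unfolding P_def by (intro prob_space_PiM prob)
  have "{x \<in> space P. \<epsilon> \<le> \<bar>f x - integral\<^sup>L P f\<bar>}
    = {x \<in> space P. \<epsilon> \<le> f x - integral\<^sup>L P f} \<union> {x \<in> space P. \<epsilon> \<le> - f x - integral\<^sup>L P (\<lambda>x. - f x)}"
    by auto
  then have "measure P {x \<in> space P. \<epsilon> \<le> \<bar>f x - integral\<^sup>L P f\<bar>}
    \<le> measure P {x \<in> space P. \<epsilon> \<le> f x - integral\<^sup>L P f} + measure P {x \<in> space P. \<epsilon> \<le> - f x - integral\<^sup>L P (\<lambda>x. - f x)}"
    by (simp add: measure_Un_le)
  moreover have "measure P {x \<in> space P. \<epsilon> \<le> f x - integral\<^sup>L P f} \<le> exp (- 2 * \<epsilon>\<^sup>2 / (card J * b\<^sup>2))"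
    unfolding P_def
    by (rule mcdiarmid_upper_tail_blocks[OF J I f[unfolded P_def] bound[unfolded P_def] diff[unfolded P_def] b \<epsilon>])
  moreover have "measure P {x \<in> space P. \<epsilon> \<le> - f x - integral\<^sup>L P (\<lambda>x. - f x)} \<le> exp (- 2 * \<epsilon>\<^sup>2 / (card J * b\<^sup>2))"
    unfolding P_def
  proof (rule mcdiarmid_upper_tail_blocks[OF J I _ _ _ b \<epsilon>, where C = C])
    fix j x y assume "j \<in> J" "x \<in> space (Pi\<^sub>M (I \<times> J) (\<lambda>_. \<mu>))" "y \<in> space (Pi\<^sub>M (I \<times> J) (\<lambda>_. \<mu>))"
      "\<And>i k. i \<in> I \<Longrightarrow> k \<in> J \<Longrightarrow> k \<noteq> j \<Longrightarrow> x (i, k) = y (i, k)"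
    then show "- f x - - f y \<le> b" using diff[of j y x] by (auto simp: P_def)
  qed (use f bound in \<open>auto simp: P_def\<close>)
  ultimately show ?thesis by simp
qed

end

subsection \<open>The trace of the resolvent of a Gram matrix\<close>

lemma borel_measurable_det:
  fixes A :: "'a \<Rightarrow> real mat"
  assumes A: "\<And>x. A x \<in> carrier_mat n n"
    and m: "\<And>i j. i < n \<Longrightarrow> j < n \<Longrightarrow> (\<lambda>x. A x $$ (i, j)) \<in> borel_measurable M"
  shows "(\<lambda>x. det (A x)) \<in> borel_measurable M"
  unfolding det_def'[OF A]
proof (intro borel_measurable_sum borel_measurable_times borel_measurable_const borel_measurable_prod m)
  fix q i assume "q \<in> {q. q permutes {0..<n}}" "i \<in> {0..<n}"
  then show "i < n" "q i < n" using permutes_in_image[of q "{0..<n}" i] by auto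
qed

lemma borel_measurable_adj_mat:
  fixes A :: "'a \<Rightarrow> real mat"
  assumes A: "\<And>x. A x \<in> carrier_mat n n"
    and m: "\<And>i j. i < n \<Longrightarrow> j < n \<Longrightarrow> (\<lambda>x. A x $$ (i, j)) \<in> borel_measurable M"
    and i: "i < n" and j: "j < n"
  shows "(\<lambda>x. adj_mat (A x) $$ (i, j)) \<in> borel_measurable M"
proof -
  have dims: "dim_row (A x) = n" "dim_col (A x) = n" for x using A[of x] by auto
  have "(\<lambda>x. det (mat_delete (A x) j i)) \<in> borel_measurable M"
  proof (rule borel_measurable_det)
    show "mat_delete (A x) j i \<in> carrier_mat (n - 1) (n - 1)" for x
      using A by (rule mat_delete_carrier)
    fix k l assume "k < n - 1" "l < n - 1"
    then show "(\<lambda>x. mat_delete (A x) j i $$ (k, l)) \<in> borel_measurable M"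
      by (auto simp: mat_delete_def dims intro!: m)
  qed
  then show ?thesis using i j by (simp add: adj_mat_def cofactor_def dims)
qed

lemma borel_measurable_resolvent:
  fixes A :: "'a \<Rightarrow> real mat"
  assumes A: "\<And>x. A x \<in> carrier_mat n n"
    and m: "\<And>i j. i < n \<Longrightarrow> j < n \<Longrightarrow> (\<lambda>x. A x $$ (i, j)) \<in> borel_measurable M"
    and i: "i < n" and j: "j < n"
  shows "(\<lambda>x. resolvent t (A x) $$ (i, j)) \<in> borel_measurable M"
proof -
  have dims: "dim_row (A x) = n" "dim_col (A x) = n" for x using A[of x] by auto
  let ?B = "\<lambda>x. A x + t \<cdot>\<^sub>m 1\<^sub>m n"
  have B: "?B x \<in> carrier_mat n n" for x using A by simp
  have mB: "(\<lambda>x. ?B x $$ (k, l)) \<in> borel_measurable M" if "k < n" "l < n" for k l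
    using m[OF that] that by (auto simp: dims)
  have "(\<lambda>x. 1 / det (?B x) * adj_mat (?B x) $$ (i, j)) \<in> borel_measurable M"
    by (intro borel_measurable_times borel_measurable_divide borel_measurable_const
        borel_measurable_det[OF B mB] borel_measurable_adj_mat[OF B mB] i j)
  moreover have "adj_mat (?B x) \<in> carrier_mat n n" for x using adj_mat[OF B] by simp
  then have "resolvent t (A x) $$ (i, j) = 1 / det (?B x) * adj_mat (?B x) $$ (i, j)" for x
    unfolding resolvent_def dims using i j by (metis carrier_matD index_smult_mat(1))
  ultimately show ?thesis by simp
qed

lemma abs_diff_div_one_plus_le:
  fixes a b :: real
  assumes "0 \<le> a" "0 \<le> b"
  shows "\<bar>a / (1 + a) - b / (1 + b)\<bar> \<le> \<bar>a - b\<bar>"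
proof -
  have "a / (1 + a) - b / (1 + b) = (a - b) / ((1 + a) * (1 + b))"
    using assms by (simp add: field_simps)
  moreover have "1 \<le> (1 + a) * (1 + b)" using assms by (simp add: algebra_simps)
  moreover have "\<bar>u / v\<bar> \<le> \<bar>u\<bar>" if "1 \<le> v" for u v :: real
    using that mult_left_mono[of 1 v "\<bar>u\<bar>"] by (simp add: divide_le_eq)
  ultimately show ?thesis by presburger
qed

text \<open>Normalised by the number \<open>n\<close> of columns, not by the dimension
  \<open>p\<close>: given the other columns, the scaled quadratic form of column \<open>j\<close>
  has the trace of the reduced resolvent over \<open>n\<close> as its mean, and on this scale the
  fixed-point equation closes.\<close>

definition gram_trace :: "nat \<Rightarrow> nat \<Rightarrow> real \<Rightarrow> (nat \<times> nat \<Rightarrow> real) \<Rightarrow> real" where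
  "gram_trace p n t x = mtrace (resolvent t (gram p (1 / real n) {..<n} x)) / real n"

lemma quadratic_form_colvec:
  assumes "R \<in> carrier_mat p p"
  shows "colvec p x j \<bullet> (R *\<^sub>v colvec p x j) = (\<Sum>i<p. \<Sum>k<p. R $$ (i, k) * x (i, j) * x (k, j))"
proof -
  have "colvec p x j \<bullet> (R *\<^sub>v colvec p x j) = (\<Sum>i<p. x (i, j) * (\<Sum>k<p. R $$ (i, k) * x (k, j)))"
    using assms by (simp add: colvec_def scalar_prod_def atLeast0LessThan)
  then show ?thesis by (simp add: sum_distrib_left mult_ac)
qed

lemma gram_trace_remove_column:
  fixes p n j :: nat and x :: "nat \<times> nat \<Rightarrow> real"
  assumes t: "0 < t" and n: "0 < n" and j: "j < n"
  defines "s \<equiv> 1 / real n"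
  defines "R \<equiv> resolvent t (gram p s {..<n} x)" and "R' \<equiv> resolvent t (gram p s ({..<n} - {j}) x)"
  defines "q \<equiv> s * (colvec p x j \<bullet> (R' *\<^sub>v colvec p x j))"
  shows "0 \<le> q" "s * (colvec p x j \<bullet> (R *\<^sub>v colvec p x j)) = q / (1 + q)"
    "mtrace R \<le> mtrace R'" "mtrace R' \<le> mtrace R + 1 / t"
proof -
  have s: "0 \<le> s" by (simp add: s_def)
  have upd: "gram p s {..<n} x *\<^sub>v y = gram p s ({..<n} - {j}) x *\<^sub>v y + (s * (colvec p x j \<bullet> y)) \<cdot>\<^sub>v colvec p x j"
    if "y \<in> carrier_vec p" for y
    by (rule gram_remove) (use j that in auto)
  note u = resolvent_rank_one_update[OF psd_shift_gram[OF s t] psd_shift_gram[OF s t] colvec_carrier s upd]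
  show "0 \<le> q" unfolding q_def R'_def by (rule u(1))
  show "s * (colvec p x j \<bullet> (R *\<^sub>v colvec p x j)) = q / (1 + q)"
    unfolding q_def R_def R'_def by (rule u(2))
  show "mtrace R \<le> mtrace R'" unfolding R_def R'_def by (rule u(3))
  show "mtrace R' \<le> mtrace R + 1 / t" unfolding R_def R'_def by (rule u(4))
qed

lemma gram_trace_nonneg: "0 < t \<Longrightarrow> 0 \<le> gram_trace p n t x"
  using psd_shift.R_trace_bounds(1)[OF psd_shift_gram[of "1 / real n" t]] by (simp add: gram_trace_def)

lemma gram_trace_le: "0 < t \<Longrightarrow> gram_trace p n t x \<le> (real p / real n) / t"
proof -
  assume "0 < t"
  then have "mtrace (resolvent t (gram p (1 / real n) {..<n} x)) / real n \<le> (real p / t) / real n"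
    by (intro divide_right_mono psd_shift.R_trace_bounds(2)[OF psd_shift_gram]) auto
  then show ?thesis by (simp add: gram_trace_def mult.commute)
qed

text \<open>Both matrices reduce to the same one when column \<open>j\<close> is removed, and
  removal raises the resolvent trace by an amount in \<open>[0, 1 / t]\<close>. Both traces
  therefore lie in one interval of length \<open>1 / t\<close>.\<close>

lemma gram_trace_bounded_difference:
  assumes t: "0 < t" and n: "0 < n" and j: "j < n"
    and eq: "\<And>i k. i < p \<Longrightarrow> k < n \<Longrightarrow> k \<noteq> j \<Longrightarrow> x (i, k) = y (i, k)"
  shows "gram_trace p n t x - gram_trace p n t y \<le> 1 / (real n * t)"
proof -
  have e: "gram p (1 / real n) ({..<n} - {j}) x = gram p (1 / real n) ({..<n} - {j}) y"
    unfolding gram_def by (intro cong_mat refl) (auto intro!: sum.cong simp: eq)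
  have "mtrace (resolvent t (gram p (1 / real n) {..<n} x)) - mtrace (resolvent t (gram p (1 / real n) {..<n} y)) \<le> 1 / t"
    using gram_trace_remove_column(3)[OF t n j, of p x] gram_trace_remove_column(4)[OF t n j, of p y]
    unfolding e by linarith
  then have "(mtrace (resolvent t (gram p (1 / real n) {..<n} x)) - mtrace (resolvent t (gram p (1 / real n) {..<n} y))) / real n
    \<le> (1 / t) / real n"
    by (intro divide_right_mono) auto
  then show ?thesis by (simp add: gram_trace_def diff_divide_distrib mult.commute)
qed

text \<open>The resolvent identity \<open>R (S + t) = 1\<close> and Sherman-Morrison turn the trace into a function
  of the quadratic forms \<open>q j\<close>, each of which is close to \<open>gram_trace\<close>.\<close>
lemma gram_trace_equation_error:
  fixes p n :: nat and x :: "nat \<times> nat \<Rightarrow> real"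
  assumes t: "0 < t" and n: "0 < n"
  defines "g \<equiv> gram_trace p n t x"
  defines "R \<equiv> \<lambda>j. resolvent t (gram p (1 / real n) ({..<n} - {j}) x)"
  shows "\<bar>real p / real n - t * g - g / (1 + g)\<bar> \<le>
    (1 / real n)\<^sup>2 * (\<Sum>j<n. \<bar>(\<Sum>i<p. \<Sum>k<p. R j $$ (i, k) * x (i, j) * x (k, j)) - (\<Sum>i<p. R j $$ (i, i))\<bar>)
    + 1 / (real n * t)"
proof -
  define q where "q j = (1 / real n) * (colvec p x j \<bullet> (R j *\<^sub>v colvec p x j))" for j
  have R: "R j \<in> carrier_mat p p" for j
    unfolding R_def using psd_shift.R_carrier[OF psd_shift_gram] t by simp
  let ?R = "resolvent t (gram p (1 / real n) {..<n} x)"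
  have rm: "0 \<le> q j" "(1 / real n) * (colvec p x j \<bullet> (?R *\<^sub>v colvec p x j)) = q j / (1 + q j)"
    "mtrace ?R \<le> mtrace (R j)" "mtrace (R j) \<le> mtrace ?R + 1 / t" if "j < n" for j
    using gram_trace_remove_column[OF t n that, of p x] by (simp_all only: q_def R_def)
  have "(\<Sum>j<n. q j / (1 + q j)) = (\<Sum>j<n. (1 / real n) *
      (colvec p x j \<bullet> (resolvent t (gram p (1 / real n) {..<n} x) *\<^sub>v colvec p x j)))"
    by (intro sum.cong refl) (simp only: rm(2) lessThan_iff)
  then have "(\<Sum>j<n. q j / (1 + q j)) + t * (real n * g) = real p"
    using gram_trace_identity[where s = "1 / real n" and t = t and n = p and J = "{..<n}" and x = x] t n by (simp add: g_def gram_trace_def)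
  then have "real p / real n - t * g = (\<Sum>j<n. q j / (1 + q j)) / real n"
    using n by (simp add: field_simps)
  then have e: "real p / real n - t * g - g / (1 + g) = (\<Sum>j<n. q j / (1 + q j) - g / (1 + g)) / real n"
    using n by (simp add: sum_subtractf diff_divide_distrib)
  have g: "0 \<le> g" unfolding g_def by (rule gram_trace_nonneg[OF t])
  \<comment> \<open>Two errors per column: the deviation of \<open>q j\<close> from
    \<open>mtrace (R j) / n\<close>, and the change of the trace under removal of the column, at
    most \<open>1 / (n * t)\<close>. The map \<open>y / (1 + y)\<close> does not enlarge distances
    between nonnegative numbers.\<close>
  have term_le: "\<bar>q j / (1 + q j) - g / (1 + g)\<bar> \<le> (1 / real n) * \<bar>(\<Sum>i<p. \<Sum>k<p. R j $$ (i, k) * x (i, j) * x (k, j)) - (\<Sum>i<p. R j $$ (i, i))\<bar> + 1 / (real n * t)"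
    if j: "j < n" for j
  proof -
    have "\<bar>q j / (1 + q j) - g / (1 + g)\<bar> \<le> \<bar>q j - g\<bar>"
      by (rule abs_diff_div_one_plus_le[OF rm(1)[OF j] g])
    also have "\<dots> \<le> \<bar>q j - mtrace (R j) / real n\<bar> + \<bar>mtrace (R j) / real n - g\<bar>" by simp
    also have "\<bar>mtrace (R j) / real n - g\<bar> \<le> 1 / (real n * t)"
    proof -
      have "\<bar>mtrace (R j) - real n * g\<bar> \<le> 1 / t"
        using rm(3,4)[OF j] n by (simp add: g_def gram_trace_def)
      then have "\<bar>mtrace (R j) - real n * g\<bar> / real n \<le> (1 / t) / real n"
        by (intro divide_right_mono) auto
      moreover have "\<bar>mtrace (R j) / real n - g\<bar> = \<bar>mtrace (R j) - real n * g\<bar> / real n"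
      proof -
        have "mtrace (R j) / real n - g = (mtrace (R j) - real n * g) / real n"
          using n by (simp add: diff_divide_distrib)
        then show ?thesis by simp
      qed
      ultimately show ?thesis by (simp add: mult.commute)
    qed
    also have "q j - mtrace (R j) / real n
      = (1 / real n) * ((\<Sum>i<p. \<Sum>k<p. R j $$ (i, k) * x (i, j) * x (k, j)) - (\<Sum>i<p. R j $$ (i, i)))"
      unfolding q_def quadratic_form_colvec[OF R] using R[of j] by (simp add: mtrace_def right_diff_distrib diff_divide_distrib)
    finally show ?thesis by (simp add: abs_mult)
  qed
  have "\<bar>real p / real n - t * g - g / (1 + g)\<bar> \<le> (\<Sum>j<n. \<bar>q j / (1 + q j) - g / (1 + g)\<bar>) / real n"
    unfolding e by (simp add: divide_right_mono sum_abs)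
  also have "\<dots> \<le> (\<Sum>j<n. (1 / real n) * \<bar>(\<Sum>i<p. \<Sum>k<p. R j $$ (i, k) * x (i, j) * x (k, j)) - (\<Sum>i<p. R j $$ (i, i))\<bar> + 1 / (real n * t)) / real n"
    by (intro divide_right_mono sum_mono term_le) auto
  also have "\<dots> = (1 / real n)\<^sup>2 * (\<Sum>j<n. \<bar>(\<Sum>i<p. \<Sum>k<p. R j $$ (i, k) * x (i, j) * x (k, j)) - (\<Sum>i<p. R j $$ (i, i))\<bar>)
    + 1 / (real n * t)"
    using n by (simp add: sum.distrib add_divide_distrib power2_eq_square flip: sum_divide_distrib)
  finally show ?thesis .
qed

lemma sum_over_column:
  fixes f :: "nat \<times> 'b \<Rightarrow> real"
  shows "(\<Sum>a\<in>{..<p} \<times> {j}. f a) = (\<Sum>i<p. f (i, j))"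
proof -
  have "{..<p} \<times> {j} = (\<lambda>i. (i, j)) ` {..<p}" by auto
  then show ?thesis by (simp add: sum.reindex inj_on_def)
qed

section \<open>The mean of the normalised trace\<close>

locale standardized_entries = iid_product +
  assumes integrable_id: "integrable \<mu> (\<lambda>y. y)"
    and integrable_sq: "integrable \<mu> (\<lambda>y. y\<^sup>2)"
    and mean_0: "(\<integral>y. y \<partial>\<mu>) = 0"
    and second_moment_1: "(\<integral>y. y\<^sup>2 \<partial>\<mu>) = 1"
begin

definition entries :: "nat \<Rightarrow> nat \<Rightarrow> (nat \<times> nat \<Rightarrow> real) measure" where
  "entries p n = Pi\<^sub>M ({..<p} \<times> {..<n}) (\<lambda>_. \<mu>)"

definition tail :: "real \<Rightarrow> real" where
  "tail K = (\<integral>y. (if y\<^sup>2 \<le> K then 0 else y\<^sup>2) \<partial>\<mu>)"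

text \<open>The bound for quadratic forms at \<open>b = 1 / t\<close> in dimension \<open>p\<close>.
  After division by \<open>n\<close> the square roots vanish in the limit and only the term with
  \<open>tail K\<close> survives, which a large \<open>K\<close> makes small.\<close>

definition deviation_bound :: "real \<Rightarrow> real \<Rightarrow> nat \<Rightarrow> real" where
  "deviation_bound t K p = sqrt (2 * real p * (1 / t)\<^sup>2) +
     (2 * real p * (1 / t) * tail K + sqrt (real p * (1 / t)\<^sup>2 * K\<^sup>2))"

lemma prob_space_entries: "prob_space (entries p n)"
  unfolding entries_def by (intro prob_space_PiM prob)

lemma component_measurable:
  "a \<in> K \<Longrightarrow> (\<lambda>x. x a) \<in> borel_measurable (Pi\<^sub>M K (\<lambda>_. \<mu>))"
  using measurable_component_singleton[of a K "\<lambda>_. \<mu>"] by (simp cong: measurable_cong_sets add: sets_mu)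

lemma gram_resolvent_measurable:
  assumes "{..<p} \<times> J \<subseteq> K" "i < p" "k < p"
  shows "(\<lambda>x. resolvent t (gram p s J x) $$ (i, k)) \<in> borel_measurable (Pi\<^sub>M K (\<lambda>_. \<mu>))"
proof (rule borel_measurable_resolvent)
  fix i k assume "i < p" "k < p"
  then show "(\<lambda>x. gram p s J x $$ (i, k)) \<in> borel_measurable (Pi\<^sub>M K (\<lambda>_. \<mu>))"
    using assms(1) unfolding gram_def
    by (auto intro!: borel_measurable_times borel_measurable_sum component_measurable)
qed (use assms in auto)

lemma gram_trace_measurable [measurable]:
  assumes "0 < t"
  shows "gram_trace p n t \<in> borel_measurable (entries p n)"
proof -
  have "gram_trace p n t = (\<lambda>x. (\<Sum>i<p. resolvent t (gram p (1 / real n) {..<n} x) $$ (i, i)) / real n)"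
    by (rule ext) (simp add: gram_trace_def psd_shift.R_trace[OF psd_shift_gram] assms)
  then show ?thesis
    unfolding entries_def
    by (auto intro!: borel_measurable_divide borel_measurable_sum gram_resolvent_measurable)
qed

text \<open>\<open>R\<close> does not involve column \<open>j\<close>, so by Fubini it can be frozen
  while column \<open>j\<close> is integrated; the conditional bound is uniform in the remaining
  columns.\<close>

lemma nn_integral_column_deviation:
  assumes t: "0 < t" and p: "0 < p" and j: "j < n" and K: "0 < K"
  defines "R \<equiv> \<lambda>x. resolvent t (gram p (1 / real n) ({..<n} - {j}) x)"
  shows "(\<integral>\<^sup>+x. ennreal \<bar>(\<Sum>i<p. \<Sum>k<p. R x $$ (i, k) * x (i, j) * x (k, j)) - (\<Sum>i<p. R x $$ (i, i))\<bar> \<partial>entries p n)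
    \<le> ennreal (deviation_bound t K p)"
    "(\<lambda>x. ennreal \<bar>(\<Sum>i<p. \<Sum>k<p. R x $$ (i, k) * x (i, j) * x (k, j)) - (\<Sum>i<p. R x $$ (i, i))\<bar>) \<in> borel_measurable (entries p n)"
proof -
  let ?K = "{..<p} \<times> ({..<n} - {j})" and ?B = "{..<p} \<times> {j}"
  interpret product_sigma_finite "\<lambda>_::nat \<times> nat. \<mu>"
    using prob by (simp add: product_sigma_finite_def prob_space_imp_sigma_finite)
  interpret PK: prob_space "Pi\<^sub>M ?K (\<lambda>_. \<mu>)" by (intro prob_space_PiM prob)
  have un: "{..<p} \<times> {..<n} = ?K \<union> ?B" using j by auto
  show meas: "(\<lambda>x. ennreal \<bar>(\<Sum>i<p. \<Sum>k<p. R x $$ (i, k) * x (i, j) * x (k, j)) - (\<Sum>i<p. R x $$ (i, i))\<bar>) \<in> borel_measurable (entries p n)"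
    unfolding R_def entries_def using j
    by (intro measurable_compose[OF _ measurable_ennreal] borel_measurable_abs borel_measurable_diff borel_measurable_sum
        borel_measurable_times component_measurable gram_resolvent_measurable) auto
  have Rm: "R (merge ?K ?B (x, y)) = R x" for x y
  proof -
    have "gram p (1 / real n) ({..<n} - {j}) (merge ?K ?B (x, y)) = gram p (1 / real n) ({..<n} - {j}) x"
      unfolding gram_def by (intro cong_mat refl) (auto simp: merge_def intro!: sum.cong)
    then show ?thesis by (simp add: R_def)
  qed
  have "(\<integral>\<^sup>+x. ennreal \<bar>(\<Sum>i<p. \<Sum>k<p. R x $$ (i, k) * x (i, j) * x (k, j)) - (\<Sum>i<p. R x $$ (i, i))\<bar> \<partial>entries p n)
    = (\<integral>\<^sup>+x. (\<integral>\<^sup>+y. ennreal \<bar>(\<Sum>i<p. \<Sum>k<p. R x $$ (i, k) * y (i, j) * y (k, j)) - (\<Sum>i<p. R x $$ (i, i))\<bar>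
        \<partial>(Pi\<^sub>M ?B (\<lambda>_. \<mu>))) \<partial>(Pi\<^sub>M ?K (\<lambda>_. \<mu>)))"
  proof -
    have "merge ?K ?B (x, y) (i, j) = y (i, j)" if "i < p" for x y :: "nat \<times> nat \<Rightarrow> real" and i
      using that by (auto simp: merge_def)
    then have "(\<Sum>i<p. \<Sum>k<p. R x $$ (i, k) * merge ?K ?B (x, y) (i, j) * merge ?K ?B (x, y) (k, j))
      = (\<Sum>i<p. \<Sum>k<p. R x $$ (i, k) * y (i, j) * y (k, j))" for x y
      by (intro sum.cong refl) simp
    then show ?thesis
      using meas unfolding entries_def un
      by (subst product_nn_integral_fold) (auto simp: Rm)
  qed
  also have "\<dots> \<le> (\<integral>\<^sup>+x. ennreal (deviation_bound t K p) \<partial>(Pi\<^sub>M ?K (\<lambda>_. \<mu>)))"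
  proof (rule nn_integral_mono)
    fix x
    interpret psd_shift "gram p (1 / real n) ({..<n} - {j}) x" p t
      using t by (intro psd_shift_gram) auto
    have Rs: "R x $$ (i, k) = R x $$ (k, i)" if "i < p" "k < p" for i k
      using R_sym R_carrier that unfolding R_def by (metis carrier_matD index_transpose_mat(1))
    have row: "0 \<le> R x $$ (i, i)" "R x $$ (i, i) \<le> 1 / t" "(\<Sum>k<p. (R x $$ (i, k))\<^sup>2) \<le> (1 / t)\<^sup>2" if "i < p" for i
      using R_row[OF that] by (simp_all add: R_def power_divide)
    \<comment> \<open>Column \<open>j\<close> is indexed by the pairs in \<open>?B\<close>;
      \<open>fst\<close> recovers the row index that \<open>R x\<close> expects.\<close>
    have "(\<integral>\<^sup>+y. ennreal \<bar>(\<Sum>a\<in>?B. \<Sum>a'\<in>?B. R x $$ (fst a, fst a') * y a * y a') - (\<Sum>a\<in>?B. R x $$ (fst a, fst a))\<bar> \<partial>(Pi\<^sub>M ?B (\<lambda>_. \<mu>)))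
      \<le> ennreal (sqrt (2 * real (card ?B) * (1 / t)\<^sup>2) + (2 * real (card ?B) * (1 / t) * (\<integral>y. (if y\<^sup>2 \<le> K then 0 else y\<^sup>2) \<partial>\<mu>) + sqrt (real (card ?B) * (1 / t)\<^sup>2 * K\<^sup>2)))"
      by (rule nn_integral_quadratic_form_deviation[OF _ _ integrable_id integrable_sq mean_0 second_moment_1 _ _ _ _ _ K])
        (use p t Rs row in \<open>auto simp: sum_over_column lessThan_empty_iff\<close>)
    then show "(\<integral>\<^sup>+y. ennreal \<bar>(\<Sum>i<p. \<Sum>k<p. R x $$ (i, k) * y (i, j) * y (k, j)) - (\<Sum>i<p. R x $$ (i, i))\<bar> \<partial>(Pi\<^sub>M ?B (\<lambda>_. \<mu>)))
      \<le> ennreal (deviation_bound t K p)"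
      by (simp add: sum_over_column deviation_bound_def tail_def card_cartesian_product)
  qed
  also have "\<dots> = ennreal (deviation_bound t K p)" by (simp add: PK.emeasure_space_1)
  finally show "(\<integral>\<^sup>+x. ennreal \<bar>(\<Sum>i<p. \<Sum>k<p. R x $$ (i, k) * x (i, j) * x (k, j)) - (\<Sum>i<p. R x $$ (i, i))\<bar> \<partial>entries p n)
    \<le> ennreal (deviation_bound t K p)" .
qed

lemma tail_nonneg: "0 \<le> tail K"
  unfolding tail_def by (intro integral_nonneg_AE) simp

lemma deviation_bound_nonneg: "0 < t \<Longrightarrow> 0 \<le> deviation_bound t K p"
  unfolding deviation_bound_def using tail_nonneg by (intro add_nonneg_nonneg mult_nonneg_nonneg) auto

lemma nn_integral_equation_error:
  assumes t: "0 < t" and p: "0 < p" and n: "0 < n" and K: "0 < K"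
  shows "(\<integral>\<^sup>+x. ennreal \<bar>real p / real n - t * gram_trace p n t x - gram_trace p n t x / (1 + gram_trace p n t x)\<bar> \<partial>entries p n)
    \<le> ennreal (deviation_bound t K p / real n + 1 / (real n * t))"
proof -
  interpret prob_space "entries p n" by (rule prob_space_entries)
  let ?D = "\<lambda>j x. \<bar>(\<Sum>i<p. \<Sum>k<p. resolvent t (gram p (1 / real n) ({..<n} - {j}) x) $$ (i, k) * x (i, j) * x (k, j))
      - (\<Sum>i<p. resolvent t (gram p (1 / real n) ({..<n} - {j}) x) $$ (i, i))\<bar>"
  note D = nn_integral_column_deviation[OF t p _ K, of _ n]
  have "(\<integral>\<^sup>+x. ennreal \<bar>real p / real n - t * gram_trace p n t x - gram_trace p n t x / (1 + gram_trace p n t x)\<bar> \<partial>entries p n)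
    \<le> (\<integral>\<^sup>+x. ennreal ((1 / real n)\<^sup>2) * (\<Sum>j<n. ennreal (?D j x)) + ennreal (1 / (real n * t)) \<partial>entries p n)"
  proof (rule nn_integral_mono)
    fix x
    have "ennreal ((1 / real n)\<^sup>2) * (\<Sum>j<n. ennreal (?D j x)) + ennreal (1 / (real n * t))
      = ennreal ((1 / real n)\<^sup>2 * (\<Sum>j<n. ?D j x) + 1 / (real n * t))"
      using t by (simp add: sum_ennreal ennreal_mult ennreal_plus sum_nonneg)
    then show "ennreal \<bar>real p / real n - t * gram_trace p n t x - gram_trace p n t x / (1 + gram_trace p n t x)\<bar>
      \<le> ennreal ((1 / real n)\<^sup>2) * (\<Sum>j<n. ennreal (?D j x)) + ennreal (1 / (real n * t))"
      using gram_trace_equation_error[OF t n, of p x] by (simp add: ennreal_leI)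
  qed
  also have "\<dots> = ennreal ((1 / real n)\<^sup>2) * (\<Sum>j<n. \<integral>\<^sup>+x. ennreal (?D j x) \<partial>entries p n) + ennreal (1 / (real n * t))"
  proof -
    have m: "(\<lambda>x. \<Sum>j<n. ennreal (?D j x)) \<in> borel_measurable (entries p n)"
      by (intro borel_measurable_sum D(2)) auto
    have "(\<integral>\<^sup>+x. ennreal ((1 / real n)\<^sup>2) * (\<Sum>j<n. ennreal (?D j x)) + ennreal (1 / (real n * t)) \<partial>entries p n)
      = ennreal ((1 / real n)\<^sup>2) * (\<integral>\<^sup>+x. (\<Sum>j<n. ennreal (?D j x)) \<partial>entries p n) + ennreal (1 / (real n * t))"
      using m by (subst nn_integral_add) (simp_all only: nn_integral_cmult nn_integral_const emeasure_space_1 mult_1_right, auto)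
    also have "(\<integral>\<^sup>+x. (\<Sum>j<n. ennreal (?D j x)) \<partial>entries p n) = (\<Sum>j<n. \<integral>\<^sup>+x. ennreal (?D j x) \<partial>entries p n)"
      by (rule nn_integral_sum) (rule D(2), simp)
    finally show ?thesis .
  qed
  also have "\<dots> \<le> ennreal ((1 / real n)\<^sup>2) * (\<Sum>j<n. ennreal (deviation_bound t K p)) + ennreal (1 / (real n * t))"
    by (intro add_right_mono mult_left_mono sum_mono D(1)) auto
  also have "(\<Sum>j<n. ennreal (deviation_bound t K p)) = ennreal (\<Sum>j<n. deviation_bound t K p)"
    by (intro sum_ennreal deviation_bound_nonneg t)
  also have "ennreal ((1 / real n)\<^sup>2) * ennreal (\<Sum>j<n. deviation_bound t K p) + ennreal (1 / (real n * t))
      = ennreal ((1 / real n)\<^sup>2 * (real n * deviation_bound t K p) + 1 / (real n * t))"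
    using t deviation_bound_nonneg[OF t] by (simp add: ennreal_mult ennreal_plus)
  also have "(1 / real n)\<^sup>2 * (real n * deviation_bound t K p) = deviation_bound t K p / real n"
    using n by (simp add: power2_eq_square)
  finally show ?thesis .
qed

text \<open>\<open>t * y + y / (1 + y)\<close> grows at least as fast as \<open>t * y\<close> on
  nonnegative \<open>y\<close>, so the error in the equation controls the distance to the root
  \<open>g\<close>. The map is nonlinear, so this is applied pointwise and integrated
  afterwards.\<close>

lemma expected_gram_trace_error:
  assumes t: "0 < t" and p: "0 < p" and n: "0 < n" and K: "0 < K"
    and g: "0 \<le> g" "t * g + g / (1 + g) = c"
  shows "t * \<bar>integral\<^sup>L (entries p n) (gram_trace p n t) - g\<bar>
    \<le> deviation_bound t K p / real n + 1 / (real n * t) + \<bar>real p / real n - c\<bar>"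
proof -
  interpret prob_space "entries p n" by (rule prob_space_entries)
  note [measurable] = gram_trace_measurable[OF t, of p n]
  let ?G = "gram_trace p n t"
  have int: "integrable (entries p n) ?G"
    using gram_trace_nonneg[OF t] gram_trace_le[OF t]
    by (intro integrable_const_bound[where B = "(real p / real n) / t"] AE_I2) auto
  have mono: "t * \<bar>u - v\<bar> \<le> \<bar>(t * u + u / (1 + u)) - (t * v + v / (1 + v))\<bar>" if "0 \<le> v" "v \<le> u" for u v
  proof -
    have "u / (1 + u) - v / (1 + v) = (u - v) / ((1 + u) * (1 + v))"
      using that by (simp add: field_simps)
    moreover have "0 \<le> (u - v) / ((1 + u) * (1 + v))" using that by simp
    ultimately have "v / (1 + v) \<le> u / (1 + u)" by linarith
    moreover have "t * v \<le> t * u" using that t by simp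
    ultimately show ?thesis using that by (simp add: right_diff_distrib)
  qed
  have "t * \<bar>?G x - g\<bar> \<le> \<bar>real p / real n - t * ?G x - ?G x / (1 + ?G x)\<bar> + \<bar>real p / real n - c\<bar>" for x
  proof -
    have "t * \<bar>?G x - g\<bar> \<le> \<bar>(t * ?G x + ?G x / (1 + ?G x)) - (t * g + g / (1 + g))\<bar>"
      using mono[of g "?G x"] mono[of "?G x" g] g(1) gram_trace_nonneg[OF t, of p n x]
      by (cases "g \<le> ?G x") (auto simp: abs_minus_commute)
    then show ?thesis unfolding g(2) by linarith
  qed
  then have "(\<integral>\<^sup>+x. ennreal (t * \<bar>?G x - g\<bar>) \<partial>entries p n)
    \<le> (\<integral>\<^sup>+x. ennreal \<bar>real p / real n - t * ?G x - ?G x / (1 + ?G x)\<bar> + ennreal \<bar>real p / real n - c\<bar> \<partial>entries p n)"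
    by (intro nn_integral_mono) (simp add: ennreal_leI flip: ennreal_plus)
  also have "\<dots> = (\<integral>\<^sup>+x. ennreal \<bar>real p / real n - t * ?G x - ?G x / (1 + ?G x)\<bar> \<partial>entries p n) + ennreal \<bar>real p / real n - c\<bar>"
    by (subst nn_integral_add) (simp_all add: emeasure_space_1)
  also have "\<dots> \<le> ennreal (deviation_bound t K p / real n + 1 / (real n * t)) + ennreal \<bar>real p / real n - c\<bar>"
    by (intro add_right_mono nn_integral_equation_error t p n K)
  also have "\<dots> = ennreal (deviation_bound t K p / real n + 1 / (real n * t) + \<bar>real p / real n - c\<bar>)"
    using t deviation_bound_nonneg[OF t] by (intro ennreal_plus[symmetric]) auto
  finally have "(\<integral>\<^sup>+x. ennreal (t * \<bar>?G x - g\<bar>) \<partial>entries p n) \<le> \<dots>" .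
  moreover have "(\<integral>\<^sup>+x. ennreal (t * \<bar>?G x - g\<bar>) \<partial>entries p n) = ennreal (\<integral>x. t * \<bar>?G x - g\<bar> \<partial>entries p n)"
    using int t by (intro nn_integral_eq_integral) auto
  ultimately have "ennreal (\<integral>x. t * \<bar>?G x - g\<bar> \<partial>entries p n)
    \<le> ennreal (deviation_bound t K p / real n + 1 / (real n * t) + \<bar>real p / real n - c\<bar>)"
    by (simp only:)
  then have "(\<integral>x. t * \<bar>?G x - g\<bar> \<partial>entries p n) \<le> deviation_bound t K p / real n + 1 / (real n * t) + \<bar>real p / real n - c\<bar>"
    by (rule ennreal_le_iff[THEN iffD1, rotated]) (use t deviation_bound_nonneg[OF t, of K p] in simp)
  moreover have "\<bar>integral\<^sup>L (entries p n) ?G - g\<bar> \<le> (\<integral>x. \<bar>?G x - g\<bar> \<partial>entries p n)"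
    using integral_abs_bound[of "entries p n" "\<lambda>x. ?G x - g"] int by (simp add: prob_space)
  then have "t * \<bar>integral\<^sup>L (entries p n) ?G - g\<bar> \<le> (\<integral>x. t * \<bar>?G x - g\<bar> \<partial>entries p n)"
    using t by simp
  ultimately show ?thesis by simp
qed

lemma tail_tendsto_0: "(\<lambda>m. tail (real m)) \<longlonglongrightarrow> 0"
proof -
  have "(\<lambda>m. \<integral>y. (if y\<^sup>2 \<le> real m then 0 else y\<^sup>2) \<partial>\<mu>) \<longlonglongrightarrow> (\<integral>y. 0 \<partial>\<mu>)"
  proof (rule integral_dominated_convergence[where w = "\<lambda>y. y\<^sup>2"])
    show "AE y in \<mu>. (\<lambda>m. if y\<^sup>2 \<le> real m then 0 else y\<^sup>2) \<longlonglongrightarrow> 0"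
    proof (rule AE_I2)
      fix y :: real
      obtain N where "y\<^sup>2 \<le> real N" using real_arch_simple by blast
      then have "\<forall>\<^sub>F m in sequentially. (if y\<^sup>2 \<le> real m then 0 else y\<^sup>2) = 0"
        by (intro eventually_sequentiallyI[of N]) auto
      then show "(\<lambda>m. if y\<^sup>2 \<le> real m then 0 else y\<^sup>2) \<longlonglongrightarrow> 0"
        by (rule tendsto_eventually)
    qed
  qed (use integrable_sq in auto)
  then show ?thesis by (simp add: tail_def)
qed

text \<open>The order of choices matters: first the cutoff \<open>K\<close>, so that the surviving
  term \<open>2 * c * (1 / t) * tail K\<close> is below \<open>t * \<epsilon>\<close>, and only then
  \<open>n\<close>.\<close>

lemma expected_gram_trace_tendsto:
  assumes ratio: "(\<lambda>n. real (p n) / real n) \<longlonglongrightarrow> c" and c: "0 < c" and t: "0 < t"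
    and g: "0 \<le> g" "t * g + g / (1 + g) = c"
  shows "(\<lambda>n. integral\<^sup>L (entries (p n) n) (gram_trace (p n) n t)) \<longlonglongrightarrow> g"
proof (rule LIMSEQ_I)
  fix \<epsilon> :: real assume \<epsilon>: "0 < \<epsilon>"
  have lim: "(\<lambda>m. 2 * c * (1 / t) * tail (real m)) \<longlonglongrightarrow> 2 * c * (1 / t) * 0"
    by (intro tendsto_intros tail_tendsto_0)
  have "\<forall>\<^sub>F m in sequentially. 2 * c * (1 / t) * tail (real m) < t * \<epsilon>"
    by (rule order_tendstoD(2)[OF lim]) (use t \<epsilon> in simp)
  then have "\<forall>\<^sub>F m in sequentially. 2 * c * (1 / t) * tail (real m) < t * \<epsilon> \<and> 0 < m"
    by (intro eventually_conj eventually_gt_at_top)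
  then obtain m where m: "2 * c * (1 / t) * tail (real m) < t * \<epsilon>" "0 < m"
    using eventually_happens by force
  define K where "K = real m"
  let ?r = "\<lambda>n. real (p n) / real n"
  \<comment> \<open>The error bound rewritten in \<open>p n / n\<close> and \<open>1 / n\<close>, so
    that the limit can be taken term by term.\<close>
  let ?E = "\<lambda>n. sqrt (2 * ?r n * (1 / t)\<^sup>2 * (1 / real n)) + (2 * ?r n * (1 / t) * tail K + sqrt (?r n * (1 / t)\<^sup>2 * K\<^sup>2 * (1 / real n)))
    + (1 / real n) / t + \<bar>?r n - c\<bar>"
  have limE: "?E \<longlonglongrightarrow> sqrt (2 * c * (1 / t)\<^sup>2 * 0) + (2 * c * (1 / t) * tail K + sqrt (c * (1 / t)\<^sup>2 * K\<^sup>2 * 0)) + 0 / t + \<bar>c - c\<bar>"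
    using t by (intro tendsto_intros ratio lim_1_over_n) auto
  have "\<forall>\<^sub>F n in sequentially. ?E n < t * \<epsilon>"
    by (rule order_tendstoD(2)[OF limE]) (use m(1) in \<open>simp add: K_def\<close>)
  moreover have "\<forall>\<^sub>F n in sequentially. 0 < ?r n"
    by (rule order_tendstoD(1)[OF ratio c])
  ultimately have "\<forall>\<^sub>F n in sequentially. norm (integral\<^sup>L (entries (p n) n) (gram_trace (p n) n t) - g) < \<epsilon>"
  proof eventually_elim
    case (elim n)
    then have pn: "0 < p n" "0 < n" by (auto simp: zero_less_divide_iff)
    have sq: "sqrt (u * real (p n) * v) / real n = sqrt (u * ?r n * v * (1 / real n))" for u v
    proof -
      have "u * ?r n * v * (1 / real n) = (u * real (p n) * v) / (real n)\<^sup>2"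
        by (simp add: power2_eq_square)
      then show ?thesis using pn by (simp add: real_sqrt_divide)
    qed
    have "deviation_bound t K (p n) / real n = sqrt (2 * ?r n * (1 / t)\<^sup>2 * (1 / real n))
        + (2 * ?r n * (1 / t) * tail K + sqrt (?r n * (1 / t)\<^sup>2 * K\<^sup>2 * (1 / real n)))"
      using sq[of 2 "(1 / t)\<^sup>2"] sq[of 1 "(1 / t)\<^sup>2 * K\<^sup>2"]
      by (simp add: deviation_bound_def add_divide_distrib mult.assoc)
    then have "t * \<bar>integral\<^sup>L (entries (p n) n) (gram_trace (p n) n t) - g\<bar> \<le> ?E n"
      using expected_gram_trace_error[OF t pn _ g, of K] m(2) by (simp add: K_def mult.commute)
    then have "t * \<bar>integral\<^sup>L (entries (p n) n) (gram_trace (p n) n t) - g\<bar> < t * \<epsilon>" using elim(1) by linarith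
    then show ?case using t by simp
  qed
  then show "\<exists>N. \<forall>n\<ge>N. norm (integral\<^sup>L (entries (p n) n) (gram_trace (p n) n t) - g) < \<epsilon>"
    unfolding eventually_sequentially .
qed

end

section \<open>Almost sure convergence of the normalised trace\<close>

lemma gram_trace_cong:
  assumes "\<And>i j. i < p \<Longrightarrow> j < n \<Longrightarrow> x (i, j) = y (i, j)"
  shows "gram_trace p n t x = gram_trace p n t y"
proof -
  have "gram p (1 / real n) {..<n} x = gram p (1 / real n) {..<n} y"
    unfolding gram_def by (intro cong_mat refl) (auto simp: assms intro!: sum.cong)
  then show ?thesis by (simp add: gram_trace_def)
qed

context standardized_entries
begin

text \<open>There are \<open>n\<close> blocks with differences \<open>1 / (n * t)\<close>, so the
  exponent is linear in \<open>n\<close> and the bound is geometric, hence summable.\<close>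

lemma gram_trace_deviation_prob:
  assumes t: "0 < t" and n: "0 < n" and \<epsilon>: "0 < \<epsilon>"
  shows "measure (entries p n) {x \<in> space (entries p n). \<epsilon> \<le> \<bar>gram_trace p n t x - integral\<^sup>L (entries p n) (gram_trace p n t)\<bar>}
    \<le> 2 * exp (- 2 * \<epsilon>\<^sup>2 * t\<^sup>2) ^ n"
proof -
  have "measure (entries p n) {x \<in> space (entries p n). \<epsilon> \<le> \<bar>gram_trace p n t x - integral\<^sup>L (entries p n) (gram_trace p n t)\<bar>}
    \<le> 2 * exp (- 2 * \<epsilon>\<^sup>2 / (real (card {..<n}) * (1 / (real n * t))\<^sup>2))"
    unfolding entries_def
  proof (rule mcdiarmid_blocks[where C = "(real p / real n) / t"])
    show "gram_trace p n t \<in> borel_measurable (Pi\<^sub>M ({..<p} \<times> {..<n}) (\<lambda>_. \<mu>))"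
      using gram_trace_measurable[OF t] by (simp add: entries_def)
    show "\<bar>gram_trace p n t x\<bar> \<le> (real p / real n) / t" for x
      using gram_trace_nonneg[OF t, of p n x] gram_trace_le[OF t, of p n x] by simp
  qed (use t n \<epsilon> in \<open>auto intro!: gram_trace_bounded_difference[OF t n]\<close>)
  also have "- 2 * \<epsilon>\<^sup>2 / (real (card {..<n}) * (1 / (real n * t))\<^sup>2) = real n * (- 2 * \<epsilon>\<^sup>2 * t\<^sup>2)"
    using t n by (simp add: power2_eq_square field_simps)
  finally show ?thesis by (simp only: exp_of_nat_mult)
qed

lemma AE_gram_trace_tendsto:
  fixes X :: "nat \<Rightarrow> nat \<Rightarrow> nat \<Rightarrow> 'a \<Rightarrow> real"
  assumes "prob_space M"
    and indep: "\<And>n. prob_space.indep_vars M (\<lambda>_. borel) (\<lambda>(i, j). X n i j) ({..<p n} \<times> {..<n})"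
    and ident: "\<And>n i j. i < p n \<Longrightarrow> j < n \<Longrightarrow> distr M borel (X n i j) = \<mu>"
    and ratio: "(\<lambda>n. real (p n) / real n) \<longlonglongrightarrow> c" and c: "0 < c" and t: "0 < t"
    and g: "0 \<le> g" "t * g + g / (1 + g) = c"
  shows "AE \<omega> in M. (\<lambda>n. gram_trace (p n) n t (\<lambda>(i, j). X n i j \<omega>)) \<longlonglongrightarrow> g"
proof -
  interpret M: prob_space M by fact
  define G where "G n \<omega> = gram_trace (p n) n t (\<lambda>(i, j). X n i j \<omega>)" for n \<omega>
  define e where "e n = integral\<^sup>L (entries (p n) n) (gram_trace (p n) n t)" for n
  \<comment> \<open>Restricting to the index set places the entries in the product space, where
    their joint law is \<open>entries (p n) n\<close>.\<close>
  define Y where "Y n \<omega> = (\<lambda>a\<in>{..<p n} \<times> {..<n}. X n (fst a) (snd a) \<omega>)" for n \<omega>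
  have rv: "(\<lambda>(i, j). X n i j) a \<in> borel_measurable M" if "a \<in> {..<p n} \<times> {..<n}" for n a
    using indep[of n] that unfolding M.indep_vars_def by blast
  have distr_Y: "distr M (Pi\<^sub>M ({..<p n} \<times> {..<n}) (\<lambda>_. borel)) (Y n) = entries (p n) n"
    if "0 < p n" "0 < n" for n
  proof -
    have "distr M (Pi\<^sub>M ({..<p n} \<times> {..<n}) (\<lambda>_. borel)) (\<lambda>\<omega>. \<lambda>a\<in>{..<p n} \<times> {..<n}. (\<lambda>(i, j). X n i j) a \<omega>)
      = Pi\<^sub>M ({..<p n} \<times> {..<n}) (\<lambda>a. distr M borel ((\<lambda>(i, j). X n i j) a))"
    proof -
      have "{..<p n} \<times> {..<n} \<noteq> {}" using that by auto
      from M.indep_vars_iff_distr_eq_PiM'[where M' = "\<lambda>_. borel" and X = "\<lambda>(i, j). X n i j", OF this rv] indep[of n]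
      show ?thesis by blast
    qed
    also have "\<dots> = entries (p n) n"
      unfolding entries_def by (intro PiM_cong) (auto simp: ident)
    finally show ?thesis by (simp add: Y_def[abs_def] split_beta)
  qed
  have Y_meas: "Y n \<in> measurable M (Pi\<^sub>M ({..<p n} \<times> {..<n}) (\<lambda>_. borel))" for n
    unfolding Y_def using rv[of _ n] by (intro measurable_restrict) (auto simp: split_beta)
  have sets_entries: "sets (entries q n) = sets (Pi\<^sub>M ({..<q} \<times> {..<n}) (\<lambda>_. borel))" for q n
    unfolding entries_def by (intro sets_PiM_cong) (auto simp: sets_mu)
  have space_entries: "space (entries q n) = space (Pi\<^sub>M ({..<q} \<times> {..<n}) (\<lambda>_. borel))" for q n
    by (rule sets_eq_imp_space_eq[OF sets_entries])
  have G_Y: "G n \<omega> = gram_trace (p n) n t (Y n \<omega>)" for n \<omega>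
    unfolding G_def Y_def by (intro gram_trace_cong) auto
  \<comment> \<open>The law of \<open>Y n\<close> is identified only for a nonempty index set. Every
    other \<open>n\<close> gets the empty event; since \<open>c > 0\<close>, there are only finitely
    many of them.\<close>
  define good where "good n \<longleftrightarrow> 0 < p n \<and> 0 < n" for n
  define A where "A \<epsilon> n = (if good n then {\<omega> \<in> space M. \<epsilon> \<le> \<bar>G n \<omega> - e n\<bar>} else {})" for \<epsilon> n
  define B where "B \<epsilon> n = {x \<in> space (entries (p n) n). \<epsilon> \<le> \<bar>gram_trace (p n) n t x - e n\<bar>}" for \<epsilon> n
  have B_sets: "B \<epsilon> n \<in> sets (Pi\<^sub>M ({..<p n} \<times> {..<n}) (\<lambda>_. borel))" for \<epsilon> n
  proof -
    note [measurable] = gram_trace_measurable[OF t, of "p n" n]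
    have "B \<epsilon> n \<in> sets (entries (p n) n)" unfolding B_def by measurable
    then show ?thesis by (simp add: sets_entries)
  qed
  have A_B: "{\<omega> \<in> space M. \<epsilon> \<le> \<bar>G n \<omega> - e n\<bar>} = Y n -` B \<epsilon> n \<inter> space M" for \<epsilon> n
    using measurable_space[OF Y_meas, of _ n] by (auto simp: B_def G_Y space_entries)
  have A_sets: "A \<epsilon> n \<in> sets M" for \<epsilon> n
    unfolding A_def A_B using measurable_sets[OF Y_meas B_sets] by simp
  have A_prob: "measure M (A \<epsilon> n) \<le> 2 * exp (- 2 * \<epsilon>\<^sup>2 * t\<^sup>2) ^ n" if "0 < \<epsilon>" for \<epsilon> n
  proof (cases "good n")
    case True
    then have "measure M (A \<epsilon> n) = measure (entries (p n) n) (B \<epsilon> n)"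
      using measure_distr[OF Y_meas B_sets, of n \<epsilon>] distr_Y[of n] by (simp add: A_def A_B good_def)
    then show ?thesis
      using gram_trace_deviation_prob[OF t _ that, of n "p n"] True by (simp add: B_def e_def good_def)
  qed (simp add: A_def)
  have "AE \<omega> in M. \<forall>\<^sub>F n in sequentially. \<omega> \<in> space M - A \<epsilon> n" if \<epsilon>: "0 < \<epsilon>" for \<epsilon>
  proof (rule borel_cantelli_AE1[OF A_sets])
    have "summable (\<lambda>n. 2 * exp (- 2 * \<epsilon>\<^sup>2 * t\<^sup>2) ^ n)"
      using t \<epsilon> by (intro summable_mult summable_geometric) simp
    then show "summable (\<lambda>n. measure M (A \<epsilon> n))"
      by (rule summable_comparison_test'[where N = 0]) (use A_prob[OF \<epsilon>] in simp)
  qed (simp add: M.emeasure_eq_measure)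
  \<comment> \<open>Countably many thresholds \<open>1 / (k + 1)\<close> leave a single null
    set.\<close>
  then have bc: "AE \<omega> in M. \<forall>k::nat. \<forall>\<^sub>F n in sequentially. \<omega> \<in> space M - A (1 / real (Suc k)) n"
    by (subst AE_all_countable) auto
  have ev_good: "\<forall>\<^sub>F n in sequentially. good n"
  proof -
    have "\<forall>\<^sub>F n in sequentially. 0 < real (p n) / real n"
      by (rule order_tendstoD(1)[OF ratio c])
    then show ?thesis by eventually_elim (auto simp: good_def zero_less_divide_iff)
  qed
  have e_lim: "e \<longlonglongrightarrow> g"
    unfolding e_def by (rule expected_gram_trace_tendsto[OF ratio c t g])
  show ?thesis
    using bc unfolding G_def[symmetric]
  proof eventually_elim
    case (elim \<omega>)
    have "(\<lambda>n. G n \<omega> - e n) \<longlonglongrightarrow> 0"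
    proof (rule LIMSEQ_I)
      fix r :: real assume "0 < r"
      then obtain k where k: "1 / real (Suc k) < r" using nat_approx_posE by (metis of_nat_Suc)
      have "\<forall>\<^sub>F n in sequentially. norm (G n \<omega> - e n - 0) < r"
        using elim[rule_format, of k] ev_good
        by eventually_elim (use k in \<open>auto simp: A_def\<close>)
      then show "\<exists>N. \<forall>n\<ge>N. norm (G n \<omega> - e n - 0) < r" unfolding eventually_sequentially .
    qed
    from tendsto_add[OF this e_lim] show ?case by simp
  qed
qed

end

subsection \<open>The limit law\<close>

text \<open>The factor encodes the recurrence \<open>sin ((N + 2) \<theta>) = 2 cos \<theta> sin ((N
  + 1) \<theta>) - sin (N \<theta>)\<close>, so the product telescopes down to boundary
  terms.\<close>

lemma sine_series_partial_sum:
  fixes a :: complex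
  shows "(1 - 2 * a * of_real (cos \<theta>) + a\<^sup>2) * (\<Sum>k<N. a ^ k * of_real (sin (real (Suc k) * \<theta>)))
    = of_real (sin \<theta>) - a ^ N * of_real (sin (real (Suc N) * \<theta>)) + a ^ Suc N * of_real (sin (real N * \<theta>))"
proof (induction N)
  case (Suc N)
  have s: "sin (real (Suc (Suc N)) * \<theta>) = 2 * cos \<theta> * sin (real (Suc N) * \<theta>) - sin (real N * \<theta>)"
  proof -
    have "real (Suc (Suc N)) * \<theta> = real (Suc N) * \<theta> + \<theta>" "real N * \<theta> = real (Suc N) * \<theta> - \<theta>"
      by (simp_all add: algebra_simps)
    then show ?thesis by (simp only: sin_add sin_diff) simp
  qed
  show ?case
    unfolding sum.lessThan_Suc distrib_left Suc.IH s
    by (simp add: algebra_simps power2_eq_square)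
qed simp

lemma has_integral_sin_mult_sin_Suc:
  "((\<lambda>\<theta>. sin \<theta> * sin (real (Suc k) * \<theta>)) has_integral (if k = 0 then pi / 2 else 0)) {0..pi}"
proof (cases "k = 0")
  case True
  have "((\<lambda>\<theta>. sin \<theta> * sin \<theta>) has_integral ((pi / 2 - sin (2 * pi) / 4) - (0 / 2 - sin (2 * 0) / 4))) {0..pi}"
  proof (rule fundamental_theorem_of_calculus)
    fix x :: real
    have "sin x * sin x = (1 - cos (2 * x)) / 2"
      using cos_double_sin[of x] by (simp add: power2_eq_square)
    then show "((\<lambda>x. x / 2 - sin (2 * x) / 4) has_vector_derivative sin x * sin x) (at x within {0..pi})"
      unfolding has_real_derivative_iff_has_vector_derivative[symmetric]
      by (auto intro!: derivative_eq_intros)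
  qed simp
  then show ?thesis using True by simp
next
  case False
  let ?F = "\<lambda>x. (sin (real k * x) / real k - sin (real (k + 2) * x) / real (k + 2)) / 2"
  have "((\<lambda>\<theta>. sin \<theta> * sin (real (Suc k) * \<theta>)) has_integral (?F pi - ?F 0)) {0..pi}"
  proof (rule fundamental_theorem_of_calculus)
    fix x :: real
    have "real k * x = real (Suc k) * x - x" "real (k + 2) * x = real (Suc k) * x + x"
      by (simp_all add: algebra_simps)
    then have "sin x * sin (real (Suc k) * x) = (cos (real k * x) - cos (real (k + 2) * x)) / 2"
      by (simp only: cos_add cos_diff) simp
    then show "(?F has_vector_derivative sin x * sin (real (Suc k) * x)) (at x within {0..pi})"
      unfolding has_real_derivative_iff_has_vector_derivative[symmetric] using False
      by (auto intro!: derivative_eq_intros)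
  qed simp
  moreover have "?F pi - ?F 0 = 0"
    by (simp only: sin_npi) simp
  ultimately show ?thesis using False by simp
qed

text \<open>The integrand is \<open>sin \<theta>\<close> times the generating function of \<open>sin (k \<theta>)\<close>, so orthogonality leaves
  only the first term.\<close>
lemma has_integral_poisson_sin_sq:
  fixes q :: complex
  assumes q: "norm q < 1"
  shows "((\<lambda>\<theta>. of_real ((sin \<theta>)\<^sup>2) / (1 + 2 * q * of_real (cos \<theta>) + q\<^sup>2)) has_integral (of_real (pi / 2) :: complex)) {0..pi}"
proof -
  define a where "a = - q"
  have a: "norm a < 1" using q by (simp add: a_def)
  define D where "D \<theta> = 1 - 2 * a * of_real (cos \<theta>) + a\<^sup>2" for \<theta> :: real
  \<comment> \<open>\<open>D\<close> factors as
    \<open>(1 - a * cis \<theta>) * (1 - a * cis (- \<theta>))\<close> with both moduli at least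
    \<open>1 - norm a\<close>. This excludes poles and makes the remainder estimate uniform in
    \<open>\<theta>\<close>.\<close>
  have D_low: "(1 - norm a)\<^sup>2 \<le> norm (D \<theta>)" for \<theta>
  proof -
    have "cis \<theta> + cis (- \<theta>) = 2 * of_real (cos \<theta>)" by (simp add: complex_eq_iff)
    moreover have "cis \<theta> * cis (- \<theta>) = 1" by (simp add: cis_mult)
    moreover have "(1 - a * cis \<theta>) * (1 - a * cis (- \<theta>))
        = 1 - a * (cis \<theta> + cis (- \<theta>)) + a\<^sup>2 * (cis \<theta> * cis (- \<theta>))"
      by (simp only: power2_eq_square ring_distribs) (simp add: algebra_simps)
    ultimately have D: "D \<theta> = (1 - a * cis \<theta>) * (1 - a * cis (- \<theta>))"
      by (simp add: D_def)
    have "1 - norm a \<le> norm (1 - a * cis \<phi>)" for \<phi>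
      using norm_triangle_ineq2[of 1 "a * cis \<phi>"] by (simp add: norm_mult)
    then show ?thesis unfolding D norm_mult power2_eq_square
      using a by (intro mult_mono) auto
  qed
  then have D0: "D \<theta> \<noteq> 0" for \<theta>
    using a by (metis diff_gt_0_iff_gt less_numeral_extra(3) linorder_not_le norm_zero zero_less_power)
  define f where "f \<theta> = of_real ((sin \<theta>)\<^sup>2) / D \<theta>" for \<theta>
  define S where "S N \<theta> = (\<Sum>k<N. a ^ k * of_real (sin \<theta> * sin (real (Suc k) * \<theta>)))" for N \<theta>
  have f_cont: "continuous_on {0..pi} f"
    unfolding f_def by (intro continuous_intros) (use D0 in \<open>auto simp: D_def intro!: continuous_intros\<close>)
  then have f_int: "f integrable_on {0..pi}" by (rule integrable_continuous_real)
  have S_int: "(S (Suc N) has_integral of_real (pi / 2)) {0..pi}" for N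
  proof -
    have "(S (Suc N) has_integral (\<Sum>k<Suc N. a ^ k * of_real (if k = 0 then pi / 2 else 0))) {0..pi}"
      unfolding S_def
      by (intro has_integral_sum has_integral_mult_right has_integral_of_real has_integral_sin_mult_sin_Suc) auto
    moreover have "(\<Sum>k<Suc N. a ^ k * of_real (if k = 0 then pi / 2 else 0)) = of_real (pi / 2)"
      unfolding sum.lessThan_Suc_shift by simp
    ultimately show ?thesis by (simp only:)
  qed
  \<comment> \<open>The remainder is explicit: the two boundary terms of
    \<open>sine_series_partial_sum\<close>, each of modulus at most
    \<open>norm a ^ N\<close>.\<close>
  have rem: "norm (f \<theta> - S N \<theta>) \<le> 2 * norm a ^ N / (1 - norm a)\<^sup>2" for N \<theta>
  proof -
    have "S N \<theta> = of_real (sin \<theta>) * (\<Sum>k<N. a ^ k * of_real (sin (real (Suc k) * \<theta>)))"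
      by (simp add: S_def sum_distrib_left mult_ac)
    then have "D \<theta> * S N \<theta> = of_real (sin \<theta>) * (of_real (sin \<theta>) - a ^ N * of_real (sin (real (Suc N) * \<theta>)) + a ^ Suc N * of_real (sin (real N * \<theta>)))"
      using sine_series_partial_sum[of a \<theta> N] unfolding D_def by (simp only: mult.left_commute)
    then have "f \<theta> - S N \<theta> = of_real (sin \<theta>) * (a ^ N * of_real (sin (real (Suc N) * \<theta>)) - a ^ Suc N * of_real (sin (real N * \<theta>))) / D \<theta>"
      unfolding f_def using D0[of \<theta>] by (simp add: field_simps power2_eq_square)
    also have "norm \<dots> \<le> 2 * norm a ^ N / (1 - norm a)\<^sup>2"
      unfolding norm_divide
    proof (intro frac_le)
      have "norm (a ^ N * of_real (sin (real (Suc N) * \<theta>)) - a ^ Suc N * of_real (sin (real N * \<theta>)))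
        \<le> norm (a ^ N * of_real (sin (real (Suc N) * \<theta>))) + norm (a ^ Suc N * of_real (sin (real N * \<theta>)))"
        by (rule norm_triangle_ineq4)
      also have "\<dots> \<le> norm a ^ N * 1 + norm a ^ N * 1"
      proof (rule add_mono)
        show "norm (a ^ N * of_real (sin (real (Suc N) * \<theta>))) \<le> norm a ^ N * 1"
          unfolding norm_mult norm_power norm_of_real by (intro mult_left_mono) auto
        show "norm (a ^ Suc N * of_real (sin (real N * \<theta>))) \<le> norm a ^ N * 1"
          unfolding norm_mult norm_power norm_of_real using a
          by (intro mult_mono power_decreasing) auto
      qed
      finally have "norm (a ^ N * of_real (sin (real (Suc N) * \<theta>)) - a ^ Suc N * of_real (sin (real N * \<theta>))) \<le> 2 * norm a ^ N"
        by simp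
      then show "norm (of_real (sin \<theta>) * (a ^ N * of_real (sin (real (Suc N) * \<theta>)) - a ^ Suc N * of_real (sin (real N * \<theta>)))) \<le> 2 * norm a ^ N"
        unfolding norm_mult[of "of_real (sin \<theta>)"] norm_of_real
        using mult_mono[of "\<bar>sin \<theta>\<bar>" 1] by simp
    qed (use D_low a in auto)
    finally show ?thesis .
  qed
  have bound: "norm (integral {0..pi} f - of_real (pi / 2)) \<le> (2 * norm a ^ Suc N / (1 - norm a)\<^sup>2) * pi" for N
  proof -
    have "((\<lambda>\<theta>. f \<theta> - S (Suc N) \<theta>) has_integral (integral {0..pi} f - of_real (pi / 2))) {0..pi}"
      by (intro has_integral_diff integrable_integral f_int S_int)
    then have "norm (integral {0..pi} f - of_real (pi / 2)) \<le> (2 * norm a ^ Suc N / (1 - norm a)\<^sup>2) * measure lborel {0..pi}"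
      by (rule has_integral_bound_real[where S = "{}", rotated 2]) (use rem[of _ "Suc N"] a in simp_all)
    then show ?thesis by simp
  qed
  have "(\<lambda>N. (2 * norm a ^ Suc N / (1 - norm a)\<^sup>2) * pi) \<longlonglongrightarrow> (2 * 0 / (1 - norm a)\<^sup>2) * pi"
    using a by (intro tendsto_intros LIMSEQ_Suc[OF LIMSEQ_power_zero]) auto
  then have "norm (integral {0..pi} f - of_real (pi / 2)) \<le> 0"
    using bound by (intro LIMSEQ_le_const) auto
  then have "integral {0..pi} f = of_real (pi / 2)" by simp
  then have "(f has_integral of_real (pi / 2)) {0..pi}" using f_int by (metis integrable_integral)
  then show ?thesis by (simp add: f_def[abs_def] D_def a_def)
qed

text \<open>The quadratic equation for \<open>q\<close> says that \<open>u + h cos \<theta>\<close>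
  equals \<open>h / (2 q)\<close> times \<open>1 + 2 q cos \<theta> + q^2\<close>, so the affine
  denominator becomes a Poisson kernel with parameter in the unit disc.\<close>

lemma has_integral_sin_sq_over_affine_cos:
  fixes q u :: complex and h :: real
  assumes q: "norm q < 1" "q \<noteq> 0" and h: "h \<noteq> 0" and eq: "of_real h * (1 + q\<^sup>2) = 2 * q * u"
  shows "((\<lambda>\<theta>. of_real ((sin \<theta>)\<^sup>2) / (u + of_real (h * cos \<theta>))) has_integral (of_real pi * q / of_real h)) {0..pi}"
proof -
  have "of_real ((sin \<theta>)\<^sup>2) / (u + of_real (h * cos \<theta>))
    = (2 * q / of_real h) * (of_real ((sin \<theta>)\<^sup>2) / (1 + 2 * q * of_real (cos \<theta>) + q\<^sup>2))" for \<theta>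
  proof -
    have "of_real h * (1 + 2 * q * of_real (cos \<theta>) + q\<^sup>2) = 2 * q * (u + of_real (h * cos \<theta>))"
      using eq by (simp add: algebra_simps)
    then have "1 + 2 * q * of_real (cos \<theta>) + q\<^sup>2 = (2 * q / of_real h) * (u + of_real (h * cos \<theta>))"
      using h by (simp add: field_simps)
    then show ?thesis using q h by simp
  qed
  moreover have "((\<lambda>\<theta>. (2 * q / of_real h) * (of_real ((sin \<theta>)\<^sup>2) / (1 + 2 * q * of_real (cos \<theta>) + q\<^sup>2)))
    has_integral ((2 * q / of_real h) * of_real (pi / 2))) {0..pi}"
    by (intro has_integral_mult_right has_integral_poisson_sin_sq q)
  ultimately show ?thesis by (simp add: mult.commute[of q "of_real pi"])
qed

lemma csqrt_lower_half_plane: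
  assumes "Im z < 0"
  shows "0 < Re (csqrt z)" "Im (csqrt z) < 0"
proof -
  have sq: "(csqrt z)\<^sup>2 = z" by simp
  have Im: "2 * Re (csqrt z) * Im (csqrt z) = Im z"
    using arg_cong[OF sq, of Im] by (simp only: Im_power2)
  have "Re (csqrt z) \<noteq> 0" using Im assms by auto
  moreover have "0 \<le> Re (csqrt z)" using csqrt_principal[of z] by auto
  ultimately show Re: "0 < Re (csqrt z)" by simp
  show "Im (csqrt z) < 0"
    using Im assms Re by (metis mult_less_0_iff mult_pos_pos not_less_iff_gr_or_eq zero_less_numeral)
qed

text \<open>\<open>Im (q + q') = Im q' * (1 - 1 / |q'|^2)\<close>, so signs of imaginary parts
  decide which of two reciprocal numbers lies in the unit disc. This later selects the root to which
  the Poisson integral applies.\<close>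

lemma smaller_root_norm_less_1:
  fixes q q' :: complex
  assumes "q * q' = 1" "0 < Im q'" "0 < Im (q + q')"
  shows "norm q < 1"
proof -
  have q': "q' \<noteq> 0" using assms(1) by auto
  then have q: "q = 1 / q'" using assms(1) by (simp add: field_simps)
  define N where "N = (Re q')\<^sup>2 + (Im q')\<^sup>2"
  have "Im q = - Im q' / N" unfolding q by (simp add: N_def Im_divide)
  then have "0 < Im q' * (1 - 1 / N)" using assms(3) by (simp add: algebra_simps)
  then have "0 < 1 - 1 / N" using assms(2) by (simp add: zero_less_mult_iff)
  moreover have N: "0 < N" unfolding N_def using assms(2) by (simp add: add_nonneg_pos)
  ultimately have "1 < N" by (simp add: field_simps)
  then have "1 < norm q'" unfolding N_def cmod_def by simp
  then show ?thesis unfolding q by (simp add: norm_divide divide_less_eq)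
qed

section \<open>The limit law in the angle coordinate\<close>

locale mp_params =
  fixes c \<sigma> :: real
  assumes c: "1 < c" and sigma: "\<sigma> \<noteq> 0"
begin

text \<open>Midpoint \<open>m\<close> and half-width \<open>h\<close> of the Marchenko-Pastur
  interval from \<open>lambda_minus\<close> to \<open>lambda_plus\<close>.\<close>

definition "m = \<sigma>\<^sup>2 * (1 + c)"
definition "h = 2 * \<sigma>\<^sup>2 * sqrt c"

lemma s2: "0 < \<sigma>\<^sup>2" using sigma by simp
lemma sqrt_c: "1 < sqrt c" "sqrt c * sqrt c = c" using c by simp_all
lemma h_pos: "0 < h" using s2 c by (simp add: h_def)
lemma m_minus_h: "m - h = lambda_minus c \<sigma>" and m_plus_h: "m + h = lambda_plus c \<sigma>"
proof -
  have e: "(1 - sqrt c)\<^sup>2 = 1 + c - 2 * sqrt c" "(1 + sqrt c)\<^sup>2 = 1 + c + 2 * sqrt c"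
    using c by (simp_all add: power2_diff power2_sum)
  show "m - h = lambda_minus c \<sigma>" "m + h = lambda_plus c \<sigma>"
    unfolding m_def h_def lambda_minus_def lambda_plus_def e by (simp_all add: algebra_simps)
qed
lemma lambda_minus_pos: "0 < lambda_minus c \<sigma>"
  using s2 sqrt_c by (simp add: lambda_minus_def)
lemma h_less_m: "h < m" using lambda_minus_pos m_minus_h by linarith
text \<open>This is the product of the two edges. Being a perfect square, it removes the square root
  from \<open>real_root 0\<close>, which yields the total mass \<open>1 / c\<close>.\<close>

lemma m2_h2: "m\<^sup>2 - h\<^sup>2 = (\<sigma>\<^sup>2 * (c - 1))\<^sup>2"
proof -
  have "h\<^sup>2 = 4 * (\<sigma>\<^sup>2)\<^sup>2 * c" using c by (simp add: h_def power_mult_distrib)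
  moreover have "m\<^sup>2 = (\<sigma>\<^sup>2)\<^sup>2 * (1 + c)\<^sup>2" "(\<sigma>\<^sup>2 * (c - 1))\<^sup>2 = (\<sigma>\<^sup>2)\<^sup>2 * (c - 1)\<^sup>2"
    by (simp_all add: m_def power_mult_distrib)
  moreover have "(1 + c)\<^sup>2 - 4 * c = (c - 1)\<^sup>2" by (simp add: power2_eq_square algebra_simps)
  ultimately show ?thesis by (metis mult.assoc mult.commute right_diff_distrib)
qed

definition location :: "real \<Rightarrow> real" where "location \<theta> = m + h * cos \<theta>"

lemma location_bounds: "m - h \<le> location \<theta>" "location \<theta> \<le> m + h"
proof -
  have "h * -1 \<le> h * cos \<theta>" "h * cos \<theta> \<le> h * 1"
    using h_pos by (intro mult_left_mono; simp)+
  then show "m - h \<le> location \<theta>" "location \<theta> \<le> m + h" by (simp_all add: location_def)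
qed

lemma location_pos: "0 < location \<theta>"
  using location_bounds(1)[of \<theta>] h_less_m by linarith

text \<open>The Marchenko-Pastur density \<open>sqrt ((lambda_plus - x) * (x - lambda_minus)) / (2 *
  pi * \<sigma>^2 * c * x)\<close> at \<open>x = location \<theta>\<close>, times the Jacobian; root
  and Jacobian each contribute \<open>h * sin \<theta>\<close>.\<close>

definition weight :: "real \<Rightarrow> real" where
  "weight \<theta> = h\<^sup>2 * (sin \<theta>)\<^sup>2 / (2 * pi * \<sigma>\<^sup>2 * c * location \<theta>)"

lemma weight_nonneg: "0 \<le> weight \<theta>"
  unfolding weight_def using c location_pos[of \<theta>] by (intro divide_nonneg_nonneg mult_nonneg_nonneg) auto

text \<open>The root in the unit disc of \<open>h * (1 + q^2) = 2 * q * (m + t)\<close>.\<close>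

definition real_root :: "real \<Rightarrow> real" where
  "real_root t = (m + t - sqrt ((m + t)\<^sup>2 - h\<^sup>2)) / h"

lemma real_root:
  assumes "0 \<le> t"
  shows "0 < real_root t" "real_root t < 1" "h * (1 + (real_root t)\<^sup>2) = 2 * real_root t * (m + t)"
proof -
  define u where "u = m + t"
  define r where "r = sqrt (u\<^sup>2 - h\<^sup>2)"
  have u: "h < u" using h_less_m assms by (simp add: u_def)
  have hu: "h\<^sup>2 < u\<^sup>2" using u h_pos by (simp add: power_strict_mono)
  have r: "0 < r" "r * r = u\<^sup>2 - h\<^sup>2" using hu by (simp_all add: r_def)
  have ru: "r < u" unfolding r_def using h_pos u
    by (intro real_less_lsqrt) auto
  have root: "real_root t = (u - r) / h" by (simp add: real_root_def u_def r_def)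
  show "0 < real_root t" unfolding root using ru h_pos by simp
  \<comment> \<open>Since \<open>r^2 = (u - h) * (u + h)\<close>, it exceeds
    \<open>(u - h)^2\<close>.\<close>
  have "u - h < r"
  proof (rule power2_less_imp_less)
    have "(u - h) * (u - h) < (u - h) * (u + h)" using u h_pos by simp
    then show "(u - h)\<^sup>2 < r\<^sup>2" using r(2) by (simp add: power2_eq_square algebra_simps)
  qed (use r in simp)
  then show "real_root t < 1" unfolding root using h_pos by simp
  have "h * h + (u - r) * (u - r) = 2 * (u - r) * u"
    using r(2) by (simp add: power2_eq_square algebra_simps)
  then show "h * (1 + (real_root t)\<^sup>2) = 2 * real_root t * (m + t)"
  proof -
    have "h * (1 + ((u - r) / h)\<^sup>2) = (h * h + (u - r) * (u - r)) / h"
      using h_pos by (simp add: power2_eq_square add_divide_distrib distrib_left)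
    also have "\<dots> = 2 * ((u - r) / h) * u" unfolding \<open>h * h + (u - r) * (u - r) = 2 * (u - r) * u\<close> by simp
    finally show ?thesis unfolding root u_def[symmetric] .
  qed
qed

lemma integral_weight_kernel_real:
  assumes "0 \<le> t"
  shows "((\<lambda>\<theta>. (sin \<theta>)\<^sup>2 / (location \<theta> + t)) has_integral (pi * real_root t / h)) {0..pi}"
proof -
  note r = real_root[OF assms]
  have "of_real h * (1 + (of_real (real_root t))\<^sup>2) = 2 * of_real (real_root t) * (of_real (m + t) :: complex)"
    using arg_cong[OF r(3), of complex_of_real] by simp
  then have "((\<lambda>\<theta>. of_real ((sin \<theta>)\<^sup>2) / (of_real (m + t) + of_real (h * cos \<theta>)))
      has_integral (of_real pi * of_real (real_root t) / (of_real h :: complex))) {0..pi}"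
    using r h_pos by (intro has_integral_sin_sq_over_affine_cos) auto
  then have "((\<lambda>\<theta>. complex_of_real ((sin \<theta>)\<^sup>2 / (location \<theta> + t))) has_integral (of_real (pi * real_root t / h))) {0..pi}"
    by (simp add: location_def add_ac)
  from has_integral_Re[OF this] show ?thesis by simp
qed

lemma integral_weight: "(weight has_integral (1 / c)) {0..pi}"
proof -
  have e: "weight \<theta> = h\<^sup>2 / (2 * pi * \<sigma>\<^sup>2 * c) * ((sin \<theta>)\<^sup>2 / (location \<theta> + 0))" for \<theta>
    by (simp add: weight_def)
  have "sqrt (m\<^sup>2 - h\<^sup>2) = \<sigma>\<^sup>2 * (c - 1)" unfolding m2_h2 using c by simp
  then have r: "real_root 0 = 2 * \<sigma>\<^sup>2 / h" by (simp add: real_root_def m_def algebra_simps)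
  have "(weight has_integral (h\<^sup>2 / (2 * pi * \<sigma>\<^sup>2 * c) * (pi * real_root 0 / h))) {0..pi}"
    unfolding e by (intro has_integral_mult_right integral_weight_kernel_real) simp
  moreover have "h\<^sup>2 / (2 * pi * \<sigma>\<^sup>2 * c) * (pi * real_root 0 / h) = 1 / c"
    unfolding r using sigma h_pos c by (simp add: power2_eq_square)
  ultimately show ?thesis by (simp only:)
qed

text \<open>The angle \<open>\<theta> \<in> [0, \<pi>]\<close> carries the eigenvalue \<open>location \<theta>\<close> of \<open>S\<close>; the interval \<open>[4, 5]\<close>,
  disjoint from it, encodes the atom at 0.\<close>
definition angle_density :: "real \<Rightarrow> real" where
  "angle_density \<theta> = (if \<theta> \<in> {0..pi} then weight \<theta> else if \<theta> \<in> {4..5} then 1 - 1 / c else 0)"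

definition inv_location :: "real \<Rightarrow> real" where
  "inv_location \<theta> = (if \<theta> \<in> {0..pi} then inverse (location \<theta>) else 0)"

text \<open>A push-forward of the angle: its integrals become integrals of continuous functions over
  \<open>[0, pi]\<close> plus an atom term. The form with \<open>nu\<close> is recovered afterwards
  by substitution, in \<open>emeasure_limit_law\<close>.\<close>

definition limit_law :: "real measure" where
  "limit_law = distr (density lborel (\<lambda>\<theta>. ennreal (angle_density \<theta>))) borel inv_location"

lemma location_measurable [measurable]: "location \<in> borel_measurable borel"
  unfolding location_def by measurable
lemma weight_measurable [measurable]: "weight \<in> borel_measurable borel"
  unfolding weight_def by measurable
lemma angle_density_measurable [measurable]: "angle_density \<in> borel_measurable borel"
  unfolding angle_density_def by measurable
lemma inv_location_measurable [measurable]: "inv_location \<in> borel_measurable borel"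
  unfolding inv_location_def by measurable

lemma angle_density_nonneg: "0 \<le> angle_density \<theta>"
  using weight_nonneg c by (simp add: angle_density_def)

lemma sets_limit_law [simp]: "sets limit_law = sets borel" by (simp add: limit_law_def)

lemma location_continuous: "continuous_on A location"
  unfolding location_def by (intro continuous_intros)

lemma weight_continuous: "continuous_on A weight"
proof -
  have "location \<theta> \<noteq> 0" for \<theta> using location_pos[of \<theta>] by simp
  then show ?thesis
    unfolding weight_def by (intro continuous_intros location_continuous) (use c sigma in auto)
qed

lemma angle_integral:
  fixes F :: "real \<Rightarrow> 'b :: euclidean_space"
  assumes F: "continuous_on {0..pi} (\<lambda>\<theta>. F (inverse (location \<theta>)))" and [measurable]: "F \<in> borel_measurable borel"
  shows "integrable limit_law F"
    "integral\<^sup>L limit_law F = integral {0..pi} (\<lambda>\<theta>. weight \<theta> *\<^sub>R F (inverse (location \<theta>))) + (1 - 1 / c) *\<^sub>R F 0"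
proof -
  let ?f = "\<lambda>\<theta>. indicator {0..pi} \<theta> *\<^sub>R (weight \<theta> *\<^sub>R F (inverse (location \<theta>)))"
  let ?g = "\<lambda>\<theta>. indicator {4..5::real} \<theta> *\<^sub>R ((1 - 1 / c) *\<^sub>R F 0)"
  \<comment> \<open>\<open>pi < 4\<close> keeps the interval that carries the atom apart from the
    angles, so the two indicators never overlap.\<close>
  have e: "angle_density \<theta> *\<^sub>R F (inv_location \<theta>) = ?f \<theta> + ?g \<theta>" for \<theta>
    using pi_less_4 by (auto simp: angle_density_def inv_location_def indicator_def)
  have cont: "continuous_on {0..pi} (\<lambda>\<theta>. weight \<theta> *\<^sub>R F (inverse (location \<theta>)))"
    by (intro continuous_intros weight_continuous F)
  have f: "integrable lborel ?f"
    by (rule borel_integrable_compact[OF _ cont]) simp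
  have g: "integrable lborel ?g"
    by (rule integrable_scaleR_left) simp
  have g_int: "integral\<^sup>L lborel ?g = (1 - 1 / c) *\<^sub>R F 0"
    by (subst integral_scaleR_left) auto
  have f_int: "integral\<^sup>L lborel ?f = integral {0..pi} (\<lambda>\<theta>. weight \<theta> *\<^sub>R F (inverse (location \<theta>)))"
    using set_borel_integral_eq_integral(2)[of "{0..pi}" "\<lambda>\<theta>. weight \<theta> *\<^sub>R F (inverse (location \<theta>))"] f
    by (simp add: set_integrable_def set_lebesgue_integral_def)
  show "integrable limit_law F"
    unfolding limit_law_def
    by (subst integrable_distr_eq, measurable, subst integrable_density)
      (use f g in \<open>auto simp: e angle_density_nonneg intro!: Bochner_Integration.integrable_add simp del: scaleR_scaleR\<close>)
  have "integral\<^sup>L limit_law F = integral\<^sup>L lborel (\<lambda>\<theta>. ?f \<theta> + ?g \<theta>)"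
    unfolding limit_law_def
    by (subst integral_distr, measurable, subst integral_density) (auto simp: e angle_density_nonneg simp del: scaleR_scaleR)
  also have "\<dots> = integral\<^sup>L lborel ?f + integral\<^sup>L lborel ?g"
    by (rule Bochner_Integration.integral_add[OF f g])
  finally show "integral\<^sup>L limit_law F = integral {0..pi} (\<lambda>\<theta>. weight \<theta> *\<^sub>R F (inverse (location \<theta>))) + (1 - 1 / c) *\<^sub>R F 0"
    by (simp only: f_int g_int)
qed

lemma real_distribution_limit_law: "real_distribution limit_law"
proof -
  note I = angle_integral[of "\<lambda>_. 1 :: real", simplified]
  have "emeasure limit_law (space limit_law) < \<infinity>"
    using I(1) by (simp add: integrable_iff_bounded)
  moreover have "measure limit_law (space limit_law) = 1"
    using I(2) integral_weight by (simp add: integral_unique)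
  ultimately have "emeasure limit_law (space limit_law) = 1"
    by (simp add: emeasure_eq_ennreal_measure)
  then have "prob_space limit_law" by (rule prob_spaceI)
  then show ?thesis
    by (simp add: real_distribution_def real_distribution_axioms_def limit_law_def)
qed

text \<open>The second factor is the derivative of \<open>1 / location\<close>. Under the root the
  distances to the edges are \<open>h - h cos \<theta>\<close> and
  \<open>h + h cos \<theta>\<close>, with product \<open>(h sin \<theta>)^2\<close>, and the sine is
  nonnegative on \<open>[0, pi]\<close>.\<close>

lemma nu_inverse_location:
  assumes "\<theta> \<in> {0..pi}"
  shows "nu c \<sigma> (inverse (location \<theta>)) * (h * sin \<theta> / (location \<theta>)\<^sup>2) = weight \<theta>"
proof -
  let ?L = "location \<theta>"
  have L: "0 < ?L" by (rule location_pos)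
  have "inverse (lambda_plus c \<sigma>) \<le> inverse ?L" "inverse ?L \<le> inverse (lambda_minus c \<sigma>)"
    using location_bounds[of \<theta>] L lambda_minus_pos unfolding m_minus_h m_plus_h
    by (auto intro!: le_imp_inverse_le)
  moreover have "sqrt ((lambda_plus c \<sigma> - ?L) * (?L - lambda_minus c \<sigma>)) = h * sin \<theta>"
  proof -
    have "(lambda_plus c \<sigma> - ?L) * (?L - lambda_minus c \<sigma>) = (h - h * cos \<theta>) * (h + h * cos \<theta>)"
      by (simp add: location_def flip: m_minus_h m_plus_h)
    also have "\<dots> = (h * sin \<theta>)\<^sup>2"
      using sin_squared_eq[of \<theta>] by (simp add: power_mult_distrib) (simp add: power2_eq_square algebra_simps)
    finally show ?thesis using h_pos assms by (simp add: sin_ge_zero)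
  qed
  moreover have "1 / inverse ?L = ?L" by (simp add: inverse_eq_divide)
  ultimately have "nu c \<sigma> (inverse ?L) = inverse c * (h * sin \<theta> / (2 * pi * \<sigma>\<^sup>2 * inverse ?L))"
    unfolding nu_def by presburger
  then have "nu c \<sigma> (inverse ?L) * (h * sin \<theta> / ?L\<^sup>2)
    = inverse c * (h * sin \<theta> / (2 * pi * \<sigma>\<^sup>2 * inverse ?L)) * (h * sin \<theta> / ?L\<^sup>2)"
    by (simp only:)
  also have "\<dots> = weight \<theta>"
    unfolding weight_def power2_eq_square using L by (simp add: divide_simps)
  finally show ?thesis .
qed

lemma nu_measurable [measurable]: "nu c \<sigma> \<in> borel_measurable borel"
  unfolding nu_def by measurable

lemma inverse_location_has_derivative:
  "((\<lambda>\<theta>. inverse (location \<theta>)) has_real_derivative h * sin \<theta> / (location \<theta>)\<^sup>2) (at \<theta>)"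
proof -
  have "location \<theta> \<noteq> 0" using location_pos[of \<theta>] by simp
  then show ?thesis
    unfolding location_def by (auto intro!: derivative_eq_intros simp: power2_eq_square field_simps)
qed

text \<open>Substitution along \<open>1 / location\<close>, which increases on
  \<open>[0, pi]\<close> from the lower to the upper end of the interval outside which
  \<open>nu\<close> vanishes.\<close>

lemma emeasure_density_nu:
  assumes A [measurable]: "A \<in> sets borel"
  shows "emeasure (density lborel (\<lambda>x. ennreal (nu c \<sigma> x))) A
    = (\<integral>\<^sup>+\<theta>. ennreal (weight \<theta> * indicator A (inverse (location \<theta>)) * indicator {0..pi} \<theta>) \<partial>lborel)"
proof -
  let ?g = "\<lambda>\<theta>. inverse (location \<theta>)"
  have g: "?g 0 = inverse (lambda_plus c \<sigma>)" "?g pi = inverse (lambda_minus c \<sigma>)"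
    by (simp_all add: location_def flip: m_minus_h m_plus_h)
  have "emeasure (density lborel (\<lambda>x. ennreal (nu c \<sigma> x))) A = (\<integral>\<^sup>+x. ennreal (nu c \<sigma> x) * indicator A x \<partial>lborel)"
    by (rule emeasure_density) auto
  also have "\<dots> = (\<integral>\<^sup>+x. ennreal ((nu c \<sigma> x * indicator A x) * indicator {?g 0..?g pi} x) \<partial>lborel)"
    unfolding g by (intro nn_integral_cong) (auto simp: nu_def indicator_def)
  also have "\<dots> = (\<integral>\<^sup>+\<theta>. ennreal ((nu c \<sigma> (?g \<theta>) * indicator A (?g \<theta>)) * (h * sin \<theta> / (location \<theta>)\<^sup>2) * indicator {0..pi} \<theta>) \<partial>lborel)"
  proof (rule nn_integral_substitution)
    show "set_borel_measurable borel {?g 0..?g pi} (\<lambda>x. nu c \<sigma> x * indicator A x)"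
      unfolding set_borel_measurable_def by measurable
    show "continuous_on {0..pi} (\<lambda>\<theta>. h * sin \<theta> / (location \<theta>)\<^sup>2)"
    proof -
      have "location \<theta> \<noteq> 0" for \<theta> using location_pos[of \<theta>] by simp
      then show ?thesis by (intro continuous_intros location_continuous) auto
    qed
    show "0 \<le> h * sin \<theta> / (location \<theta>)\<^sup>2" if "\<theta> \<in> {0..pi}" for \<theta>
      using that h_pos by (simp add: sin_ge_zero)
  qed (auto intro: inverse_location_has_derivative)
  also have "\<dots> = (\<integral>\<^sup>+\<theta>. ennreal (weight \<theta> * indicator A (?g \<theta>) * indicator {0..pi} \<theta>) \<partial>lborel)"
  proof (intro nn_integral_cong arg_cong[where f = ennreal])
    fix \<theta>
    show "(nu c \<sigma> (?g \<theta>) * indicator A (?g \<theta>)) * (h * sin \<theta> / (location \<theta>)\<^sup>2) * indicator {0..pi} \<theta>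
      = weight \<theta> * indicator A (?g \<theta>) * indicator {0..pi} \<theta>"
    proof (cases "\<theta> \<in> {0..pi}")
      case True
      then show ?thesis using nu_inverse_location[OF True] by (simp only: mult_ac)
    qed simp
  qed
  finally show ?thesis .
qed

lemma emeasure_limit_law:
  assumes A [measurable]: "A \<in> sets borel"
  shows "emeasure limit_law A = ennreal (1 - inverse c) * emeasure (return borel 0) A
    + emeasure (density lborel (\<lambda>x. ennreal (nu c \<sigma> x))) A"
proof -
  let ?a = "\<lambda>\<theta>. ennreal (weight \<theta> * indicator A (inverse (location \<theta>)) * indicator {0..pi} \<theta>)"
  let ?b = "\<lambda>\<theta>. ennreal ((1 - inverse c) * indicator A 0) * indicator {4..5::real} \<theta>"
  have "emeasure limit_law A = emeasure (density lborel (\<lambda>\<theta>. ennreal (angle_density \<theta>))) (inv_location -` A \<inter> space lborel)"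
    unfolding limit_law_def by (subst emeasure_distr) auto
  also have "\<dots> = (\<integral>\<^sup>+\<theta>. ennreal (angle_density \<theta>) * indicator (inv_location -` A \<inter> space lborel) \<theta> \<partial>lborel)"
    by (rule emeasure_density) (use measurable_sets[OF inv_location_measurable A] in simp_all)
  also have "\<dots> = (\<integral>\<^sup>+\<theta>. ?b \<theta> + ?a \<theta> \<partial>lborel)"
    using pi_less_4
    by (intro nn_integral_cong) (auto simp: angle_density_def inv_location_def indicator_def inverse_eq_divide)
  also have "\<dots> = (\<integral>\<^sup>+\<theta>. ?b \<theta> \<partial>lborel) + (\<integral>\<^sup>+\<theta>. ?a \<theta> \<partial>lborel)"
    by (rule nn_integral_add) auto
  also have "(\<integral>\<^sup>+\<theta>. ?b \<theta> \<partial>lborel) = ennreal (1 - inverse c) * emeasure (return borel 0) A"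
    by (subst nn_integral_cmult_indicator) (auto simp: indicator_def)
  finally show ?thesis by (simp add: emeasure_density_nu[OF A])
qed

section \<open>The branch of the square root and the Stieltjes transform\<close>

definition sqrt_branch :: "complex \<Rightarrow> complex" where
  "sqrt_branch z = csqrt (1 / z - of_real (lambda_minus c \<sigma>)) * csqrt (1 / z - of_real (lambda_plus c \<sigma>))"

lemma Im_inverse_neg: "0 < Im z \<Longrightarrow> Im (1 / z) < 0"
  by (simp add: Im_divide divide_neg_pos add_nonneg_pos)

lemma lambda_sum_prod:
  "lambda_minus c \<sigma> + lambda_plus c \<sigma> = 2 * m" "lambda_minus c \<sigma> * lambda_plus c \<sigma> = (\<sigma>\<^sup>2 * (c - 1))\<^sup>2"
  unfolding m_minus_h[symmetric] m_plus_h[symmetric] m2_h2[symmetric]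
  by (simp_all add: power2_eq_square algebra_simps)

text \<open>Vieta: as a quadratic in \<open>1 / z\<close>, the radicand has the two edges of the
  spectrum as its zeros.\<close>

lemma mP_radicand_factored:
  "mP_radicand c \<sigma> z = (1 / z - of_real (lambda_minus c \<sigma>)) * (1 / z - of_real (lambda_plus c \<sigma>))"
proof -
  define w where "w = 1 / z"
  have "(w - of_real (lambda_minus c \<sigma>)) * (w - of_real (lambda_plus c \<sigma>))
    = w\<^sup>2 - of_real (lambda_minus c \<sigma> + lambda_plus c \<sigma>) * w + of_real (lambda_minus c \<sigma> * lambda_plus c \<sigma>)"
    by (simp add: power2_eq_square algebra_simps)
  also have "\<dots> = (w - of_real (c * \<sigma>\<^sup>2) + of_real (\<sigma>\<^sup>2))\<^sup>2 - 4 * w * of_real (\<sigma>\<^sup>2)"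
    unfolding lambda_sum_prod m_def by (simp add: power2_eq_square algebra_simps)
  finally show ?thesis unfolding mP_radicand_def w_def by simp
qed

lemma sqrt_branch_sq: "(sqrt_branch z)\<^sup>2 = mP_radicand c \<sigma> z"
  unfolding mP_radicand_factored sqrt_branch_def by (simp add: power_mult_distrib)

lemma mP_radicand_nonzero:
  assumes "0 < Im z" shows "mP_radicand c \<sigma> z \<noteq> 0"
proof -
  have "1 / z - of_real x \<noteq> 0" for x
    using Im_inverse_neg[OF assms] by (auto simp: complex_eq_iff)
  then show ?thesis unfolding mP_radicand_factored by simp
qed

text \<open>For \<open>0 < Im z\<close> each factor lies in the lower half-plane, off the cut of
  \<open>csqrt\<close>. The radicand itself is negative wherever \<open>Re (1 / z) = m\<close>, so
  its own principal root would jump there; hence the product of two roots.\<close>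

lemma sqrt_branch_holomorphic: "sqrt_branch holomorphic_on {z. 0 < Im z}"
proof -
  have "1 / z - of_real x \<notin> \<real>\<^sub>\<le>\<^sub>0" if "0 < Im z" for z x
    using Im_inverse_neg[OF that] by (auto simp: complex_nonpos_Reals_iff)
  then show ?thesis
    unfolding sqrt_branch_def by (intro holomorphic_intros) auto
qed

text \<open>With \<open>w = 1 / z\<close> and \<open>L = location \<theta>\<close> one has
  \<open>1 / (1 / L - z) = - w * L / (L - w)\<close>, and this \<open>L\<close> cancels the one in
  \<open>weight\<close>. What remains is the kernel with denominator
  \<open>m - w + h cos \<theta>\<close>.\<close>

lemma stieltjes_limit_law:
  assumes z: "0 < Im z"
  shows "stieltjes_transform limit_law z = mP c \<sigma> sqrt_branch z"
proof -
  define w where "w = 1 / z"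
  define r where "r = sqrt_branch z"
  \<comment> \<open>\<open>q\<close> and \<open>q'\<close> are the reciprocal roots of
    \<open>h * (1 + q^2) = 2 * q * (m - w)\<close>, since
    \<open>r^2 = (m - w)^2 - h^2\<close>.\<close>
  define q where "q = (of_real m - w + r) / of_real h"
  define q' where "q' = (of_real m - w - r) / of_real h"
  have w: "Im w < 0" unfolding w_def by (rule Im_inverse_neg[OF z])
  have z0: "z \<noteq> 0" using z by auto
  have r2: "r\<^sup>2 = (w - of_real m)\<^sup>2 - (of_real h)\<^sup>2"
    unfolding r_def sqrt_branch_sq mP_radicand_factored w_def m_minus_h[symmetric] m_plus_h[symmetric]
    by (simp add: power2_eq_square algebra_simps)
  \<comment> \<open>Both principal roots lie in the open fourth quadrant, so their product has
    negative imaginary part. Hence \<open>Im q' > 0\<close>, and \<open>q\<close> is the root in the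
    unit disc.\<close>
  have "Im r < 0"
  proof -
    let ?u = "csqrt (w - of_real (lambda_minus c \<sigma>))" and ?v = "csqrt (w - of_real (lambda_plus c \<sigma>))"
    have "Im (w - of_real x) < 0" for x using w by simp
    then have "0 < Re ?u" "Im ?u < 0" "0 < Re ?v" "Im ?v < 0"
      by (blast intro: csqrt_lower_half_plane)+
    then have "Re ?u * Im ?v + Im ?u * Re ?v < 0"
      by (intro add_neg_neg mult_pos_neg mult_neg_pos)
    then show ?thesis unfolding r_def sqrt_branch_def w_def by simp
  qed
  then have "0 < Im q'" using w h_pos by (simp add: q'_def)
  have hq: "of_real h * q = of_real m - w + r" "of_real h * q' = of_real m - w - r"
    using h_pos by (simp_all add: q_def q'_def)
  have "(of_real h)\<^sup>2 * (q * q') = (of_real h * q) * (of_real h * q')"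
    by (simp add: power2_eq_square mult_ac)
  also have "\<dots> = (of_real h)\<^sup>2"
    unfolding hq using r2 by (simp add: power2_eq_square algebra_simps)
  finally have qq': "q * q' = 1" using h_pos by simp
  have "0 < Im (q + q')"
    using w h_pos by (simp add: q_def q'_def divide_neg_pos add_divide_distrib[symmetric])
  then have q: "norm q < 1" "q \<noteq> 0"
    using smaller_root_norm_less_1[OF qq' \<open>0 < Im q'\<close>] qq' by auto
  have "of_real h * (1 + q\<^sup>2) = q * (of_real h * (q' + q))"
    using qq' by (simp add: algebra_simps power2_eq_square)
  also have "of_real h * (q' + q) = 2 * (of_real m - w)"
    unfolding distrib_left hq by simp
  finally have "of_real h * (1 + q\<^sup>2) = 2 * q * (of_real m - w)" by simp
  then have J: "((\<lambda>\<theta>. of_real ((sin \<theta>)\<^sup>2) / (of_real m - w + of_real (h * cos \<theta>))) has_integral (of_real pi * q / of_real h)) {0..pi}"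
    using q h_pos by (intro has_integral_sin_sq_over_affine_cos) auto
  have den: "of_real x - z \<noteq> 0" for x using z by (auto simp: complex_eq_iff)
  define C where "C = - w * of_real (h\<^sup>2 / (2 * pi * \<sigma>\<^sup>2 * c))"
  have e: "weight \<theta> *\<^sub>R (1 / (of_real (inverse (location \<theta>)) - z))
    = C * (of_real ((sin \<theta>)\<^sup>2) / (of_real m - w + of_real (h * cos \<theta>)))" for \<theta>
  proof -
    define L where "L = complex_of_real (location \<theta>)"
    have L: "L \<noteq> 0" using location_pos[of \<theta>] by (simp add: L_def)
    have Lw: "L - w \<noteq> 0" using w by (auto simp: L_def complex_eq_iff)
    have "inverse L - z = (1 - z * L) / L" using L by (simp add: field_simps)
    also have "1 - z * L = - (L - w) / w" using z0 by (simp add: w_def field_simps)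
    finally have "1 / (inverse L - z) = - (w * L) / (L - w)" by (simp add: minus_divide_right)
    then have k1: "1 / (of_real (inverse (location \<theta>)) - z) = - (w * L) / (L - w)" by (simp add: L_def)
    have k2: "complex_of_real (weight \<theta>) = of_real (h\<^sup>2 / (2 * pi * \<sigma>\<^sup>2 * c)) * of_real ((sin \<theta>)\<^sup>2) / L"
      by (simp add: weight_def L_def)
    have k3: "of_real m - w + of_real (h * cos \<theta>) = L - w" by (simp add: L_def location_def)
    have "k * s / L * (- (w * L) / (L - w)) = - w * k * (s / (L - w))" for k s
      using L Lw by (simp add: field_simps)
    then show ?thesis unfolding scaleR_conv_of_real C_def k1 k2 k3 .
  qed
  have "stieltjes_transform limit_law z
    = integral {0..pi} (\<lambda>\<theta>. weight \<theta> *\<^sub>R (1 / (of_real (inverse (location \<theta>)) - z))) + (1 - 1 / c) *\<^sub>R (1 / (of_real 0 - z))"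
    unfolding stieltjes_transform_def
  proof (rule angle_integral(2))
    have l0: "location \<theta> \<noteq> 0" for \<theta> using location_pos[of \<theta>] by simp
    show "continuous_on {0..pi} (\<lambda>\<theta>. 1 / (complex_of_real (inverse (location \<theta>)) - z))"
      by (intro continuous_intros location_continuous ballI den l0)
  qed measurable
  also have "integral {0..pi} (\<lambda>\<theta>. weight \<theta> *\<^sub>R (1 / (of_real (inverse (location \<theta>)) - z))) = C * (of_real pi * q / of_real h)"
    unfolding e by (intro integral_unique has_integral_mult_right J)
  also have "C * (of_real pi * q / of_real h) = - w * (of_real m - w + r) / of_real (2 * \<sigma>\<^sup>2 * c)"
    unfolding hq(1)[symmetric] C_def using h_pos sigma c by (simp add: power2_eq_square)
  also have "(1 - 1 / c) *\<^sub>R (1 / (of_real 0 - z)) = - w * (1 - 1 / of_real c)"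
    by (simp add: w_def scaleR_conv_of_real)
  also have "- w * (of_real m - w + r) / of_real (2 * \<sigma>\<^sup>2 * c) + - w * (1 - 1 / of_real c) = mP c \<sigma> sqrt_branch z"
  proof -
    have "(of_real m - w + r) / of_real (2 * \<sigma>\<^sup>2 * c) + (1 - 1 / of_real c)
      = 1 + (- w + of_real ((c - 1) * \<sigma>\<^sup>2) + r) / of_real (2 * \<sigma>\<^sup>2 * c)"
      using c sigma by (simp add: m_def field_simps)
    then have "- w * ((of_real m - w + r) / of_real (2 * \<sigma>\<^sup>2 * c) + (1 - 1 / of_real c)) = mP c \<sigma> sqrt_branch z"
      unfolding mP_def w_def r_def by simp
    then show ?thesis by (simp only: distrib_left times_divide_eq_right)
  qed
  finally show ?thesis .
qed

end

text \<open>At \<open>z = \<i> * (n + 1)\<close> the integrand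
  \<open>z / (x - z) = - 1 + x / (x - z)\<close> has modulus at most 1 and tends to
  \<open>- 1\<close>, so dominated convergence applies to every probability law.\<close>

lemma stieltjes_transform_asymptotics:
  assumes "real_distribution Q"
  shows "(\<lambda>n. (\<i> * of_nat (Suc n)) * stieltjes_transform Q (\<i> * of_nat (Suc n))) \<longlonglongrightarrow> - 1"
proof -
  interpret real_distribution Q by fact
  define f where "f n x = (\<i> * of_nat (Suc n)) / (of_real x - \<i> * of_nat (Suc n))" for n and x :: real
  have e: "(\<i> * of_nat (Suc n)) * stieltjes_transform Q (\<i> * of_nat (Suc n)) = (LINT x|Q. f n x)" for n
    unfolding stieltjes_transform_def f_def integral_mult_right_zero[symmetric] by simp
  have low: "real (Suc n) \<le> norm (of_real x - \<i> * of_nat (Suc n))" for n x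
    using abs_Im_le_cmod[of "of_real x - \<i> * of_nat (Suc n)"] by simp
  have bound: "norm (f n x) \<le> 1" for n x
  proof -
    have "norm (\<i> * of_nat (Suc n) :: complex) = real (Suc n)"
      by (simp only: norm_mult norm_ii norm_of_nat mult_1)
    then show ?thesis using low[of n x] by (simp add: f_def norm_divide divide_le_eq)
  qed
  have lim: "(\<lambda>n. f n x) \<longlonglongrightarrow> - 1" for x
  proof -
    have "(\<lambda>n. - 1 + of_real x / (of_real x - \<i> * of_nat (Suc n))) \<longlonglongrightarrow> - 1 + 0"
    proof (intro tendsto_add tendsto_const)
      have "(\<lambda>n. \<bar>x\<bar> * inverse (real (Suc n))) \<longlonglongrightarrow> \<bar>x\<bar> * 0"
        by (intro tendsto_intros LIMSEQ_inverse_real_of_nat)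
      then have z: "(\<lambda>n. \<bar>x\<bar> * inverse (real (Suc n))) \<longlonglongrightarrow> 0" by simp
      show "(\<lambda>n. of_real x / (of_real x - \<i> * of_nat (Suc n))) \<longlonglongrightarrow> 0"
      proof (rule Lim_null_comparison[OF always_eventually z], rule allI)
        fix n
        show "norm (of_real x / (of_real x - \<i> * of_nat (Suc n))) \<le> \<bar>x\<bar> * inverse (real (Suc n))"
          unfolding norm_divide norm_of_real unfolding divide_inverse
          by (intro mult_left_mono le_imp_inverse_le low) auto
      qed
    qed
    moreover have "- 1 + of_real x / (of_real x - \<i> * of_nat (Suc n)) = f n x" for n
    proof -
      have "of_real x - \<i> * of_nat (Suc n) \<noteq> (0 :: complex)" using low[of n x] by auto
      then show ?thesis by (simp add: f_def divide_simps)
    qed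
    ultimately show ?thesis by simp
  qed
  have "(\<lambda>n. LINT x|Q. f n x) \<longlonglongrightarrow> (LINT x|Q. - 1)"
  proof (rule integral_dominated_convergence[where w = "\<lambda>_. 1"])
    show "f n \<in> borel_measurable Q" for n unfolding f_def by measurable
  qed (use bound lim in auto)
  then show ?thesis unfolding e using prob_space by simp
qed

context mp_params
begin

text \<open>A competing branch is \<open>sqrt_branch\<close> or its negative on the whole half-plane; the negative is
  excluded since \<open>z * m(z)\<close> must tend to \<open>- 1\<close> along the imaginary axis.\<close>
lemma mP_branch_unique:
  assumes r: "mP_branch c \<sigma> r" and z: "0 < Im z"
  shows "r z = sqrt_branch z"
proof -
  let ?H = "{z::complex. 0 < Im z}"
  have r_an: "r analytic_on ?H" and r_sq: "\<And>z. 0 < Im z \<Longrightarrow> (r z)\<^sup>2 = mP_radicand c \<sigma> z"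
    using r by (auto simp: mP_branch_def)
  obtain Q where Q: "real_distribution Q" "\<And>z. 0 < Im z \<Longrightarrow> stieltjes_transform Q z = mP c \<sigma> r z"
    using r by (auto simp: mP_branch_def)
  have conn: "connected ?H" by (intro convex_connected convex_halfspace_Im_gt)
  have s_nz: "sqrt_branch z \<noteq> 0" if "0 < Im z" for z
    using sqrt_branch_sq[of z] mP_radicand_nonzero[OF that] by auto
  define k where "k z = r z / sqrt_branch z" for z
  have "continuous_on ?H k"
    unfolding k_def
    using analytic_imp_holomorphic[OF r_an] sqrt_branch_holomorphic s_nz
    by (intro continuous_on_divide holomorphic_on_imp_continuous_on) auto
  moreover have k_pm: "k z \<in> {1, - 1}" if "0 < Im z" for z
  proof -
    have "(k z)\<^sup>2 = 1"
      using r_sq[OF that] sqrt_branch_sq[of z] mP_radicand_nonzero[OF that] by (simp add: k_def power_divide)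
    then show ?thesis by (simp add: power2_eq_1_iff)
  qed
  then have "finite (k ` ?H)" by (rule finite_subset[of _ "{1, - 1}", OF image_subsetI]) auto
  \<comment> \<open>A continuous function with finite range on a connected set is constant, so the
    sign is global.\<close>
  ultimately have "k constant_on ?H"
    using continuous_finite_range_constant[OF conn] by blast
  then obtain \<kappa> where \<kappa>: "\<And>z. 0 < Im z \<Longrightarrow> k z = \<kappa>" by (auto simp: constant_on_def)
  have "\<kappa> \<noteq> - 1"
  proof
    assume "\<kappa> = - 1"
    then have neg: "r z = - sqrt_branch z" if "0 < Im z" for z
      using \<kappa>[OF that] s_nz[OF that] by (simp add: k_def field_simps)
    let ?z = "\<lambda>n. \<i> * of_nat (Suc n) :: complex"
    have Imz: "0 < Im (?z n)" for n by simp
    \<comment> \<open>Adding the transforms for the two signs cancels the root. The sum must tend to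
      \<open>- 2\<close>, whereas the formulas give \<open>- 2 - (c - 1) / c\<close>.\<close>
    have "(\<lambda>n. ?z n * stieltjes_transform Q (?z n) + ?z n * stieltjes_transform limit_law (?z n)) \<longlonglongrightarrow> - 1 + - 1"
      by (intro tendsto_add stieltjes_transform_asymptotics Q(1) real_distribution_limit_law)
    moreover have "?z n * stieltjes_transform Q (?z n) + ?z n * stieltjes_transform limit_law (?z n)
      = - 2 - (of_real ((c - 1) * \<sigma>\<^sup>2) - 1 / ?z n) / of_real (\<sigma>\<^sup>2 * c)" for n
    proof -
      have "?z n \<noteq> 0" using Imz[of n] by (metis less_irrefl zero_complex.simps(2))
      moreover have "w * (- (1 / w) * (1 + (- 1 / w + a + - s) / of_real (2 * \<sigma>\<^sup>2 * c)))
          + w * (- (1 / w) * (1 + (- 1 / w + a + s) / of_real (2 * \<sigma>\<^sup>2 * c)))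
        = - 2 - (a - 1 / w) / of_real (\<sigma>\<^sup>2 * c)" if "w \<noteq> 0" for w a s :: complex
      proof -
        define d where "d = complex_of_real (\<sigma>\<^sup>2 * c)"
        have d: "d \<noteq> 0" using sigma c by (simp add: d_def)
        have d2: "of_real (2 * \<sigma>\<^sup>2 * c) = 2 * d" by (simp add: d_def)
        have "w * (- (1 / w) * (1 + (- 1 / w + a + - s) / (2 * d))) + w * (- (1 / w) * (1 + (- 1 / w + a + s) / (2 * d)))
          = - (1 + (- 1 / w + a + - s) / (2 * d)) - (1 + (- 1 / w + a + s) / (2 * d))"
          using that by simp
        also have "\<dots> = - 2 - ((- 1 / w + a + - s) + (- 1 / w + a + s)) / (2 * d)"
        proof -
          have "- (1 + u / e) - (1 + v / e) = - 2 - (u + v) / e" for u v e :: complex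
            by (simp add: add_divide_distrib)
          then show ?thesis .
        qed
        also have "(- 1 / w + a + - s) + (- 1 / w + a + s) = 2 * (a - 1 / w)" by simp
        also have "2 * (a - 1 / w) / (2 * d) = (a - 1 / w) / d"
          by (rule mult_divide_mult_cancel_left) simp
        finally show ?thesis unfolding d2 d_def[symmetric] .
      qed
      ultimately show ?thesis
        unfolding Q(2)[OF Imz] stieltjes_limit_law[OF Imz] mP_def neg[OF Imz] by blast
    qed
    moreover have "(\<lambda>n. - 2 - (of_real ((c - 1) * \<sigma>\<^sup>2) - 1 / ?z n) / of_real (\<sigma>\<^sup>2 * c))
      \<longlonglongrightarrow> - 2 - (of_real ((c - 1) * \<sigma>\<^sup>2) - 0) / of_real (\<sigma>\<^sup>2 * c)"
    proof (intro tendsto_intros)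
      have "(\<lambda>n. - \<i> * of_real (inverse (real (Suc n)))) \<longlonglongrightarrow> - \<i> * of_real 0"
        by (intro tendsto_intros LIMSEQ_inverse_real_of_nat)
      moreover have "- \<i> * of_real (inverse (real (Suc n))) = 1 / ?z n" for n
        by (simp add: divide_inverse)
      ultimately show "(\<lambda>n. 1 / ?z n) \<longlonglongrightarrow> 0" by simp
      show "complex_of_real (\<sigma>\<^sup>2 * c) \<noteq> 0" using sigma c by simp
    qed
    ultimately have "- 2 - (of_real ((c - 1) * \<sigma>\<^sup>2) - 0) / of_real (\<sigma>\<^sup>2 * c) = (- 1 + - 1 :: complex)"
      by (simp only: LIMSEQ_unique)
    then show False using sigma c by simp
  qed
  then have "\<kappa> = 1" using k_pm[OF z] \<kappa>[OF z] by auto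
  then show ?thesis using \<kappa>[OF z] s_nz[OF z] by (simp add: k_def)
qed

lemma mP_branch_sqrt_branch: "mP_branch c \<sigma> sqrt_branch"
proof -
  have "sqrt_branch analytic_on {z. 0 < Im z}"
    using sqrt_branch_holomorphic by (subst analytic_on_open) (auto simp: open_halfspace_Im_gt)
  then show ?thesis
    unfolding mP_branch_def using sqrt_branch_sq stieltjes_limit_law real_distribution_limit_law by blast
qed

lemma stieltjes_limit_law_branch:
  assumes "mP_branch c \<sigma> r" "0 < Im z"
  shows "stieltjes_transform limit_law z = mP c \<sigma> r z"
  using stieltjes_limit_law[OF assms(2)] mP_branch_unique[OF assms] by (simp add: mP_def)

lemma inverse_add_measurable: "(\<lambda>x. 1 / (inverse x + t)) \<in> borel_measurable (borel :: real measure)"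
  by measurable

text \<open>Identifies the root of the limiting equation. \<open>inverse x\<close> recovers an
  eigenvalue of \<open>S\<close> from one of the pseudo-inverse, the atom included since
  \<open>inverse 0 = 0\<close>. The factor \<open>\<sigma>^2 * c\<close> and the shift
  \<open>t / \<sigma>^2\<close> come from scaling to unit variance and from averaging over
  \<open>n\<close> instead of \<open>p\<close>.\<close>

lemma limit_law_resolvent_equation:
  assumes t: "0 < t"
  defines "g \<equiv> \<sigma>\<^sup>2 * c * integral\<^sup>L limit_law (\<lambda>x. 1 / (inverse x + t))"
  shows "0 \<le> g" "(t / \<sigma>\<^sup>2) * g + g / (1 + g) = c"
proof -
  define C where "C = h\<^sup>2 / (2 * pi * \<sigma>\<^sup>2 * c)"
  define \<rho> where "\<rho> = sqrt ((m + t)\<^sup>2 - h\<^sup>2)"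
  \<comment> \<open>Partial fractions: \<open>1 / (L (L + t)) = (1 / L - 1 / (L + t)) / t\<close>
    reduces the integral to the kernel at the shifts 0 and \<open>t\<close>.\<close>
  have e: "weight \<theta> *\<^sub>R (1 / (inverse (inverse (location \<theta>)) + t))
    = (C / t) * ((sin \<theta>)\<^sup>2 / (location \<theta> + 0) - (sin \<theta>)\<^sup>2 / (location \<theta> + t))" for \<theta>
  proof -
    let ?L = "location \<theta>"
    have L: "0 < ?L" by (rule location_pos)
    have "(sin \<theta>)\<^sup>2 / (?L + 0) - (sin \<theta>)\<^sup>2 / (?L + t) = (sin \<theta>)\<^sup>2 * t / (?L * (?L + t))"
      using L t by (simp add: field_simps)
    moreover have "weight \<theta> = C * (sin \<theta>)\<^sup>2 / ?L" by (simp add: weight_def C_def)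
    ultimately show ?thesis using L t by simp
  qed
  have int: "integral\<^sup>L limit_law (\<lambda>x. 1 / (inverse x + t))
    = integral {0..pi} (\<lambda>\<theta>. weight \<theta> *\<^sub>R (1 / (inverse (inverse (location \<theta>)) + t))) + (1 - 1 / c) *\<^sub>R (1 / (inverse 0 + t))"
  proof (rule angle_integral(2))
    have "location \<theta> + t \<noteq> 0" for \<theta> using location_pos[of \<theta>] t by simp
    then show "continuous_on {0..pi} (\<lambda>\<theta>. 1 / (inverse (inverse (location \<theta>)) + t))"
      unfolding inverse_inverse_eq by (intro continuous_intros location_continuous) auto
  qed (rule inverse_add_measurable)
  also have "integral {0..pi} (\<lambda>\<theta>. weight \<theta> *\<^sub>R (1 / (inverse (inverse (location \<theta>)) + t)))
    = (C / t) * (pi * real_root 0 / h - pi * real_root t / h)"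
    unfolding e using t
    by (intro integral_unique has_integral_mult_right has_integral_diff integral_weight_kernel_real) auto
  finally have I: "integral\<^sup>L limit_law (\<lambda>x. 1 / (inverse x + t))
    = (C / t) * (pi * real_root 0 / h - pi * real_root t / h) + (1 - 1 / c) / t" by simp
  have "sqrt (m\<^sup>2 - h\<^sup>2) = \<sigma>\<^sup>2 * (c - 1)" unfolding m2_h2 using c by simp
  moreover have "h * real_root 0 = m - sqrt (m\<^sup>2 - h\<^sup>2)" using h_pos by (simp add: real_root_def)
  ultimately have r0: "h * real_root 0 = 2 * \<sigma>\<^sup>2" by (simp add: m_def algebra_simps)
  have rt: "h * real_root t = m + t - \<rho>" using h_pos by (simp add: real_root_def \<rho>_def)
  have "(C / t) * (pi * real_root 0 / h - pi * real_root t / h) = (h * real_root 0 - h * real_root t) / (2 * \<sigma>\<^sup>2 * c * t)"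
  proof -
    have k: "C * pi / h = h / (2 * \<sigma>\<^sup>2 * c)" using h_pos by (simp add: C_def power2_eq_square)
    have "(C / t) * (pi * real_root 0 / h - pi * real_root t / h) = (C * pi / h) * (real_root 0 - real_root t) / t"
      by (simp add: diff_divide_distrib right_diff_distrib mult_ac)
    also have "\<dots> = (h * real_root 0 - h * real_root t) / (2 * \<sigma>\<^sup>2 * c * t)"
      unfolding k by (simp add: right_diff_distrib diff_divide_distrib)
    finally show ?thesis .
  qed
  then have "integral\<^sup>L limit_law (\<lambda>x. 1 / (inverse x + t)) = (2 * \<sigma>\<^sup>2 - (m + t - \<rho>)) / (2 * \<sigma>\<^sup>2 * c * t) + (1 - 1 / c) / t"
    unfolding I r0 rt by simp
  then have "g = ((2 * \<sigma>\<^sup>2 - (m + t - \<rho>)) / 2 + \<sigma>\<^sup>2 * (c - 1)) / t"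
    unfolding g_def using sigma c t by (simp add: field_simps)
  then have g: "2 * t * g = \<sigma>\<^sup>2 * (c - 1) - t + \<rho>"
    using t by (simp add: m_def field_simps)
  have "h\<^sup>2 < (m + t)\<^sup>2" using h_less_m h_pos t by (intro power_strict_mono) auto
  then have \<rho>2: "\<rho>\<^sup>2 = (m + t)\<^sup>2 - h\<^sup>2" and \<rho>: "0 \<le> \<rho>" by (simp_all add: \<rho>_def)
  have h2: "h\<^sup>2 = 4 * \<sigma>\<^sup>2 * \<sigma>\<^sup>2 * c" using c by (simp add: h_def power_mult_distrib power2_eq_square)
  have \<rho>2': "\<rho>\<^sup>2 = (\<sigma>\<^sup>2 * (c - 1) - t)\<^sup>2 + 4 * \<sigma>\<^sup>2 * c * t"
    unfolding \<rho>2 h2 m_def by (simp add: power2_eq_square algebra_simps)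
  have "\<bar>\<sigma>\<^sup>2 * (c - 1) - t\<bar> \<le> \<rho>"
  proof (rule power2_le_imp_le)
    show "\<bar>\<sigma>\<^sup>2 * (c - 1) - t\<bar>\<^sup>2 \<le> \<rho>\<^sup>2" unfolding \<rho>2' using c t by simp
  qed (rule \<rho>)
  then have "0 \<le> 2 * t * g" unfolding g by linarith
  then show g0: "0 \<le> g" using t by (simp add: zero_le_mult_iff)
  \<comment> \<open>Eliminating \<open>\<rho>\<close> by squaring leaves a quadratic equation for
    \<open>g\<close>; division by \<open>1 + g\<close> brings it into the fixed-point form.\<close>
  have "(2 * t * g - (\<sigma>\<^sup>2 * (c - 1) - t))\<^sup>2 = (\<sigma>\<^sup>2 * (c - 1) - t)\<^sup>2 + 4 * \<sigma>\<^sup>2 * c * t"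
    unfolding g using \<rho>2' by simp
  then have "4 * t * (t * g\<^sup>2 - g * (\<sigma>\<^sup>2 * (c - 1) - t) - \<sigma>\<^sup>2 * c) = 0"
    by (simp add: power2_eq_square algebra_simps)
  then have "t * g\<^sup>2 - g * (\<sigma>\<^sup>2 * (c - 1) - t) - \<sigma>\<^sup>2 * c = 0" using t by simp
  then have "t * g * (1 + g) + \<sigma>\<^sup>2 * g = \<sigma>\<^sup>2 * (c * (1 + g))"
    by (simp add: power2_eq_square algebra_simps)
  then have "(t / \<sigma>\<^sup>2) * g * (1 + g) + g = c * (1 + g)"
    using sigma by (simp add: field_simps)
  then show "(t / \<sigma>\<^sup>2) * g + g / (1 + g) = c"
    using g0 by (simp add: field_simps)
qed

end

subsection \<open>From resolvents to weak convergence\<close>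

text \<open>The properties of integration against a probability law on \<open>[0, 1]\<close> that
  the density argument uses, kept abstract so that finite averages and the gauge integral with an
  atom are treated alike.\<close>

definition unit_functional :: "((real \<Rightarrow> real) \<Rightarrow> real) \<Rightarrow> bool" where
  "unit_functional L \<longleftrightarrow> L (\<lambda>_. 1) = 1 \<and>
    (\<forall>a b f g. continuous_on {0..1} f \<longrightarrow> continuous_on {0..1} g \<longrightarrow>
      L (\<lambda>u. a * f u + b * g u) = a * L f + b * L g) \<and>
    (\<forall>e f. continuous_on {0..1} f \<longrightarrow> (\<forall>u\<in>{0..1}. \<bar>f u\<bar> \<le> e) \<longrightarrow> \<bar>L f\<bar> \<le> e)"

locale converging_functionals =
  fixes A :: "nat \<Rightarrow> (real \<Rightarrow> real) \<Rightarrow> real" and L :: "(real \<Rightarrow> real) \<Rightarrow> real"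
  assumes A: "\<forall>\<^sub>F n in sequentially. unit_functional (A n)" and L: "unit_functional L"
begin

definition conv :: "(real \<Rightarrow> real) \<Rightarrow> bool" where
  "conv f \<longleftrightarrow> continuous_on {0..1} f \<and> (\<lambda>n. A n f) \<longlonglongrightarrow> L f"

lemma conv_one: "conv (\<lambda>_. 1)"
proof -
  have "\<forall>\<^sub>F n in sequentially. A n (\<lambda>_. 1) = L (\<lambda>_. 1)"
    using A by eventually_elim (use L in \<open>simp add: unit_functional_def\<close>)
  then show ?thesis by (simp add: conv_def tendsto_eventually)
qed

lemma conv_lin:
  assumes "conv f" "conv g" shows "conv (\<lambda>u. a * f u + b * g u)"
proof -
  have cont: "continuous_on {0..1} f" "continuous_on {0..1} g" using assms by (auto simp: conv_def)
  have "(\<lambda>n. a * A n f + b * A n g) \<longlonglongrightarrow> a * L f + b * L g"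
    using assms by (intro tendsto_intros) (auto simp: conv_def)
  moreover have "\<forall>\<^sub>F n in sequentially. a * A n f + b * A n g = A n (\<lambda>u. a * f u + b * g u)"
    using A by eventually_elim (use cont in \<open>simp add: unit_functional_def\<close>)
  moreover have "L (\<lambda>u. a * f u + b * g u) = a * L f + b * L g"
    using L cont by (simp add: unit_functional_def)
  ultimately show ?thesis
    using cont unfolding conv_def by (auto intro!: continuous_intros elim: Lim_transform_eventually)
qed

lemma unit_functional_diff_le:
  assumes K: "unit_functional K" and cont: "continuous_on {0..1} f" "continuous_on {0..1} g"
    and e: "\<And>u. u \<in> {0..1} \<Longrightarrow> \<bar>f u - g u\<bar> \<le> e"
  shows "\<bar>K f - K g\<bar> \<le> e"
proof -
  have "K (\<lambda>u. 1 * f u + (- 1) * g u) = 1 * K f + (- 1) * K g"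
    using K cont unfolding unit_functional_def by blast
  then have "K f - K g = K (\<lambda>u. f u - g u)" by simp
  moreover have "\<bar>K (\<lambda>u. f u - g u)\<bar> \<le> e"
    using K e continuous_on_diff[OF cont] unfolding unit_functional_def by blast
  ultimately show ?thesis by simp
qed

text \<open>All functionals are bounded by the supremum norm on \<open>[0, 1]\<close>, so an
  approximation error enters once for \<open>A n\<close> and once for \<open>L\<close>, uniformly in
  \<open>n\<close>.\<close>

lemma conv_uniform_limit:
  assumes f: "continuous_on {0..1} f"
    and approx: "\<And>e. 0 < e \<Longrightarrow> \<exists>g. conv g \<and> (\<forall>u\<in>{0..1}. \<bar>f u - g u\<bar> \<le> e)"
  shows "conv f"
proof -
  have "(\<lambda>n. A n f) \<longlonglongrightarrow> L f"
  proof (rule LIMSEQ_I)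
    fix r :: real assume r: "0 < r"
    then obtain g where g: "conv g" and e: "\<And>u. u \<in> {0..1} \<Longrightarrow> \<bar>f u - g u\<bar> \<le> r / 3"
      using approx[of "r / 3"] by auto
    have cg: "continuous_on {0..1} g" using g by (simp add: conv_def)
    have "(\<lambda>n. A n g) \<longlonglongrightarrow> L g" using g by (simp add: conv_def)
    then have "\<forall>\<^sub>F n in sequentially. dist (A n g) (L g) < r / 3"
      using r by (intro tendstoD) auto
    then have "\<forall>\<^sub>F n in sequentially. norm (A n f - L f) < r"
      using A
    proof eventually_elim
      case (elim n)
      have "\<bar>A n f - A n g\<bar> \<le> r / 3" "\<bar>L f - L g\<bar> \<le> r / 3"
        using unit_functional_diff_le[OF _ f cg e] elim(2) L by blast+
      then show ?case using elim(1) unfolding dist_real_def real_norm_def by linarith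
    qed
    then show "\<exists>N. \<forall>n\<ge>N. norm (A n f - L f) < r" unfolding eventually_sequentially .
  qed
  then show ?thesis using f by (simp add: conv_def)
qed

text \<open>Dividing out: \<open>u^(k+1) / (1 + s u) = (u^k - u^k / (1 + s u)) / s\<close>, and \<open>u^k\<close> is the uniform limit
  of \<open>u^k / (1 + s u)\<close> as \<open>s\<close> tends to 0.\<close>
lemma conv_continuous:
  assumes base: "\<And>j::nat. conv (\<lambda>u. u / (1 + inverse (real (Suc j)) * u))"
    and f: "continuous_on {0..1} f"
  shows "conv f"
proof -
  define s where "s j = inverse (real (Suc j))" for j
  have s: "0 < s j" for j by (simp add: s_def)
  have den: "1 \<le> 1 + s j * u" "1 + s j * u \<noteq> 0" if "u \<in> {0..1}" for j u
    using that s[of j] by (auto simp: add_nonneg_eq_0_iff)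
  \<comment> \<open>The error is \<open>u ^ k * s j * u / (1 + s j * u)\<close>, at most
    \<open>s j\<close> on the unit interval.\<close>
  have power_of: "conv (\<lambda>u. u ^ k)" if H: "\<And>j. conv (\<lambda>u. u ^ k / (1 + s j * u))" for k
  proof (rule conv_uniform_limit)
    fix e :: real assume "0 < e"
    then obtain j where j: "s j < e" unfolding s_def using reals_Archimedean by blast
    have "\<bar>u ^ k - u ^ k / (1 + s j * u)\<bar> \<le> e" if u: "u \<in> {0..1}" for u
    proof -
      have e1: "u ^ k - u ^ k / (1 + s j * u) = u ^ k * (s j * u) / (1 + s j * u)"
        using den[OF u, of j] by (simp add: field_simps)
      have "\<bar>u ^ k - u ^ k / (1 + s j * u)\<bar> = u ^ k * (s j * u) / (1 + s j * u)"
        unfolding e1 using u s[of j] den[OF u, of j] by (intro abs_of_nonneg) auto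
      also have "\<dots> \<le> u ^ k * (s j * u) / 1"
        using u s[of j] den[OF u, of j] by (intro divide_left_mono) (auto intro!: add_pos_nonneg)
      also have "\<dots> \<le> 1 * (s j * 1)"
        using u s[of j] by (simp add: mult_le_one power_le_one mult_left_le_one_le mult.left_commute mult_left_le)
      finally show ?thesis using j by simp
    qed
    then show "\<exists>g. conv g \<and> (\<forall>u\<in>{0..1}. \<bar>u ^ k - g u\<bar> \<le> e)" using H[of j] by blast
  qed (intro continuous_intros)
  \<comment> \<open>The functionals take functions on all reals; agreement on \<open>[0, 1]\<close>
    suffices, as approximation with error 0.\<close>
  have cong: "conv g" if "conv f" "\<And>u. u \<in> {0..1} \<Longrightarrow> f u = g u" for f g
  proof (rule conv_uniform_limit)
    show "continuous_on {0..1} g" using that continuous_on_cong[of "{0..1}" "{0..1}" f g] by (auto simp: conv_def)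
    show "\<exists>g'. conv g' \<and> (\<forall>u\<in>{0..1}. \<bar>g u - g' u\<bar> \<le> e)" if "0 < e" for e
      using \<open>conv f\<close> \<open>\<And>u. u \<in> {0..1} \<Longrightarrow> f u = g u\<close> that by (intro exI[of _ f]) auto
  qed
  \<comment> \<open>\<open>j\<close> stays arbitrary in the induction: the step needs
    \<open>u ^ k\<close>, which is a limit over all \<open>j\<close>.\<close>
  have quot: "conv (\<lambda>u. u ^ k / (1 + s j * u))" for k j
  proof (induction k arbitrary: j)
    case 0
    have "conv (\<lambda>u. 1 * 1 + (- s j) * (u / (1 + s j * u)))"
      by (rule conv_lin[OF conv_one base[of j, folded s_def]])
    then show ?case by (rule cong) (use den in \<open>simp add: field_simps\<close>)
  next
    case (Suc k)
    have "conv (\<lambda>u. (1 / s j) * u ^ k + (- 1 / s j) * (u ^ k / (1 + s j * u)))"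
      by (rule conv_lin[OF power_of[OF Suc.IH] Suc.IH])
    then show ?case
    proof (rule cong)
      fix u :: real assume u: "u \<in> {0..1}"
      have "1 - 1 / (1 + s j * u) = s j * u / (1 + s j * u)" using den[OF u, of j] by (simp add: diff_divide_eq_iff)
      moreover have "(1 / s j) * u ^ k + (- 1 / s j) * (u ^ k / (1 + s j * u)) = (u ^ k / s j) * (1 - 1 / (1 + s j * u))"
        by (simp add: right_diff_distrib)
      ultimately show "(1 / s j) * u ^ k + (- 1 / s j) * (u ^ k / (1 + s j * u)) = u ^ Suc k / (1 + s j * u)"
        using s[of j] by simp
    qed
  qed
  have power: "conv (\<lambda>u. u ^ k)" for k by (rule power_of[OF quot])
  have poly: "conv (\<lambda>u. \<Sum>i\<le>k. a i * u ^ i)" for a k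
  proof (induction k)
    case 0
    then show ?case using conv_lin[OF power[of 0] conv_one, of "a 0" 0] by simp
  next
    case (Suc k)
    then show ?case using conv_lin[OF Suc power[of "Suc k"], of 1 "a (Suc k)"] by simp
  qed
  show ?thesis
  proof (rule conv_uniform_limit[OF f])
    fix e :: real assume "0 < e"
    then obtain g where g: "real_polynomial_function g" "\<And>u. u \<in> {0..1} \<Longrightarrow> \<bar>f u - g u\<bar> < e"
      using Stone_Weierstrass_real_polynomial_function[OF compact_Icc f] by blast
    then obtain a k where "g = (\<lambda>u. \<Sum>i\<le>k. a i * u ^ i)" using real_polynomial_function_iff_sum by blast
    then have "conv g" using poly by simp
    then show "\<exists>g. conv g \<and> (\<forall>u\<in>{0..1}. \<bar>f u - g u\<bar> \<le> e)" using g(2) less_imp_le by blast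
  qed
qed

end

context mp_params
begin

text \<open>The integral of \<open>f (1 / (1 + \<lambda>))\<close> for the limiting spectral law of
  \<open>S\<close>; its atom at \<open>\<lambda> = 0\<close> sits at \<open>u = 1\<close>.\<close>

definition limit_functional :: "(real \<Rightarrow> real) \<Rightarrow> real" where
  "limit_functional f = integral {0..pi} (\<lambda>\<theta>. weight \<theta> * f (1 / (1 + location \<theta>))) + (1 - 1 / c) * f 1"

lemma unit_location: "1 / (1 + location \<theta>) \<in> {0..1}"
  using location_pos[of \<theta>] by simp

lemma weight_integrable:
  assumes "continuous_on {0..1} f"
  shows "(\<lambda>\<theta>. weight \<theta> * f (1 / (1 + location \<theta>))) integrable_on {0..pi}"
proof (rule integrable_continuous_real)
  have "1 + location \<theta> \<noteq> 0" for \<theta> using location_pos[of \<theta>] by simp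
  then have "continuous_on {0..pi} (\<lambda>\<theta>. 1 / (1 + location \<theta>))"
    by (intro continuous_intros location_continuous) auto
  then have "continuous_on {0..pi} (\<lambda>\<theta>. f (1 / (1 + location \<theta>)))"
    by (rule continuous_on_compose2[OF assms]) (use unit_location in auto)
  then show "continuous_on {0..pi} (\<lambda>\<theta>. weight \<theta> * f (1 / (1 + location \<theta>)))"
    by (intro continuous_intros weight_continuous)
qed

lemma unit_functional_limit: "unit_functional limit_functional"
  unfolding unit_functional_def
proof (intro conjI allI impI)
  show "limit_functional (\<lambda>_. 1) = 1"
    using integral_weight by (simp add: limit_functional_def integral_unique)
  fix a b e :: real and f g :: "real \<Rightarrow> real"
  assume f: "continuous_on {0..1} f"
  note fi = weight_integrable[OF f]
  {
    assume g: "continuous_on {0..1} g"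
    note gi = weight_integrable[OF g]
    have "integral {0..pi} (\<lambda>\<theta>. weight \<theta> * (a * f (1 / (1 + location \<theta>)) + b * g (1 / (1 + location \<theta>))))
      = integral {0..pi} (\<lambda>\<theta>. a * (weight \<theta> * f (1 / (1 + location \<theta>))) + b * (weight \<theta> * g (1 / (1 + location \<theta>))))"
      by (simp add: algebra_simps)
    also have "\<dots> = a * integral {0..pi} (\<lambda>\<theta>. weight \<theta> * f (1 / (1 + location \<theta>)))
       + b * integral {0..pi} (\<lambda>\<theta>. weight \<theta> * g (1 / (1 + location \<theta>)))"
      using fi gi by (intro integral_unique has_integral_add has_integral_mult_right integrable_integral)
    finally show "limit_functional (\<lambda>u. a * f u + b * g u) = a * limit_functional f + b * limit_functional g"
      by (simp add: limit_functional_def algebra_simps)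
  }
  {
    assume e: "\<forall>u\<in>{0..1}. \<bar>f u\<bar> \<le> e"
    have "norm (integral {0..pi} (\<lambda>\<theta>. weight \<theta> * f (1 / (1 + location \<theta>)))) \<le> integral {0..pi} (\<lambda>\<theta>. weight \<theta> * e)"
    proof (rule integral_norm_bound_integral[OF fi])
      show "(\<lambda>\<theta>. weight \<theta> * e) integrable_on {0..pi}"
        using integral_weight by (intro integrable_on_mult_left) (auto simp: integrable_on_def)
      show "norm (weight \<theta> * f (1 / (1 + location \<theta>))) \<le> weight \<theta> * e" for \<theta>
      proof -
        have "\<bar>f (1 / (1 + location \<theta>))\<bar> \<le> e" using e unit_location[of \<theta>] by blast
        then show ?thesis using weight_nonneg[of \<theta>] by (simp add: abs_mult mult_left_mono)
      qed
    qed
    also have "\<dots> = (1 / c) * e"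
      by (intro integral_unique has_integral_mult_left integral_weight)
    finally have "\<bar>integral {0..pi} (\<lambda>\<theta>. weight \<theta> * f (1 / (1 + location \<theta>)))\<bar> \<le> (1 / c) * e" by simp
    moreover have "\<bar>(1 - 1 / c) * f 1\<bar> \<le> (1 - 1 / c) * e"
    proof -
      have "\<bar>f 1\<bar> \<le> e" using e by simp
      moreover have "0 \<le> 1 - 1 / c" using c by simp
      ultimately show ?thesis by (metis abs_mult abs_of_nonneg mult_left_mono)
    qed
    ultimately show "\<bar>limit_functional f\<bar> \<le> e"
      unfolding limit_functional_def by (simp add: left_diff_distrib)
  }
qed

text \<open>Apart from the atom, \<open>u\<close> is at most \<open>1 / (1 + (m - h)) < 1\<close>,
  so high powers of \<open>u\<close> isolate the mass of the atom.\<close>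

lemma limit_functional_power_le:
  "limit_functional (\<lambda>u. u ^ k) \<le> (1 / c) * (1 / (1 + (m - h))) ^ k + (1 - 1 / c)"
proof -
  have "integral {0..pi} (\<lambda>\<theta>. weight \<theta> * (1 / (1 + location \<theta>)) ^ k)
    \<le> integral {0..pi} (\<lambda>\<theta>. weight \<theta> * (1 / (1 + (m - h))) ^ k)"
  proof (rule integral_le)
    show "(\<lambda>\<theta>. weight \<theta> * (1 / (1 + location \<theta>)) ^ k) integrable_on {0..pi}"
      by (rule weight_integrable) (intro continuous_intros)
    show "(\<lambda>\<theta>. weight \<theta> * (1 / (1 + (m - h))) ^ k) integrable_on {0..pi}"
      using integral_weight by (intro integrable_on_mult_left) (auto simp: integrable_on_def)
    show "weight \<theta> * (1 / (1 + location \<theta>)) ^ k \<le> weight \<theta> * (1 / (1 + (m - h))) ^ k" for \<theta>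
      using h_less_m location_bounds(1)[of \<theta>]
      by (intro mult_left_mono power_mono weight_nonneg divide_left_mono) (auto intro!: mult_pos_pos)
  qed
  also have "\<dots> = (1 / c) * (1 / (1 + (m - h))) ^ k"
    by (intro integral_unique has_integral_mult_left integral_weight)
  finally show ?thesis by (simp add: limit_functional_def)
qed

lemma limit_functional_resolvent:
  assumes "0 < s"
  shows "limit_functional (\<lambda>u. u / (1 + s * u)) = integral\<^sup>L limit_law (\<lambda>x. 1 / (inverse x + (1 + s)))"
proof -
  have l: "0 < location \<theta>" for \<theta> by (rule location_pos)
  have "integral\<^sup>L limit_law (\<lambda>x. 1 / (inverse x + (1 + s)))
    = integral {0..pi} (\<lambda>\<theta>. weight \<theta> *\<^sub>R (1 / (inverse (inverse (location \<theta>)) + (1 + s)))) + (1 - 1 / c) *\<^sub>R (1 / (inverse 0 + (1 + s)))"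
  proof (rule angle_integral(2))
    have "location \<theta> + (1 + s) \<noteq> 0" for \<theta> using l[of \<theta>] assms by simp
    then show "continuous_on {0..pi} (\<lambda>\<theta>. 1 / (inverse (inverse (location \<theta>)) + (1 + s)))"
      unfolding inverse_inverse_eq by (intro continuous_intros location_continuous) auto
  qed (rule inverse_add_measurable)
  moreover have "1 / (1 + location \<theta>) / (1 + s * (1 / (1 + location \<theta>))) = 1 / (location \<theta> + (1 + s))" for \<theta>
    using l[of \<theta>] assms by (simp add: divide_simps add_nonneg_eq_0_iff)
  ultimately show ?thesis by (simp add: limit_functional_def)
qed

end

section \<open>Finite spectra and step functions\<close>

definition unit_average :: "nat \<Rightarrow> (nat \<Rightarrow> real) \<Rightarrow> (real \<Rightarrow> real) \<Rightarrow> real" where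
  "unit_average p d f = (\<Sum>i<p. f (1 / (1 + d i))) / real p"

lemma unit_functional_average:
  assumes "0 < p" and d: "\<And>i. i < p \<Longrightarrow> 0 \<le> d i"
  shows "unit_functional (unit_average p d)"
  unfolding unit_functional_def
proof (intro conjI allI impI)
  show "unit_average p d (\<lambda>_. 1) = 1" using assms(1) by (simp add: unit_average_def)
  fix a b e :: real and f g :: "real \<Rightarrow> real"
  show "unit_average p d (\<lambda>u. a * f u + b * g u) = a * unit_average p d f + b * unit_average p d g"
    by (simp add: unit_average_def sum.distrib add_divide_distrib sum_distrib_left)
  assume "\<forall>u\<in>{0..1}. \<bar>f u\<bar> \<le> e"
  then have "\<bar>f (1 / (1 + d i))\<bar> \<le> e" if "i < p" for i
    using d[OF that] by auto
  then have "(\<Sum>i<p. \<bar>f (1 / (1 + d i))\<bar>) \<le> (\<Sum>i<p. e)" by (intro sum_mono) simp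
  then have "\<bar>\<Sum>i<p. f (1 / (1 + d i))\<bar> \<le> (\<Sum>i<p. e)"
    by (rule order_trans[OF sum_abs])
  then show "\<bar>unit_average p d f\<bar> \<le> e"
    using assms(1) by (simp add: unit_average_def field_simps)
qed

text \<open>The step function \<open>cts_step x y\<close> in the coordinate \<open>v = s / (1 + s)\<close>.\<close>
definition unit_step :: "real \<Rightarrow> real \<Rightarrow> real \<Rightarrow> real" where
  "unit_step x y v = (if y \<le> 0 then 0 else cts_step x y (min v (y / (1 + y)) / (1 - min v (y / (1 + y)))))"

lemma cts_step_continuous: "x < y \<Longrightarrow> continuous_on A (cts_step x y)"
  using cts_step_uniformly_continuous[of x y] uniformly_continuous_imp_continuous continuous_on_subset by blast

lemma unit_step_continuous:
  assumes "x < y" shows "continuous_on A (unit_step x y)"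
proof (cases "y \<le> 0")
  case False
  have "1 - min v (y / (1 + y)) \<noteq> 0" for v
  proof -
    have "y / (1 + y) < 1" using False by simp
    then show ?thesis by linarith
  qed
  then have "continuous_on A (\<lambda>v. cts_step x y (min v (y / (1 + y)) / (1 - min v (y / (1 + y)))))"
    by (intro continuous_on_compose2[OF cts_step_continuous[OF assms, of UNIV]] continuous_intros) auto
  then show ?thesis using False by (simp add: unit_step_def[abs_def])
qed (simp add: unit_step_def[abs_def])

text \<open>The clamp at \<open>y / (1 + y)\<close> keeps \<open>v / (1 - v)\<close> finite and
  takes effect only for \<open>s > y\<close>, where the step is already 0. For
  \<open>y \<le> 0\<close> the step vanishes at every \<open>s \<ge> 0\<close>.\<close>

lemma unit_step_eq:
  assumes "x < y" "0 \<le> s"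
  shows "unit_step x y (s / (1 + s)) = cts_step x y s"
proof (cases "y \<le> 0")
  case True
  then show ?thesis using assms by (simp add: unit_step_def cts_step_def)
next
  case y: False
  have inv: "a / (1 + a) / (1 - a / (1 + a)) = a" if "0 \<le> a" for a :: real
  proof -
    have "1 - a / (1 + a) = 1 / (1 + a)" using that by (simp add: field_simps)
    then show ?thesis using that by simp
  qed
  show ?thesis
  proof (cases "s \<le> y")
    case True
    then have "s / (1 + s) \<le> y / (1 + y)" using assms y by (simp add: frac_le_eq divide_le_eq pos_divide_le_eq field_simps)
    then have "min (s / (1 + s)) (y / (1 + y)) = s / (1 + s)" by simp
    then show ?thesis using y inv[OF assms(2)] by (simp add: unit_step_def)
  next
    case False
    then have "y / (1 + y) \<le> s / (1 + s)" using assms y by (simp add: field_simps)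
    then have "min (s / (1 + s)) (y / (1 + y)) = y / (1 + y)" by simp
    then show ?thesis using y inv[of y] False assms(1) by (simp add: unit_step_def cts_step_def)
  qed
qed

text \<open>For \<open>d > 0\<close> the coordinate of \<open>1 / d\<close> is
  \<open>1 / (1 + d)\<close>, the same \<open>u\<close> as for the resolvents. A zero eigenvalue has
  \<open>u = 1\<close>, but its pseudo-inverse 0 has coordinate 0; the last term repairs this, and
  makes the fraction of zeros a separate quantity to control.\<close>

lemma average_cts_step:
  assumes p: "0 < p" and d: "\<And>i. i < p \<Longrightarrow> 0 \<le> d i" and xy: "x < y"
  shows "(\<Sum>i<p. cts_step x y (inverse (d i))) / real p
    = unit_average p d (unit_step x y) + (real (card {i. i < p \<and> d i = 0}) / real p) * (unit_step x y 0 - unit_step x y 1)"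
proof -
  let ?f = "unit_step x y"
  have "cts_step x y (inverse (d i)) = ?f (1 / (1 + d i)) + (if d i = 0 then ?f 0 - ?f 1 else 0)" if "i < p" for i
  proof (cases "d i = 0")
    case True
    then show ?thesis using unit_step_eq[OF xy, of 0] by simp
  next
    case False
    then have "inverse (d i) / (1 + inverse (d i)) = 1 / (1 + d i)"
      using d[OF that] by (simp add: field_simps)
    then show ?thesis using unit_step_eq[OF xy, of "inverse (d i)"] d[OF that] False by simp
  qed
  then have "(\<Sum>i<p. cts_step x y (inverse (d i))) = (\<Sum>i<p. ?f (1 / (1 + d i)) + (if d i = 0 then ?f 0 - ?f 1 else 0))"
    by (intro sum.cong) auto
  also have "\<dots> = (\<Sum>i<p. ?f (1 / (1 + d i))) + real (card {i. i < p \<and> d i = 0}) * (?f 0 - ?f 1)"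
    by (simp add: sum.distrib sum.If_cases Int_def lessThan_def)
  finally show ?thesis by (simp add: unit_average_def add_divide_distrib)
qed

context mp_params
begin

lemma limit_cts_step:
  assumes xy: "x < y"
  shows "integral\<^sup>L limit_law (cts_step x y)
    = limit_functional (unit_step x y) + (1 - 1 / c) * (unit_step x y 0 - unit_step x y 1)"
proof -
  have l: "0 < location \<theta>" for \<theta> by (rule location_pos)
  have "integral\<^sup>L limit_law (cts_step x y)
    = integral {0..pi} (\<lambda>\<theta>. weight \<theta> *\<^sub>R cts_step x y (inverse (location \<theta>))) + (1 - 1 / c) *\<^sub>R cts_step x y 0"
  proof (rule angle_integral(2))
    have "location \<theta> \<noteq> 0" for \<theta> using l[of \<theta>] by simp
    then show "continuous_on {0..pi} (\<lambda>\<theta>. cts_step x y (inverse (location \<theta>)))"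
      by (intro continuous_on_compose2[OF cts_step_continuous[OF xy, of UNIV]] continuous_intros location_continuous) auto
    show "cts_step x y \<in> borel_measurable borel"
      by (intro borel_measurable_continuous_onI cts_step_continuous xy)
  qed
  moreover have "cts_step x y (inverse (location \<theta>)) = unit_step x y (1 / (1 + location \<theta>))" for \<theta>
  proof -
    have "inverse (location \<theta>) / (1 + inverse (location \<theta>)) = 1 / (1 + location \<theta>)"
      using l[of \<theta>] by (simp add: field_simps)
    then show ?thesis using unit_step_eq[OF xy, of "inverse (location \<theta>)"] l[of \<theta>] by simp
  qed
  moreover have "cts_step x y 0 = unit_step x y 0" using unit_step_eq[OF xy, of 0] by simp
  ultimately show ?thesis by (simp add: limit_functional_def algebra_simps)
qed

text \<open>A deterministic statement, applied to each outcome outside the null set: the resolvent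
  averages settle all continuous functions of \<open>u\<close>, and the fraction of zero eigenvalues
  settles the jump at 0.\<close>

lemma weak_conv_inverse_eigenvalues:
  fixes p :: "nat \<Rightarrow> nat" and d :: "nat \<Rightarrow> nat \<Rightarrow> real"
  assumes p: "\<forall>\<^sub>F n in sequentially. 0 < p n"
    and d: "\<And>n i. i < p n \<Longrightarrow> 0 \<le> d n i"
    and res: "\<And>j::nat. (\<lambda>n. (\<Sum>i<p n. 1 / (d n i + (1 + inverse (real (Suc j))))) / real (p n))
      \<longlonglongrightarrow> integral\<^sup>L limit_law (\<lambda>x. 1 / (inverse x + (1 + inverse (real (Suc j)))))"
    and zeros: "\<forall>\<^sub>F n in sequentially. 1 - real n / real (p n) \<le> real (card {i. i < p n \<and> d n i = 0}) / real (p n)"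
    and ratio: "(\<lambda>n. real n / real (p n)) \<longlonglongrightarrow> 1 / c"
  shows "weak_conv (\<lambda>n t. real (card {i. i < p n \<and> inverse (d n i) \<le> t}) / real (p n)) (cdf limit_law)"
proof -
  interpret converging_functionals "\<lambda>n. unit_average (p n) (d n)" limit_functional
  proof
    show "\<forall>\<^sub>F n in sequentially. unit_functional (unit_average (p n) (d n))"
      using p by eventually_elim (rule unit_functional_average[OF _ d])
  qed (rule unit_functional_limit)
  have base: "conv (\<lambda>u. u / (1 + inverse (real (Suc j)) * u))" for j :: nat
  proof -
    define s where "s = inverse (real (Suc j))"
    have s: "0 < s" by (simp add: s_def)
    have "1 / (1 + a) / (1 + s * (1 / (1 + a))) = 1 / (a + (1 + s))" if "0 \<le> a" for a
      using that s by (simp add: divide_simps add_nonneg_eq_0_iff)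
    then have "unit_average (p n) (d n) (\<lambda>u. u / (1 + s * u)) = (\<Sum>i<p n. 1 / (d n i + (1 + s))) / real (p n)" for n
      unfolding unit_average_def using d by (intro arg_cong[where f = "\<lambda>a. a / real (p n)"] sum.cong) auto
    moreover have "continuous_on {0..1} (\<lambda>u. u / (1 + s * u))"
      using s by (intro continuous_intros) (auto simp: add_nonneg_eq_0_iff)
    ultimately show ?thesis
      using res[of j] limit_functional_resolvent[OF s] by (simp add: conv_def s_def)
  qed
  note conv = conv_continuous[OF base]
  define Z where "Z n = real (card {i. i < p n \<and> d n i = 0}) / real (p n)" for n
  \<comment> \<open>A zero eigenvalue has \<open>u = 1\<close>, so it contributes 1 to every power
    average; the others contribute nonnegative amounts.\<close>
  have Z_le: "Z n \<le> unit_average (p n) (d n) (\<lambda>u. u ^ k)" for n k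
  proof -
    have "real (card {i. i < p n \<and> d n i = 0}) = (\<Sum>i<p n. if d n i = 0 then 1 else 0)"
      by (simp add: sum.If_cases Int_def lessThan_def)
    also have "\<dots> \<le> (\<Sum>i<p n. (1 / (1 + d n i)) ^ k)"
      using d by (intro sum_mono) auto
    finally show ?thesis by (simp add: Z_def unit_average_def divide_right_mono)
  qed
  \<comment> \<open>The lower bound is the rank bound. For the upper bound \<open>k\<close> is
    chosen first, so that the limiting \<open>k\<close>-th power average is below \<open>a\<close>,
    and then \<open>n\<close> is sent to infinity.\<close>
  have Z_lim: "Z \<longlonglongrightarrow> 1 - 1 / c"
  proof (rule order_tendstoI)
    fix a assume "a < 1 - 1 / c"
    moreover have "(\<lambda>n. 1 - real n / real (p n)) \<longlonglongrightarrow> 1 - 1 / c"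
      by (intro tendsto_intros ratio)
    ultimately have "\<forall>\<^sub>F n in sequentially. a < 1 - real n / real (p n)"
      by (intro order_tendstoD(1)) auto
    then show "\<forall>\<^sub>F n in sequentially. a < Z n"
      using zeros by eventually_elim (simp add: Z_def)
  next
    fix a assume a: "1 - 1 / c < a"
    have "(\<lambda>k. (1 / c) * (1 / (1 + (m - h))) ^ k + (1 - 1 / c)) \<longlonglongrightarrow> (1 / c) * 0 + (1 - 1 / c)"
      using h_less_m by (intro tendsto_intros LIMSEQ_power_zero) simp
    then have "\<forall>\<^sub>F k in sequentially. (1 / c) * (1 / (1 + (m - h))) ^ k + (1 - 1 / c) < a"
      by (rule order_tendstoD(2)) (use a in simp)
    then obtain k where "(1 / c) * (1 / (1 + (m - h))) ^ k + (1 - 1 / c) < a"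
      using eventually_happens by force
    then have "limit_functional (\<lambda>u. u ^ k) < a" using limit_functional_power_le[of k] by linarith
    moreover have "conv (\<lambda>u. u ^ k)" by (rule conv) (intro continuous_intros)
    ultimately have "\<forall>\<^sub>F n in sequentially. unit_average (p n) (d n) (\<lambda>u. u ^ k) < a"
      by (intro order_tendstoD(2)) (auto simp: conv_def)
    then show "\<forall>\<^sub>F n in sequentially. Z n < a"
      by eventually_elim (use Z_le[of _ k] in \<open>blast intro: le_less_trans\<close>)
  qed
  \<comment> \<open>The uniform law on the indices makes \<open>N n\<close> a probability law for
    every \<open>n\<close>; for \<open>p n = 0\<close> it is arbitrary, which happens only for
    finitely many \<open>n\<close>.\<close>
  define N where "N n = distr (measure_pmf (pmf_of_set {..<p n})) borel (\<lambda>i. inverse (d n i))" for n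
  have N: "real_distribution (N n)" for n
    unfolding N_def by (intro prob_space.real_distribution_distr measure_pmf.prob_space_axioms) simp
  have N_int: "integral\<^sup>L (N n) (cts_step x y) = (\<Sum>i<p n. cts_step x y (inverse (d n i))) / real (p n)"
    if "0 < p n" "x < y" for n x y
  proof -
    have "{..<p n} \<noteq> {}" using that by auto
    moreover have "cts_step x y \<in> borel_measurable borel"
      by (intro borel_measurable_continuous_onI cts_step_continuous that)
    ultimately show ?thesis
      unfolding N_def by (simp add: integral_distr integral_pmf_of_set)
  qed
  have N_cdf: "cdf (N n) t = real (card {i. i < p n \<and> inverse (d n i) \<le> t}) / real (p n)" if "0 < p n" for n t
  proof -
    have ne: "{..<p n} \<noteq> {}" using that by auto
    have "cdf (N n) t = measure (measure_pmf (pmf_of_set {..<p n})) {i. inverse (d n i) \<le> t}"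
      unfolding cdf_def N_def by (subst measure_distr) (auto simp: vimage_def)
    also have "\<dots> = real (card ({..<p n} \<inter> {i. inverse (d n i) \<le> t})) / real (card {..<p n})"
      using ne by (intro measure_pmf_of_set) auto
    finally show ?thesis by (simp add: Int_def)
  qed
  have "weak_conv_m N limit_law"
  proof (rule integral_cts_step_conv_imp_weak_conv[OF N real_distribution_limit_law])
    fix x y :: real assume xy: "x < y"
    have cont: "continuous_on {0..1} (unit_step x y)" by (rule unit_step_continuous[OF xy])
    have "(\<lambda>n. unit_average (p n) (d n) (unit_step x y) + Z n * (unit_step x y 0 - unit_step x y 1))
      \<longlonglongrightarrow> limit_functional (unit_step x y) + (1 - 1 / c) * (unit_step x y 0 - unit_step x y 1)"
      using conv[OF cont] by (intro tendsto_intros Z_lim) (auto simp: conv_def)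
    moreover have "\<forall>\<^sub>F n in sequentially. unit_average (p n) (d n) (unit_step x y) + Z n * (unit_step x y 0 - unit_step x y 1)
      = integral\<^sup>L (N n) (cts_step x y)"
      using p by eventually_elim (simp add: N_int xy average_cts_step[OF _ d] Z_def)
    ultimately show "(\<lambda>n. integral\<^sup>L (N n) (cts_step x y)) \<longlonglongrightarrow> integral\<^sup>L limit_law (cts_step x y)"
      unfolding limit_cts_step[OF xy] by (rule Lim_transform_eventually)
  qed
  then have "(\<lambda>n. cdf (N n) t) \<longlonglongrightarrow> cdf limit_law t" if "isCont (cdf limit_law) t" for t
    using that by (simp add: weak_conv_m_def weak_conv_def)
  moreover have "\<forall>\<^sub>F n in sequentially. cdf (N n) t = real (card {i. i < p n \<and> inverse (d n i) \<le> t}) / real (p n)" for t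
    using p by eventually_elim (rule N_cdf)
  ultimately show ?thesis
    unfolding weak_conv_def by (blast intro: Lim_transform_eventually)
qed

end

subsection \<open>The theorem\<close>

text \<open>One diagonalisation serves both the resolvent traces and the spectrum of the
  pseudo-inverse, so the two are expressed through the same \<open>d\<close>.\<close>

lemma gram_spectrum:
  assumes s: "0 \<le> s"
  obtains d where "\<And>i. i < p \<Longrightarrow> 0 \<le> d i"
    "\<And>t. 0 < t \<Longrightarrow> mtrace (resolvent t (gram p s J x)) = (\<Sum>i<p. 1 / (d i + t))"
    "\<And>a t. esd (moore_penrose (a \<cdot>\<^sub>m gram p s J x)) t = real (card {i. i < p \<and> inverse (a * d i) \<le> t}) / real p"
proof -
  let ?A = "gram p s J x"
  have "transpose_mat ?A = ?A" by (rule eq_matI) (auto simp: gram_def mult.commute)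
  then obtain U d where U: "U \<in> carrier_mat p p" "U * transpose_mat U = 1\<^sub>m p" "transpose_mat U * U = 1\<^sub>m p"
    and A: "?A = U * mat_diag p d * transpose_mat U"
    using symmetric_spectral_decomposition[of ?A p] by auto
  have "a \<cdot>\<^sub>m ?A = U * mat_diag p (\<lambda>i. a * d i) * transpose_mat U" for a
  proof -
    have "mat_diag p (\<lambda>i. a * d i) = a \<cdot>\<^sub>m mat_diag p d"
      by (rule eq_matI) (auto simp: mat_diag_def)
    then show ?thesis
      unfolding A using U(1) by (simp add: mult_smult_distrib[of _ p p _ p] mult_smult_assoc_mat[of _ p p _ p] mult_carrier_mat[of _ p p _ p])
  qed
  then have "esd (moore_penrose (a \<cdot>\<^sub>m ?A)) t = real (card {i. i < p \<and> inverse (a * d i) \<le> t}) / real p" for a t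
    by (simp only: moore_penrose_conjugate_diag[OF U] esd_conjugate_diag[OF U])
  moreover have "0 \<le> d i" if "i < p" for i
    using psd_shift.R_spectral(1)[OF psd_shift_gram[OF s, of 1] U A that] by simp
  moreover have "mtrace (resolvent t ?A) = (\<Sum>i<p. 1 / (d i + t))" if "0 < t" for t
    by (rule psd_shift.R_spectral(2)[OF psd_shift_gram[OF s that] U A])
  ultimately show ?thesis by (rule that[rotated 2])
qed

text \<open>The trace identity bounds the sum of \<open>d i / (d i + t)\<close> by \<open>n\<close>; letting \<open>t\<close> tend to 0 counts the
  nonzero eigenvalues.\<close>
lemma gram_zero_eigenvalues:
  assumes n: "0 < n" and d: "\<And>i. i < p \<Longrightarrow> 0 \<le> d i"
    and tr: "\<And>t. 0 < t \<Longrightarrow> mtrace (resolvent t (gram p (1 / real n) {..<n} x)) = (\<Sum>i<p. 1 / (d i + t))"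
  shows "real p - real n \<le> real (card {i. i < p \<and> d i = 0})"
proof -
  have bound: "real p - real n \<le> (\<Sum>i<p. t / (d i + t))" if t: "0 < t" for t
  proof -
    let ?R = "resolvent t (gram p (1 / real n) {..<n} x)"
    have "(\<Sum>j<n. (1 / real n) * (colvec p x j \<bullet> (?R *\<^sub>v colvec p x j))) \<le> (\<Sum>j<n. 1)"
    proof (rule sum_mono)
      fix j assume "j \<in> {..<n}"
      then have j: "j < n" by simp
      have le_1: "q / (1 + q) \<le> 1" if "0 \<le> q" for q :: real using that by simp
      note r = gram_trace_remove_column(1,2)[OF t n j, of p x]
      show "(1 / real n) * (colvec p x j \<bullet> (?R *\<^sub>v colvec p x j)) \<le> 1"
        unfolding r(2) by (rule le_1[OF r(1)])
    qed
    moreover have "(\<Sum>j<n. (1 / real n) * (colvec p x j \<bullet> (?R *\<^sub>v colvec p x j))) + t * mtrace ?R = real p"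
      by (rule gram_trace_identity) (use t in auto)
    moreover have "t * mtrace ?R = (\<Sum>i<p. t / (d i + t))"
      by (simp add: tr[OF t] sum_distrib_left)
    ultimately show ?thesis by simp
  qed
  let ?t = "\<lambda>k. inverse (real (Suc k))"
  have "(\<lambda>k. \<Sum>i<p. ?t k / (d i + ?t k)) \<longlonglongrightarrow> (\<Sum>i<p. if d i = 0 then 1 else 0)"
  proof (rule tendsto_sum)
    fix i
    show "(\<lambda>k. ?t k / (d i + ?t k)) \<longlonglongrightarrow> (if d i = 0 then 1 else 0)"
    proof (cases "d i = 0")
      case False
      then have "(\<lambda>k. ?t k / (d i + ?t k)) \<longlonglongrightarrow> 0 / (d i + 0)"
        by (intro tendsto_intros LIMSEQ_inverse_real_of_nat) auto
      then show ?thesis using False by simp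
    qed simp
  qed
  then have "real p - real n \<le> (\<Sum>i<p. if d i = 0 then 1 else 0)"
    by (rule LIMSEQ_le_const) (use bound in auto)
  also have "\<dots> = real (card {i. i < p \<and> d i = 0})"
    by (simp add: sum.If_cases Int_def lessThan_def)
  finally show ?thesis .
qed

theorem corollary2p1:
  fixes M :: "'a measure"
    and X :: "nat \<Rightarrow> nat \<Rightarrow> nat \<Rightarrow> 'a \<Rightarrow> real"
    and \<mu> :: "real measure"
    and p :: "nat \<Rightarrow> nat"
    and \<sigma> c :: real
  assumes "prob_space M"
    and indep: "\<And>n. prob_space.indep_vars M (\<lambda>_. borel) (\<lambda>(i, j). X n i j) ({..<p n} \<times> {..<n})"
    and ident: "\<And>n i j. i < p n \<Longrightarrow> j < n \<Longrightarrow> distr M borel (X n i j) = \<mu>"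
    and mean: "\<And>n i j. i < p n \<Longrightarrow> j < n \<Longrightarrow>
                 integrable M (X n i j) \<and> prob_space.expectation M (X n i j) = 0"
    and var: "\<And>n i j. i < p n \<Longrightarrow> j < n \<Longrightarrow> prob_space.variance M (X n i j) = 1"
    and sigma: "\<sigma>\<^sup>2 > 0"
    and ratio: "(\<lambda>n. real (p n) / real n) \<longlonglongrightarrow> c"
    and c: "1 < c"
  shows "\<exists>P. real_distribution P \<and>
    (AE \<omega> in M.
       weak_conv
         (\<lambda>n. esd (moore_penrose
                (sample_cov (\<sigma>\<^sup>2 \<cdot>\<^sub>m 1\<^sub>m (p n)) (Matrix.mat (p n) n (\<lambda>(i, j). X n i j \<omega>)))))
         (cdf P)) \<and>
    (\<exists>r. mP_branch c \<sigma> r) \<and>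
    (\<forall>r. mP_branch c \<sigma> r \<longrightarrow>
       (\<forall>z. 0 < Im z \<longrightarrow> stieltjes_transform P z = mP c \<sigma> r z)) \<and>
    (\<forall>A \<in> sets borel. emeasure P A =
       ennreal (1 - inverse c) * emeasure (return borel 0) A
       + emeasure (density lborel (\<lambda>x. ennreal (nu c \<sigma> x))) A)"
proof -
  interpret M: prob_space M by fact
  have \<sigma>: "\<sigma> \<noteq> 0" using sigma by auto
  interpret mp_params c \<sigma> by unfold_locales (use c \<sigma> in auto)
  have c0: "0 < c" using c by simp
  have good: "\<forall>\<^sub>F n in sequentially. 0 < p n \<and> 0 < n"
  proof -
    have "\<forall>\<^sub>F n in sequentially. 0 < real (p n) / real n" by (rule order_tendstoD(1)[OF ratio c0])
    then show ?thesis by eventually_elim (auto simp: zero_less_divide_iff)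
  qed
  have "standardized_entries \<mu>"
  proof -
    \<comment> \<open>Some \<open>n\<close> has a nonempty matrix; the properties of
      \<open>\<mu>\<close> are read off from its entry \<open>(0, 0)\<close>.\<close>
    obtain n where n: "0 < p n" "0 < n" using good eventually_happens by force
    let ?X = "X n 0 0"
    have rv [measurable]: "?X \<in> borel_measurable M" using mean[OF n] by auto
    have \<mu>: "\<mu> = distr M borel ?X" using ident[OF n] by simp
    have E0: "M.expectation ?X = 0" using mean[OF n] by simp
    then have E2: "(\<integral>\<omega>. (?X \<omega>)\<^sup>2 \<partial>M) = 1" using var[OF n] by simp
    \<comment> \<open>A function that is not integrable has Bochner integral 0; here the integral is
      1.\<close>
    then have "integrable M (\<lambda>\<omega>. (?X \<omega>)\<^sup>2)" using not_integrable_integral_eq by fastforce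
    then have int: "integrable M ?X" "integrable M (\<lambda>\<omega>. (?X \<omega>)\<^sup>2)" using mean[OF n] by simp_all
    show ?thesis
      unfolding standardized_entries_def iid_product_def standardized_entries_axioms_def
    proof (intro conjI)
      show "prob_space \<mu>" unfolding \<mu> by (rule M.prob_space_distr[OF rv])
      show "sets \<mu> = sets borel" unfolding \<mu> by simp
      show "integrable \<mu> (\<lambda>y. y)" "integrable \<mu> (\<lambda>y. y\<^sup>2)"
        unfolding \<mu> using int by (subst integrable_distr_eq; simp)+
      show "(\<integral>y. y \<partial>\<mu>) = 0" unfolding \<mu> using E0 by (subst integral_distr) simp_all
      show "(\<integral>y. y\<^sup>2 \<partial>\<mu>) = 1" unfolding \<mu> using E2 by (subst integral_distr) simp_all
    qed
  qed
  then interpret standardized_entries \<mu> .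
  define G where "G n t \<omega> = gram_trace (p n) n t (\<lambda>(i, j). X n i j \<omega>)" for n t \<omega>
  \<comment> \<open>The shift \<open>1 + s\<close> with \<open>s = 1 / (j + 1)\<close>, which
    corresponds to the test function \<open>u / (1 + s * u)\<close>.\<close>
  define T where "T j = 1 + inverse (real (Suc j))" for j
  have T: "0 < T j" for j by (simp add: T_def add_pos_pos)
  define g where "g j = \<sigma>\<^sup>2 * c * integral\<^sup>L limit_law (\<lambda>x. 1 / (inverse x + T j))" for j
  have "AE \<omega> in M. \<forall>j. (\<lambda>n. G n (T j / \<sigma>\<^sup>2) \<omega>) \<longlonglongrightarrow> g j"
  proof (subst AE_all_countable, intro allI)
    fix j
    show "AE \<omega> in M. (\<lambda>n. G n (T j / \<sigma>\<^sup>2) \<omega>) \<longlonglongrightarrow> g j"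
      unfolding G_def g_def
      by (rule AE_gram_trace_tendsto[OF M.prob_space_axioms indep ident ratio c0 _ limit_law_resolvent_equation[OF T]])
        (use T[of j] sigma in auto)
  qed
  then have "AE \<omega> in M. weak_conv
         (\<lambda>n. esd (moore_penrose
                (sample_cov (\<sigma>\<^sup>2 \<cdot>\<^sub>m 1\<^sub>m (p n)) (Matrix.mat (p n) n (\<lambda>(i, j). X n i j \<omega>)))))
         (cdf limit_law)"
  proof eventually_elim
    case (elim \<omega>)
    let ?A = "\<lambda>n. gram (p n) (1 / real n) {..<n} (\<lambda>(i, j). X n i j \<omega>)"
    \<comment> \<open>Bundles what is known about the spectrum, so that one choice function provides
      the eigenvalues for all \<open>n\<close> at the given outcome.\<close>
    define Q where "Q n d \<longleftrightarrow> (\<forall>i<p n. 0 \<le> d i) \<and> (\<forall>t>0. mtrace (resolvent t (?A n)) = (\<Sum>i<p n. 1 / (d i + t))) \<and>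
      (\<forall>a t. esd (moore_penrose (a \<cdot>\<^sub>m ?A n)) t = real (card {i. i < p n \<and> inverse (a * d i) \<le> t}) / real (p n))"
      for n and d :: "nat \<Rightarrow> real"
    have "\<exists>d. Q n d" for n
      unfolding Q_def
      by (rule gram_spectrum[of "1 / real n" "p n" "{..<n}" "\<lambda>(i, j). X n i j \<omega>"]) auto
    then obtain d where Q: "\<And>n. Q n (d n)" using choice[of Q] by blast
    have d: "\<And>n i. i < p n \<Longrightarrow> 0 \<le> d n i"
      and tr: "\<And>n t. 0 < t \<Longrightarrow> mtrace (resolvent t (?A n)) = (\<Sum>i<p n. 1 / (d n i + t))"
      and esd: "\<And>n a t. esd (moore_penrose (a \<cdot>\<^sub>m ?A n)) t = real (card {i. i < p n \<and> inverse (a * d n i) \<le> t}) / real (p n)"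
      using Q unfolding Q_def by blast+
    have ratio': "(\<lambda>n. real n / real (p n)) \<longlonglongrightarrow> 1 / c"
      using tendsto_divide[OF tendsto_const ratio, of 1] c0 by simp
    have "weak_conv (\<lambda>n t. real (card {i. i < p n \<and> inverse (\<sigma>\<^sup>2 * d n i) \<le> t}) / real (p n)) (cdf limit_law)"
    proof (rule weak_conv_inverse_eigenvalues)
      show "\<forall>\<^sub>F n in sequentially. 0 < p n" using good by eventually_elim simp
      show "0 \<le> \<sigma>\<^sup>2 * d n i" if "i < p n" for n i using d[OF that] by simp
      show "(\<lambda>n. real n / real (p n)) \<longlonglongrightarrow> 1 / c" by (rule ratio')
      show "\<forall>\<^sub>F n in sequentially. 1 - real n / real (p n) \<le> real (card {i. i < p n \<and> \<sigma>\<^sup>2 * d n i = 0}) / real (p n)"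
        using good
      proof eventually_elim
        case (elim n)
        then have "real (p n) - real n \<le> real (card {i. i < p n \<and> d n i = 0})"
          using gram_zero_eigenvalues[of n "p n" "d n", OF _ d tr] by blast
        then have "(real (p n) - real n) / real (p n) \<le> real (card {i. i < p n \<and> d n i = 0}) / real (p n)"
          by (rule divide_right_mono) simp
        then show ?case using elim \<sigma> by (simp add: diff_divide_distrib)
      qed
      fix j :: nat
      \<comment> \<open>Moves the variance into the shift: \<open>1 / (\<sigma>^2 d + T)\<close> is
        \<open>1 / \<sigma>^2\<close> times \<open>1 / (d + T / \<sigma>^2)\<close>. The factor
        \<open>n / p n\<close> turns the normalisation of \<open>gram_trace\<close> into an average
        over eigenvalues.\<close>
      have "(\<Sum>i<p n. 1 / (\<sigma>\<^sup>2 * d n i + T j)) / real (p n) = (1 / \<sigma>\<^sup>2) * (real n / real (p n)) * G n (T j / \<sigma>\<^sup>2) \<omega>"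
        if "0 < n" for n
      proof -
        have "1 / (\<sigma>\<^sup>2 * d n i + T j) = (1 / \<sigma>\<^sup>2) * (1 / (d n i + T j / \<sigma>\<^sup>2))" for i
          using \<sigma> by (simp add: field_simps)
        then have "(\<Sum>i<p n. 1 / (\<sigma>\<^sup>2 * d n i + T j)) = (1 / \<sigma>\<^sup>2) * mtrace (resolvent (T j / \<sigma>\<^sup>2) (?A n))"
          using T[of j] sigma by (simp add: tr sum_distrib_left)
        then show ?thesis using that by (simp add: G_def gram_trace_def)
      qed
      then have "\<forall>\<^sub>F n in sequentially. (1 / \<sigma>\<^sup>2) * (real n / real (p n)) * G n (T j / \<sigma>\<^sup>2) \<omega>
        = (\<Sum>i<p n. 1 / (\<sigma>\<^sup>2 * d n i + T j)) / real (p n)"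
        using good by (auto elim: eventually_mono)
      moreover have "(\<lambda>n. (1 / \<sigma>\<^sup>2) * (real n / real (p n)) * G n (T j / \<sigma>\<^sup>2) \<omega>) \<longlonglongrightarrow> (1 / \<sigma>\<^sup>2) * (1 / c) * g j"
        using elim by (intro tendsto_intros ratio') auto
      moreover have "(1 / \<sigma>\<^sup>2) * (1 / c) * g j = integral\<^sup>L limit_law (\<lambda>x. 1 / (inverse x + T j))"
        using \<sigma> c0 by (simp add: g_def)
      ultimately have "(\<lambda>n. (\<Sum>i<p n. 1 / (\<sigma>\<^sup>2 * d n i + T j)) / real (p n))
        \<longlonglongrightarrow> integral\<^sup>L limit_law (\<lambda>x. 1 / (inverse x + T j))"
        by (simp only: Lim_transform_eventually)
      then show "(\<lambda>n. (\<Sum>i<p n. 1 / (\<sigma>\<^sup>2 * d n i + (1 + inverse (real (Suc j))))) / real (p n))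
        \<longlonglongrightarrow> integral\<^sup>L limit_law (\<lambda>x. 1 / (inverse x + (1 + inverse (real (Suc j)))))"
        by (simp only: T_def)
    qed
    moreover have "esd (moore_penrose (sample_cov (\<sigma>\<^sup>2 \<cdot>\<^sub>m 1\<^sub>m (p n)) (Matrix.mat (p n) n (\<lambda>(i, j). X n i j \<omega>))))
      = (\<lambda>t. real (card {i. i < p n \<and> inverse (\<sigma>\<^sup>2 * d n i) \<le> t}) / real (p n))" for n
      by (rule ext) (simp only: sample_cov_scaled_identity[OF \<sigma>] esd)
    ultimately show ?case by simp
  qed
  then show ?thesis
    using real_distribution_limit_law mP_branch_sqrt_branch stieltjes_limit_law_branch emeasure_limit_law by blast
qed

end
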